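(* Let $f:X\to X$ be a Lipschitz (not necessarily invertible) map on a compact metric space $(X,d)$, and let $\mu$ be an $f$-invariant ergodic Borel probability measure. Let $(\mathcal{B},\|\cdot\|)$ be a separable infinite-dimensional Banach space, and let $\mathcal{A}$ be the linear cocycle over $f$ generated by a quasi-compact, $\nu$-Hölder continuous map $A:X\to L(\mathcal{B})$. Let $\mathcal{B}=V_1(x)\supset V_2(x)\supset\cdots\supset V_{k+1}(x)$ ($k\in\mathbb{N}\cup\{\infty\}$) be the Oseledets filtration, defined for $\mu$-almost every $x$. Then for every $\gamma>0$ and every $i$ (that is, $i\in\{1,\dots,k+1\}$ if $k<\infty$, and $i\in\mathbb{N}$ if $k=\infty$) there exists a compact subset $\Lambda_\gamma\subset X$ with $\mu(\Lambda_\gamma)>1-\gamma$ such that the map $x\mapsto V_i(x)$ is (locally) Hölder continuous on $\Lambda_\gamma$; i.e. there are constants $C>0$, $\theta>0$ and $\delta>0$ such that $$\hat d(V_i(x),V_i(y))\le C\,d(x,y)^{\theta}\quad\text{for all }x,y\in\Lambda_\gamma\text{ with }d(x,y)<\delta.$$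
   Context: $L(\mathcal{B})$ is the space of bounded linear operators on $\mathcal{B}$ with the operator norm; $A$ is $\nu$-Hölder ($\nu>0$) if $\|A(x)-A(y)\|\le c\,d(x,y)^\nu$ for some constant $c$ and all $x,y\in X$. The cocycle is $\mathcal{A}(x,n)=A(f^{n-1}(x))\circ\cdots\circ A(x)$ for $n>0$, $\mathcal{A}(x,0)=\mathrm{Id}$. For a bounded operator $T$, $\|T\|_\alpha$ is the infimum of $r>0$ such that the image under $T$ of the unit ball of $\mathcal{B}$ can be covered by finitely many balls of radius $r$. The limits $\lambda(A,\mu)=\lim_n\frac1n\log\|\mathcal{A}(x,n)\|$ and $\alpha(A,\mu)=\lim_n\frac1n\log\|\mathcal{A}(x,n)\|_\alpha$ exist and are constant for $\mu$-a.e. $x$; $A$ is quasi-compact if $\alpha(A,\mu)<\lambda(A,\mu)$. One-sided multiplicative ergodic theorem (Doan), which defines the filtration: there exist an $f$-invariant set $X_0\subset X$ of full $\mu$-measure and $k\in\mathbb{N}\cup\{\infty\}$ numbers $\lambda_1>\lambda_2>\cdots>\alpha(A,\mu)$ (ending at $\lambda_k$ if $k<\infty$, in which case put $\lambda_{k+1}=\alpha(A,\mu)$; satisfying $\lim_i\lambda_i=\alpha(A,\mu)$ if $k=\infty$), and for every $x\in X_0$ a filtration $\mathcal{B}=V_1(x)\supset V_2(x)\supset\cdots$ (ending at $V_{k+1}(x)$ if $k<\infty$) by closed subspaces of finite codimension, the codimension being constant in $x$, such that $A(x)V_i(x)\subset V_i(f(x))$, and for each $i$ ($1\le i\le k$ if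 $k<\infty$, $i\in\mathbb{N}$ if $k=\infty$): $\lim_{n\to\infty}\frac1n\log\|\mathcal{A}(x,n)u\|=\lambda_i$ for every $u\in V_i(x)\setminus V_{i+1}(x)$, and $\limsup_{n\to\infty}\frac1n\log\|\mathcal{A}(x,n)|_{V_{i+1}(x)}\|\le\lambda_{i+1}$. The maps $x\mapsto V_i(x)$ are measurable. For non-trivial closed subspaces $E,F$ of $\mathcal{B}$ with unit spheres $S_E,S_F$, $\hat d(E,F)=\max\{\sup_{v\in S_E}\operatorname{dist}(v,S_F),\ \sup_{v\in S_F}\operatorname{dist}(v,S_E)\}$, where $\operatorname{dist}(v,S)=\inf_{u\in S}\|v-u\|$. *)

theory Defs
  imports "HOL-Analysis.Analysis"
begin

definition ergodic_invariant_measure :: "'a::topological_space measure \<Rightarrow> ('a \<Rightarrow> 'a) \<Rightarrow> bool" where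
  "ergodic_invariant_measure M f \<longleftrightarrow>
     sets M = sets borel \<and> emeasure M (space M) = 1 \<and>
     f \<in> measurable M M \<and> distr M M f = M \<and>
     (\<forall>E\<in>sets M. f -` E \<inter> space M = E \<longrightarrow> measure M E = 0 \<or> measure M E = 1)"

primrec cocycle ::
  "('a \<Rightarrow> 'a) \<Rightarrow> ('a \<Rightarrow> ('b::real_normed_vector \<Rightarrow>\<^sub>L 'b)) \<Rightarrow> 'a \<Rightarrow> nat \<Rightarrow> ('b \<Rightarrow>\<^sub>L 'b)" where
  "cocycle f A x 0 = id_blinfun"
| "cocycle f A x (Suc n) = A ((f ^^ n) x) o\<^sub>L cocycle f A x n"

definition holder_map :: "real \<Rightarrow> ('a::metric_space \<Rightarrow> 'b::real_normed_vector) \<Rightarrow> bool" where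
  "holder_map \<nu> A \<longleftrightarrow> (\<exists>c. \<forall>x y. norm (A x - A y) \<le> c * dist x y powr \<nu>)"

text \<open>The norm and the index below may vanish, and the exponents may be \<open>- \<infinity>\<close>; the real
  function \<open>ln\<close> has \<open>ln 0 = 0\<close>, so the logarithm is taken in the extended reals.\<close>

definition elog :: "real \<Rightarrow> ereal" where
  "elog r = (if r \<le> 0 then - \<infinity> else ereal (ln r))"

text \<open>The index \<open>\<parallel>T\<parallel>\<^sub>\<alpha>\<close>. Open or closed (unit) balls give the same infimum.\<close>

definition index_norm :: "('b::real_normed_vector \<Rightarrow>\<^sub>L 'b) \<Rightarrow> real" where
  "index_norm T =
     Inf {r. r > 0 \<and> (\<exists>C. finite C \<and> blinfun_apply T ` cball 0 1 \<subseteq> (\<Union>c\<in>C. ball c r))}"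

text \<open>\<open>has_lyapunov_exponent M f A l\<close> says \<open>\<lambda>(A,\<mu>) = l\<close> and \<open>has_index_exponent M f A a\<close> says
  \<open>\<alpha>(A,\<mu>) = a\<close>, where \<open>M\<close> is \<open>\<mu>\<close>. (The limits exist almost everywhere by the subadditive ergodic
  theorem, and they are unique because \<open>\<mu>\<close> is a probability measure.)\<close>

definition has_lyapunov_exponent ::
  "'a measure \<Rightarrow> ('a \<Rightarrow> 'a) \<Rightarrow> ('a \<Rightarrow> ('b::real_normed_vector \<Rightarrow>\<^sub>L 'b)) \<Rightarrow> ereal \<Rightarrow> bool" where
  "has_lyapunov_exponent M f A l \<longleftrightarrow>
     (AE x in M. (\<lambda>n. elog (norm (cocycle f A x n)) / ereal (real n)) \<longlonglongrightarrow> l)"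

definition has_index_exponent ::
  "'a measure \<Rightarrow> ('a \<Rightarrow> 'a) \<Rightarrow> ('a \<Rightarrow> ('b::real_normed_vector \<Rightarrow>\<^sub>L 'b)) \<Rightarrow> ereal \<Rightarrow> bool" where
  "has_index_exponent M f A a \<longleftrightarrow>
     (AE x in M. (\<lambda>n. elog (index_norm (cocycle f A x n)) / ereal (real n)) \<longlonglongrightarrow> a)"

definition quasi_compact ::
  "'a measure \<Rightarrow> ('a \<Rightarrow> 'a) \<Rightarrow> ('a \<Rightarrow> ('b::real_normed_vector \<Rightarrow>\<^sub>L 'b)) \<Rightarrow> bool" where
  "quasi_compact M f A \<longleftrightarrow>
     (\<exists>a l. has_index_exponent M f A a \<and> has_lyapunov_exponent M f A l \<and> a < l)"

text \<open>\<open>W\<close> has an algebraic complement with a basis of \<open>m\<close> elements.\<close>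

definition has_codimension :: "'b::real_vector set \<Rightarrow> nat \<Rightarrow> bool" where
  "has_codimension W m \<longleftrightarrow>
     (\<exists>B. finite B \<and> card B = m \<and> independent B \<and> span B \<inter> W = {0} \<and> span (W \<union> B) = UNIV)"

text \<open>Operator norm of the restriction of \<open>T\<close> to the subspace \<open>W\<close>.\<close>

definition norm_restrict :: "('b::real_normed_vector \<Rightarrow>\<^sub>L 'b) \<Rightarrow> 'b set \<Rightarrow> real" where
  "norm_restrict T W = (SUP u\<in>{u\<in>W. norm u \<le> 1}. norm (blinfun_apply T u))"

text \<open>The exponents \<open>\<lambda>\<^sub>1 > \<lambda>\<^sub>2 > \<dots>\<close>, extended by \<open>\<lambda>\<close> of index \<open>k + 1\<close> being \<open>\<alpha>(A,\<mu>)\<close> (which may be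
  \<open>- \<infinity>\<close>) if \<open>k\<close> is finite.\<close>

definition exponent :: "enat \<Rightarrow> (nat \<Rightarrow> real) \<Rightarrow> ereal \<Rightarrow> nat \<Rightarrow> ereal" where
  "exponent k lam alpha i = (if enat i \<le> k then ereal (lam i) else alpha)"

text \<open>The data given by the one-sided multiplicative ergodic theorem: full measure invariant set
  \<open>X0\<close>, number \<open>k\<close> of exponents, exponents \<open>lam i\<close> for \<open>1 \<le> i \<le> k\<close> and subspaces \<open>V i x\<close> for
  \<open>x \<in> X0\<close> and \<open>1 \<le> i \<le> k + 1\<close> (all \<open>i \<ge> 1\<close> if \<open>k = \<infinity>\<close>); other values of \<open>lam\<close> and \<open>V\<close> are
  irrelevant. Here \<open>alpha\<close> is \<open>\<alpha>(A,\<mu>)\<close>. The last clause is measurability of \<open>x \<mapsto> V i x\<close> as a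
  closed-set-valued map (Effros measurability); it follows from Borel measurability with
  respect to the metric \<open>d_hat\<close> below.\<close>

definition oseledets_filtration ::
  "'a measure \<Rightarrow> ('a \<Rightarrow> 'a) \<Rightarrow> ('a \<Rightarrow> ('b::real_normed_vector \<Rightarrow>\<^sub>L 'b)) \<Rightarrow> ereal \<Rightarrow>
     'a set \<Rightarrow> enat \<Rightarrow> (nat \<Rightarrow> real) \<Rightarrow> (nat \<Rightarrow> 'a \<Rightarrow> 'b set) \<Rightarrow> bool" where
  "oseledets_filtration M f A alpha X0 k lam V \<longleftrightarrow>
     X0 \<in> sets M \<and> measure M X0 = 1 \<and> f ` X0 \<subseteq> X0 \<and>
     1 \<le> k \<and>
     (\<forall>i\<ge>1. enat i \<le> k \<longrightarrow> alpha < ereal (lam i)) \<and>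
     (\<forall>i\<ge>1. enat (i + 1) \<le> k \<longrightarrow> lam (i + 1) < lam i) \<and>
     (k = \<infinity> \<longrightarrow> (\<lambda>i. ereal (lam i)) \<longlonglongrightarrow> alpha) \<and>
     (\<forall>x\<in>X0. V 1 x = UNIV) \<and>
     (\<forall>i\<ge>1. enat i \<le> k + 1 \<longrightarrow>
        (\<forall>x\<in>X0. subspace (V i x) \<and> closed (V i x)) \<and>
        (\<exists>m. \<forall>x\<in>X0. has_codimension (V i x) m) \<and>
        (\<forall>x\<in>X0. blinfun_apply (A x) ` V i x \<subseteq> V i (f x))) \<and>
     (\<forall>i\<ge>1. enat i \<le> k \<longrightarrow>
        (\<forall>x\<in>X0. V (i + 1) x \<subseteq> V i x \<and>
           (\<forall>u\<in>V i x - V (i + 1) x.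
              (\<lambda>n. elog (norm (blinfun_apply (cocycle f A x n) u)) / ereal (real n))
                \<longlonglongrightarrow> ereal (lam i)) \<and>
           limsup (\<lambda>n. elog (norm_restrict (cocycle f A x n) (V (i + 1) x)) / ereal (real n))
             \<le> exponent k lam alpha (i + 1))) \<and>
     (\<forall>i\<ge>1. enat i \<le> k + 1 \<longrightarrow>
        (\<forall>U. open U \<longrightarrow> {x\<in>X0. V i x \<inter> U \<noteq> {}} \<in> sets M))"

definition d_hat :: "'b::real_normed_vector set \<Rightarrow> 'b set \<Rightarrow> real" where
  "d_hat E F = max (SUP v\<in>E \<inter> sphere 0 1. infdist v (F \<inter> sphere 0 1))
                   (SUP v\<in>F \<inter> sphere 0 1. infdist v (E \<inter> sphere 0 1))"

end

theory Submission
  imports Defs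
begin

text \<open>
  Write \<open>T\<^sub>n\<close> for the \<open>n\<close>-th iterate of the cocycle at \<open>x\<close> and consider one exponent \<open>\<lambda>\<^sub>j\<close>. The main
  point is that, for almost every \<open>x\<close> and large \<open>n\<close>, every vector of \<open>V\<^sub>j(x)\<close> is the sum of a vector of
  \<open>V\<^bsub>j+1\<^esub>(x)\<close> and of a vector which \<open>T\<^sub>n\<close> expands by at least \<open>exp (n (\<lambda>\<^sub>j - \<epsilon>))\<close>, although the
  exponents of individual vectors say nothing about uniformity. Let \<open>D\<^sup>p\<^sub>n\<close> be the largest
  \<open>p\<close>-dimensional volume expansion of \<open>T\<^sub>n\<close> on \<open>V\<^sub>j(x)\<close>. It is submultiplicative, so its growth rate
  obeys a zero-one law: if it is infinitely often smaller than \<open>p \<lambda>\<^sub>j\<close> by a definite amount, then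
  it is eventually so, by a covering argument along the orbit. In that case take the
  smallest such \<open>p\<close>: there is a gap between the \<open>(p - 1)\<close>-st and \<open>p\<close>-th expansion rates at
  all large times, the directions contracted at time \<open>n\<close> converge exponentially fast, and the
  limits grow at a rate below \<open>\<lambda>\<^sub>j\<close>. If \<open>p\<close> is at most the codimension of \<open>V\<^bsub>j+1\<^esub>(x)\<close> in \<open>V\<^sub>j(x)\<close>, a
  contracted direction can be chosen in a \<open>p\<close>-dimensional subspace transversal to \<open>V\<^bsub>j+1\<^esub>(x)\<close>; its
  limit is then outside \<open>V\<^bsub>j+1\<^esub>(x)\<close>, a contradiction.

  On a set of large measure the splitting is uniform. A unit vector \<open>u\<close> of \<open>V\<^sub>i(y)\<close> stays slow for
  the cocycle at a nearby point \<open>x\<close> during a time proportional to \<open>- ln (dist x y)\<close>, hence its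
  fast component at \<open>x\<close> is at most a power of \<open>dist x y\<close>; this moves \<open>u\<close> from \<open>V\<^sub>j(x)\<close> to \<open>V\<^bsub>j+1\<^esub>(x)\<close>
  for \<open>j = 1, \<dots>, i - 1\<close> successively.
\<close>

subsection \<open>Volumes in normed spaces\<close>

text \<open>Since \<open>f\<close> need not be invertible and \<open>A x\<close> need not be
  injective, no equivariant fast complement of \<open>V (j + 1) x\<close> in \<open>V j x\<close> is
  available. Fast vectors are produced separately for each time \<open>n\<close>, and only their
  existence enters; the points where they exist are described by volume bounds, which are measurable
  conditions on \<open>x\<close>, so no measurable selection of complements occurs. Volumes give
  uniformity because a \<open>p\<close>-volume is a product of \<open>p\<close> heights: once no
  height can exceed \<open>exp (n (\<lambda> + \<epsilon>))\<close>, a \<open>p\<close>-volume close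
  to \<open>exp (n p \<lambda>)\<close> forces every height to be close to
  \<open>exp (n \<lambda>)\<close>, and then the whole span is expanded at that rate. Minimality of
  \<open>p\<close> is used in the same way: with large \<open>(p - 1)\<close>-volumes and small
  \<open>p\<close>-volumes, every vector is a fast vector plus one contracted to
  \<open>exp (n (\<lambda> - \<beta>))\<close>. The fast part of a slow vector has size about
  \<open>exp (- n (\<lambda> - \<epsilon>)) * exp (n (\<lambda> - \<beta>))\<close>, which is
  summable in \<open>n\<close>. Volume growth rates may be - \<infinity>, so only one-sided bounds
  are used in place of limits.\<close>

lemma abs_scale_infdist_le_norm:
  fixes v :: "'b::real_normed_vector"
  assumes "subspace S" "s \<in> S"
  shows "\<bar>c\<bar> * infdist v S \<le> norm (c *\<^sub>R v + s)"
proof (cases "c = 0")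
  case False
  have "- (s /\<^sub>R c) \<in> S" using assms by (simp add: subspace_neg subspace_scale)
  then have "infdist v S \<le> norm (v + s /\<^sub>R c)"
    using infdist_le[of "- (s /\<^sub>R c)" S v] by (simp add: dist_norm)
  then have "\<bar>c\<bar> * infdist v S \<le> \<bar>c\<bar> * norm (v + s /\<^sub>R c)" by (simp add: mult_left_mono)
  also have "\<dots> = norm (c *\<^sub>R (v + s /\<^sub>R c))" by simp
  also have "c *\<^sub>R (v + s /\<^sub>R c) = c *\<^sub>R v + s" using False by (simp add: scaleR_add_right)
  finally show ?thesis .
qed simp

lemma infdist_scale_add_ge:
  fixes v :: "'b::real_normed_vector"
  assumes "subspace S" "s \<in> S"
  shows "\<bar>c\<bar> * infdist v S \<le> infdist (c *\<^sub>R v + s) S"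
proof -
  have ne: "S \<noteq> {}" using assms by auto
  have "\<bar>c\<bar> * infdist v S \<le> dist (c *\<^sub>R v + s) a" if "a \<in> S" for a
    using abs_scale_infdist_le_norm[OF assms(1), of "s - a" c v] assms that
    by (simp add: dist_norm subspace_diff add_diff_eq)
  then show ?thesis unfolding infdist_notempty[OF ne] using ne by (intro cINF_greatest) auto
qed

lemma infdist_scale_add:
  fixes v :: "'b::real_normed_vector"
  assumes "subspace S" "s \<in> S"
  shows "infdist (c *\<^sub>R v + s) S = \<bar>c\<bar> * infdist v S"
proof (cases "c = 0")
  case True then show ?thesis using assms by simp
next
  case False
  have s: "- (s /\<^sub>R c) \<in> S" using assms by (simp add: subspace_neg subspace_scale)
  have "\<bar>inverse c\<bar> * infdist (c *\<^sub>R v + s) S \<le> infdist (inverse c *\<^sub>R (c *\<^sub>R v + s) + - (s /\<^sub>R c)) S"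
    by (rule infdist_scale_add_ge[OF assms(1) s])
  also have "inverse c *\<^sub>R (c *\<^sub>R v + s) + - (s /\<^sub>R c) = v" using False by (simp add: scaleR_add_right)
  finally have "infdist (c *\<^sub>R v + s) S \<le> \<bar>c\<bar> * infdist v S" using False by (simp add: field_simps)
  then show ?thesis using infdist_scale_add_ge[OF assms, of c v] by linarith
qed

lemma infdist_subspace_le_norm:
  fixes v :: "'b::real_normed_vector"
  assumes "subspace S" shows "infdist v S \<le> norm v"
  using infdist_le[of 0 S v] assms by (simp add: subspace_0 dist_norm)

lemma infdist_approx_diff:
  fixes v :: "'b::real_normed_vector"
  assumes "subspace S" "infdist v S < r" shows "\<exists>s\<in>S. norm (v - s) < r"
proof (rule ccontr)
  have ne: "S \<noteq> {}" using subspace_0[OF assms(1)] by auto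
  assume "\<not> ?thesis"
  then have "r \<le> infdist v S"
    unfolding infdist_notempty[OF ne] using ne by (intro cINF_greatest) (auto simp: dist_norm not_less)
  then show False using assms(2) by simp
qed

lemma span_insert_E:
  assumes "w \<in> span (insert v S)"
  obtains c t where "t \<in> span S" "w = c *\<^sub>R v + t"
proof -
  obtain c where "w - c *\<^sub>R v \<in> span S" using assms span_breakdown_eq by blast
  then show ?thesis using that[of "w - c *\<^sub>R v" c] by simp
qed

lemma span_blinfun_image: "span (blinfun_apply T ` S) = blinfun_apply T ` span S"
  by (rule linear_span_image) (intro bounded_linear.linear blinfun.bounded_linear_right)

section \<open>Adjoining finitely many vectors to a closed subspace\<close>

text \<open>If \<open>v\<close> has positive distance from \<open>Z\<close>, its coefficient in a
  vector of the span is at most a multiple of the norm of that vector. Along a convergent sequence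
  the coefficients are therefore Cauchy, and the remainders converge in \<open>Z\<close>.\<close>

lemma closed_span_insert:
  fixes Z :: "'b::real_normed_vector set"
  assumes Z: "subspace Z" "closed Z" shows "closed (span (insert v Z))"
proof (cases "v \<in> Z")
  case True
  then have "insert v Z = Z" by auto
  then show ?thesis using Z by (simp add: span_eq_iff[THEN iffD2])
next
  case False
  define d where "d = infdist v Z"
  have d: "d > 0" using False Z infdist_pos_not_in_closed[of Z v] subspace_0[OF Z(1)] unfolding d_def by blast
  have spZ: "span Z = Z" using Z by (simp add: span_eq_iff)
  show ?thesis unfolding closed_sequential_limits
  proof (intro allI impI, elim conjE)
    fix x l assume x: "\<forall>n. x n \<in> span (insert v Z)" and l: "x \<longlonglongrightarrow> l"
    have "\<forall>n. \<exists>c. x n - c *\<^sub>R v \<in> Z" using x span_breakdown_eq spZ by blast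
    then obtain c where c: "\<And>n. x n - c n *\<^sub>R v \<in> Z" by metis
    have bd: "\<bar>c n - c m\<bar> * d \<le> dist (x n) (x m)" for n m
    proof -
      have "(x n - c n *\<^sub>R v) - (x m - c m *\<^sub>R v) \<in> Z" using c Z by (simp add: subspace_diff)
      from abs_scale_infdist_le_norm[OF Z(1) this, of "c n - c m" v]
      show ?thesis by (simp add: d_def dist_norm scaleR_diff_left)
    qed
    have "Cauchy c"
    proof (rule metric_CauchyI)
      fix e :: real assume "e > 0"
      then obtain N where N: "\<And>m n. m \<ge> N \<Longrightarrow> n \<ge> N \<Longrightarrow> dist (x m) (x n) < e * d"
        using metric_CauchyD[OF LIMSEQ_imp_Cauchy[OF l], of "e * d"] d by auto
      have "dist (c m) (c n) < e" if "m \<ge> N" "n \<ge> N" for m n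
      proof -
        have "\<bar>c m - c n\<bar> * d < e * d" using bd[of m n] N[OF that] by linarith
        then show ?thesis using d by (simp add: dist_real_def)
      qed
      then show "\<exists>N. \<forall>m\<ge>N. \<forall>n\<ge>N. dist (c m) (c n) < e" by blast
    qed
    then obtain c0 where "c \<longlonglongrightarrow> c0" using Cauchy_convergent convergent_def by blast
    then have "(\<lambda>n. x n - c n *\<^sub>R v) \<longlonglongrightarrow> l - c0 *\<^sub>R v" using l by (intro tendsto_intros)
    then have "l - c0 *\<^sub>R v \<in> Z" by (rule closed_sequentially[OF Z(2) c])
    then show "l \<in> span (insert v Z)" using span_breakdown_eq spZ by blast
  qed
qed

lemma closed_span_Un_finite:
  fixes Z :: "'b::real_normed_vector set"
  assumes Z: "subspace Z" "closed Z" and "finite F" shows "closed (span (Z \<union> F))"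
  using assms(3)
proof (induction F rule: finite_induct)
  case empty then show ?case using Z by (simp add: span_eq_iff[THEN iffD2])
next
  case (insert v F)
  have "span (Z \<union> insert v F) = span (insert v (span (Z \<union> F)))"
    by (simp only: Un_insert_right span_insert span_span)
  then show ?case using closed_span_insert[OF subspace_span insert.IH] by simp
qed

text \<open>Linear independence in the quotient by the span of \<open>Z\<close>. The recursion along
  a list matches that of \<open>pvol\<close>, so that both are handled by the same
  inductions.\<close>

primrec indep_mod :: "'b::real_vector set \<Rightarrow> 'b list \<Rightarrow> bool" where
  "indep_mod Z [] \<longleftrightarrow> True"
| "indep_mod Z (v # vs) \<longleftrightarrow> v \<notin> span (Z \<union> set vs) \<and> indep_mod Z vs"

lemma span_Un_decompose:
  assumes "subspace Z" "w \<in> span (Z \<union> S)"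
  obtains z s where "z \<in> Z" "s \<in> span S" "w = z + s"
proof -
  have "span Z = Z" using assms(1) by (simp add: span_eq_iff)
  then show ?thesis using assms(2) that unfolding span_Un by blast
qed

text \<open>The exchange bound in the quotient: modulo \<open>Z\<close> each vector has a
  representative in \<open>span F\<close>, and the representatives of a list independent modulo
  \<open>Z\<close> are distinct and independent.\<close>

lemma indep_mod_length_le:
  assumes Z: "subspace Z" and "finite F" and us: "set us \<subseteq> span (Z \<union> F)" and "indep_mod Z us"
  shows "length us \<le> card F"
proof -
  have "\<exists>b. b \<in> span F \<and> u - b \<in> Z" if u: "u \<in> span (Z \<union> F)" for u
  proof -
    obtain z s where "z \<in> Z" "s \<in> span F" "u = z + s" by (rule span_Un_decompose[OF Z u])
    then show ?thesis by (intro exI[of _ s]) simp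
  qed
  then obtain b where b: "\<And>u. u \<in> span (Z \<union> F) \<Longrightarrow> b u \<in> span F \<and> u - b u \<in> Z" by metis
  have *: "independent (b ` set us) \<and> card (b ` set us) = length us"
    using us \<open>indep_mod Z us\<close>
  proof (induction us)
    case (Cons v vs)
    have IH: "independent (b ` set vs)" "card (b ` set vs) = length vs" using Cons by auto
    have bvn: "b v \<notin> span (b ` set vs)"
    proof
      assume bv: "b v \<in> span (b ` set vs)"
      have "b u \<in> span (Z \<union> set vs)" if "u \<in> set vs" for u
      proof -
        have "u - b u \<in> Z" using b Cons.prems that by auto
        then have "u - (u - b u) \<in> span (Z \<union> set vs)" using that by (intro span_diff span_base) auto
        then show ?thesis by simp
      qed
      then have "span (b ` set vs) \<subseteq> span (Z \<union> set vs)" by (intro span_minimal) auto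
      moreover have "v - b v \<in> span (Z \<union> set vs)" using b[of v] Cons.prems by (intro span_base) auto
      ultimately have "(v - b v) + b v \<in> span (Z \<union> set vs)" using bv span_add by blast
      then show False using Cons.prems by simp
    qed
    then have nb: "b v \<notin> b ` set vs" by (rule contra_subsetD[OF span_superset])
    show ?case using IH bvn nb by (simp add: independent_insert)
  qed (simp add: independent_empty)
  have "b ` set us \<subseteq> span F" using b us by auto
  then show ?thesis using independent_span_bound[OF \<open>finite F\<close> conjunct1[OF *]] * by auto
qed

text \<open>A quantitative form of \<open>span (set us)\<close> meeting \<open>Z\<close> only in 0.
  The constant is built one vector at a time, without compactness of a unit sphere.\<close>

lemma indep_mod_infdist:
  fixes Z :: "'b::real_normed_vector set"
  assumes Z: "subspace Z" "closed Z" and "indep_mod Z us"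
  shows "\<exists>d>0. \<forall>w\<in>span (set us). d * norm w \<le> infdist w Z"
  using assms(3)
proof (induction us)
  case Nil
  then show ?case by (intro exI[of _ 1]) (simp add: infdist_nonneg)
next
  case (Cons v vs)
  then obtain d where d: "d > 0" "\<And>w. w \<in> span (set vs) \<Longrightarrow> d * norm w \<le> infdist w Z" by auto
  define a where "a = infdist v (span (Z \<union> set vs))"
  have a: "a > 0" unfolding a_def
    using Cons.prems infdist_pos_not_in_closed[OF closed_span_Un_finite[OF Z, of "set vs"]] span_zero by fastforce
  \<comment> \<open>For \<open>w = c v + t\<close> the first summand bounds the part along
    \<open>v\<close>, since \<open>\<bar>c\<bar>\<close> is at most \<open>norm (w - z) / a\<close>;
    the second bounds \<open>norm t\<close> through the distance of \<open>t\<close> from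
    \<open>z\<close>.\<close>
  define K where "K = norm v / a + (1 + norm v / a) / d"
  have K: "K > 0" unfolding K_def using a d by (intro add_nonneg_pos divide_pos_pos add_pos_nonneg) auto
  have "norm w \<le> K * norm (w - z)" if w: "w \<in> span (set (v # vs))" and z: "z \<in> Z" for w z
  proof -
    obtain c t where t: "t \<in> span (set vs)" "w = c *\<^sub>R v + t" using w span_insert_E by (metis list.simps(15))
    define y where "y = norm (w - z)"
    have "t - z \<in> span (Z \<union> set vs)"
    proof (rule span_diff)
      show "t \<in> span (Z \<union> set vs)" using t(1) span_mono[of "set vs" "Z \<union> set vs"] by auto
      show "z \<in> span (Z \<union> set vs)" using z by (intro span_base) simp
    qed
    from abs_scale_infdist_le_norm[OF subspace_span this, of c v]
    have "\<bar>c\<bar> * a \<le> y" by (simp add: a_def y_def t add_diff_eq)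
    then have c: "\<bar>c\<bar> \<le> y / a" using a by (simp add: field_simps)
    then have c': "\<bar>c\<bar> * norm v \<le> y * (norm v / a)"
      by (metis mult_right_mono norm_ge_zero times_divide_eq_left times_divide_eq_right)
    have "d * norm t \<le> infdist t Z" by (rule d(2)[OF t(1)])
    also have "\<dots> \<le> norm (t - z)" using infdist_le[OF z] by (simp add: dist_norm)
    also have "t - z = (w - z) - c *\<^sub>R v" using t by simp
    also have "norm \<dots> \<le> y + \<bar>c\<bar> * norm v" unfolding y_def by (metis norm_scaleR norm_triangle_ineq4)
    also have "\<dots> \<le> y * (1 + norm v / a)" using c' by (simp add: distrib_left)
    finally have "norm t \<le> y * ((1 + norm v / a) / d)" using d by (simp add: field_simps)
    moreover have "norm w \<le> \<bar>c\<bar> * norm v + norm t" unfolding t(2) by (metis norm_scaleR norm_triangle_ineq)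
    ultimately have "norm w \<le> y * (norm v / a) + y * ((1 + norm v / a) / d)" using c' by linarith
    then show ?thesis unfolding K_def y_def by (simp add: algebra_simps)
  qed
  then have *: "(1 / K) * norm w \<le> dist w z" if "w \<in> span (set (v # vs))" "z \<in> Z" for w z
    using that K by (simp add: field_simps dist_norm)
  have ne: "Z \<noteq> {}" using subspace_0[OF Z(1)] by auto
  have "(1 / K) * norm w \<le> infdist w Z" if "w \<in> span (set (v # vs))" for w
    unfolding infdist_notempty[OF ne] using ne *[OF that] by (intro cINF_greatest) auto
  then show ?case using K by (intro exI[of _ "1 / K"]) auto
qed

text \<open>A substitute for the volume of a parallelepiped in a normed space; for vectors in Euclidean
  space it is the usual volume.\<close>

primrec pvol :: "'b::real_normed_vector list \<Rightarrow> real" where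
  "pvol [] = 1"
| "pvol (v # vs) = infdist v (span (set vs)) * pvol vs"

lemma pvol_nonneg: "0 \<le> pvol vs"
  by (induction vs) (auto simp: infdist_nonneg)

lemma prod_list_norm_nonneg: "0 \<le> prod_list (map norm us)"
  by (induction us) auto

text \<open>The analogue of Hadamard's inequality: a height never exceeds the norm of its
  vector.\<close>

lemma pvol_map_le:
  assumes "0 \<le> M" "\<And>u. u \<in> set us \<Longrightarrow> norm (T u) \<le> M * norm u"
  shows "pvol (map T us) \<le> M ^ length us * prod_list (map norm us)"
  using assms(2)
proof (induction us)
  case (Cons u us)
  have "infdist (T u) (span (set (map T us))) \<le> norm (T u)" by (rule infdist_subspace_le_norm[OF subspace_span])
  also have "\<dots> \<le> M * norm u" using Cons.prems by simp
  finally have "infdist (T u) (span (set (map T us))) \<le> M * norm u" .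
  moreover have "pvol (map T us) \<le> M ^ length us * prod_list (map norm us)" using Cons by simp
  ultimately have "infdist (T u) (span (set (map T us))) * pvol (map T us)
      \<le> (M * norm u) * (M ^ length us * prod_list (map norm us))"
    using assms(1) by (intro mult_mono) (auto simp: pvol_nonneg)
  then show ?case by (simp add: mult_ac)
qed simp

lemma pvol_map_sgn:
  "pvol (map (blinfun_apply T) us) = pvol (map (blinfun_apply T) (map sgn us)) * prod_list (map norm us)"
proof (induction us)
  case (Cons u us)
  have sp: "span (T ` sgn ` S) = span (T ` S)" for S
  proof (rule antisym; rule span_minimal)
    show "T ` sgn ` S \<subseteq> span (T ` S)"
    proof clarify
      fix v assume "v \<in> S"
      then have "inverse (norm v) *\<^sub>R T v \<in> span (T ` S)" by (intro span_mul span_base) auto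
      then show "T (sgn v) \<in> span (T ` S)" by (simp add: sgn_div_norm blinfun.scaleR_right)
    qed
    show "T ` S \<subseteq> span (T ` sgn ` S)"
    proof clarify
      fix v assume "v \<in> S"
      then have "norm v *\<^sub>R T (sgn v) \<in> span (T ` sgn ` S)" by (intro span_mul span_base) auto
      then show "T v \<in> span (T ` sgn ` S)"
        by (cases "v = 0") (auto simp: sgn_div_norm blinfun.scaleR_right)
    qed
  qed auto
  have "infdist (T u) S = infdist (T (sgn u)) S * norm u" if "subspace S" for S
    using infdist_scale_add[OF that subspace_0[OF that], of "norm u" "T (sgn u)"]
    by (cases "u = 0") (auto simp: sgn_div_norm blinfun.scaleR_right mult.commute)
  then show ?case using Cons sp[of "set us"] by (simp add: image_image)
qed simp

text \<open>An approximate Gram-Schmidt process. From each vector a nearly nearest element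
  \<open>s\<close> of the span of the later ones is subtracted. Since \<open>T s\<close> lies in the
  span of the later images, the heights of the images do not change, while the norms become almost
  the heights of \<open>vs\<close>.\<close>

lemma pvol_reduce:
  assumes "e > 0"
  shows "\<exists>ws. length ws = length vs \<and> span (set ws) = span (set vs) \<and>
     pvol (map (blinfun_apply T) ws) = pvol (map (blinfun_apply T) vs) \<and> prod_list (map norm ws) \<le> pvol vs + e"
  using assms
proof (induction vs arbitrary: e)
  case Nil then show ?case by (intro exI[of _ "[]"]) simp
next
  case (Cons v vs)
  define d where "d = infdist v (span (set vs))"
  have d0: "d \<ge> 0" by (simp add: d_def infdist_nonneg)
  \<comment> \<open>The product \<open>(d + h) * (pvol vs + h)\<close> exceeds
    \<open>d * pvol vs\<close> by \<open>h * (d + pvol vs + h)\<close>, which is at most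
    \<open>e\<close> for this \<open>h\<close>.\<close>
  define h where "h = min 1 (e / (d + pvol vs + 1))"
  have pos: "d + pvol vs + 1 > 0" using d0 pvol_nonneg[of vs] by linarith
  have h: "h > 0" "h \<le> 1" using Cons.prems pos by (auto simp: h_def)
  have "h * (d + pvol vs + 1) \<le> e / (d + pvol vs + 1) * (d + pvol vs + 1)"
    using pos by (intro mult_right_mono) (auto simp: h_def)
  then have h': "h * (d + pvol vs + 1) \<le> e" using pos by simp
  obtain ws where ws: "length ws = length vs" "span (set ws) = span (set vs)"
    "pvol (map T ws) = pvol (map T vs)" "prod_list (map norm ws) \<le> pvol vs + h"
    using Cons.IH[OF h(1)] by blast
  obtain s where s: "s \<in> span (set vs)" "norm (v - s) < d + h"
    using infdist_approx_diff[OF subspace_span, of v "set vs" "d + h"] h by (auto simp: d_def)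
  have sp: "span (insert (v - s) (set ws)) = span (insert v (set vs))"
    using eq_span_insert_eq[of "v - s" v "set ws"] s ws(2) by (simp add: span_neg span_insert)
  have Tsp: "span (T ` set ws) = span (T ` set vs)" by (simp add: span_blinfun_image ws)
  have "- T s \<in> span (T ` set vs)"
    using s by (metis blinfun.minus_right imageI span_blinfun_image span_neg)
  from infdist_scale_add[OF subspace_span this, of 1 "T v"]
  have "infdist (T (v - s)) (span (T ` set ws)) = infdist (T v) (span (T ` set vs))"
    by (simp add: Tsp blinfun.diff_right)
  moreover have "norm (v - s) * prod_list (map norm ws) \<le> (d + h) * (pvol vs + h)"
    using s ws d0 h pvol_nonneg[of vs] by (intro mult_mono) (auto simp: prod_list_norm_nonneg)
  moreover have "(d + h) * (pvol vs + h) \<le> d * pvol vs + e"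
  proof -
    have "h * h \<le> h" using h by (simp add: mult_left_le)
    then show ?thesis using h' by (simp add: algebra_simps)
  qed
  ultimately show ?case using ws sp by (intro exI[of _ "(v - s) # ws"]) (auto simp: d_def)
qed

text \<open>A predicate instead of a supremum, since only bounds are compared. By
  \<open>pvol_reduce\<close>, for a subspace \<open>W\<close> and \<open>0 \<le> r\<close> the
  comparison with the product of norms is equivalent to one with \<open>pvol us\<close>, so that
  \<open>r\<close> bounds the genuine expansion of volume.\<close>

definition volume_bound :: "nat \<Rightarrow> ('b::real_normed_vector \<Rightarrow>\<^sub>L 'b) \<Rightarrow> 'b set \<Rightarrow> real \<Rightarrow> bool" where
  "volume_bound p T W r \<longleftrightarrow> (\<forall>us. length us = p \<longrightarrow> set us \<subseteq> W \<longrightarrow>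
      pvol (map (blinfun_apply T) us) \<le> r * prod_list (map norm us))"

lemma volume_boundD:
  "volume_bound p T W r \<Longrightarrow> length us = p \<Longrightarrow> set us \<subseteq> W \<Longrightarrow>
     pvol (map (blinfun_apply T) us) \<le> r * prod_list (map norm us)"
  by (auto simp: volume_bound_def)

lemma volume_bound_mono: "volume_bound p T W r \<Longrightarrow> r \<le> s \<Longrightarrow> volume_bound p T W s"
  unfolding volume_bound_def using order_trans[OF _ mult_right_mono[OF _ prod_list_norm_nonneg]] by blast

lemma volume_bound_1: "volume_bound 1 T W r \<longleftrightarrow> (\<forall>u\<in>W. norm (T u) \<le> r * norm u)"
  by (auto simp: volume_bound_def length_Suc_conv infdist_def)

lemma volume_bound_power:
  assumes "0 \<le> M" "\<And>u. u \<in> W \<Longrightarrow> norm (blinfun_apply T u) \<le> M * norm u"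
  shows "volume_bound p T W (M ^ p)"
  unfolding volume_bound_def using pvol_map_le[OF assms(1), of _ T] assms(2) by blast

text \<open>Replacing each vector by its component transversal to the following ones turns the volume
  of a tuple into a product of norms; this makes the bounds exactly submultiplicative.\<close>

lemma volume_bound_compose:
  assumes "volume_bound p T W r" "volume_bound p S W' s" "0 \<le> s" "T ` W \<subseteq> W'" "subspace W'"
  shows "volume_bound p (S o\<^sub>L T) W (s * r)"
  unfolding volume_bound_def
proof (intro allI impI)
  fix us assume us: "length us = p" "set us \<subseteq> W"
  define vs where "vs = map T us"
  have vs: "set vs \<subseteq> W'" using us assms by (auto simp: vs_def)
  have "pvol (map S vs) \<le> s * pvol vs + e" if "e > 0" for e
  proof -
    define e' where "e' = e / (s + 1)"
    have e': "e' > 0" "s * e' \<le> e" using that assms(3) by (auto simp: e'_def field_simps)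
    obtain ws where ws: "length ws = length vs" "span (set ws) = span (set vs)"
       "pvol (map S ws) = pvol (map S vs)" "prod_list (map norm ws) \<le> pvol vs + e'"
      using pvol_reduce[OF e'(1)] by blast
    have "set ws \<subseteq> span (set vs)" using ws(2) span_superset by blast
    also have "\<dots> \<subseteq> W'" using vs assms(5) by (simp add: span_minimal)
    finally have "pvol (map S ws) \<le> s * prod_list (map norm ws)"
      using assms(2) ws us unfolding volume_bound_def vs_def by auto
    also have "\<dots> \<le> s * (pvol vs + e')" using ws(4) assms(3) by (rule mult_left_mono)
    finally show ?thesis using ws(3) e'(2) by (simp add: distrib_left)
  qed
  then have "pvol (map S vs) \<le> s * pvol vs" by (rule field_le_epsilon)
  also have "\<dots> \<le> s * (r * prod_list (map norm us))"
    using volume_boundD[OF assms(1) us] assms(3) by (auto simp: vs_def intro: mult_left_mono)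
  moreover have "blinfun_apply (S o\<^sub>L T) = (\<lambda>x. S (T x))" by (rule ext) simp
  ultimately show "pvol (map (S o\<^sub>L T) us) \<le> s * r * prod_list (map norm us)"
    by (simp add: vs_def o_def mult.assoc)
qed

lemma not_volume_bound_unit:
  assumes "\<not> volume_bound p T W r" "subspace W" "0 \<le> r"
  obtains us where "length us = p" "set us \<subseteq> W" "\<And>u. u \<in> set us \<Longrightarrow> norm u = 1"
    "r < pvol (map (blinfun_apply T) us)"
proof -
  obtain us where us: "length us = p" "set us \<subseteq> W" "r * prod_list (map norm us) < pvol (map T us)"
    using assms(1) unfolding volume_bound_def by (auto simp: not_le)
  define P where "P = prod_list (map norm us)"
  have P: "P \<noteq> 0" using us(3) pvol_map_sgn[of T us] by (auto simp: P_def)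
  then have P0: "P > 0" using prod_list_norm_nonneg[of us] by (simp add: P_def)
  have "0 \<notin> set us" using P by (auto simp: P_def prod_list_zero_iff image_iff)
  have "r * P < pvol (map T (map sgn us)) * P" using us(3) pvol_map_sgn[of T us] by (simp add: P_def)
  then have "r < pvol (map T (map sgn us))" using P0 by simp
  moreover have "set (map sgn us) \<subseteq> W" using us(2) assms(2) by (auto simp: sgn_div_norm subspace_scale)
  moreover have "norm u = 1" if "u \<in> set (map sgn us)" for u
    using that \<open>0 \<notin> set us\<close> by (auto simp: norm_sgn)
  ultimately show ?thesis using us(1) that[of "map sgn us"] by simp
qed

text \<open>The volume is a product of \<open>length us\<close> heights, each at most
  \<open>M\<close>, so each is at least \<open>t\<close>. The coefficients of \<open>e\<close> are
  then recovered from \<open>T e\<close> one at a time, and removing one term multiplies the norm of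
  the image by at most \<open>1 + M / t\<close>. The extra factor \<open>M\<close> in the volume
  hypothesis avoids the exponent \<open>length us - 1\<close>.\<close>

lemma fast_span_aux:
  assumes "t > 0" "t \<le> M" "subspace W" "\<And>w. w \<in> W \<Longrightarrow> norm (blinfun_apply T w) \<le> M * norm w"
    "set us \<subseteq> W" "\<And>u. u \<in> set us \<Longrightarrow> norm u = 1"
    "t * M ^ length us \<le> pvol (map (blinfun_apply T) us) * M"
    "e \<in> span (set us)"
  shows "norm e \<le> (2 + M / t) ^ length us / t * norm (blinfun_apply T e)"
  using assms(5-)
proof (induction us arbitrary: e)
  case (Cons u us)
  have M: "M > 0" using assms by linarith
  obtain c s where s: "s \<in> span (set us)" "e = c *\<^sub>R u + s" using Cons.prems span_insert_E by (metis list.simps(15))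
  define d where "d = infdist (T u) (span (T ` set us))"
  have "d \<le> norm (T u)" unfolding d_def by (rule infdist_subspace_le_norm[OF subspace_span])
  also have "\<dots> \<le> M" using assms(4)[of u] Cons.prems by simp
  finally have dM: "d \<le> M" .
  have d0: "d \<ge> 0" by (simp add: d_def infdist_nonneg)
  have nus: "prod_list (map norm us) = 1" using Cons.prems(2) by (induction us) auto
  have pv: "t * M ^ length us * M \<le> d * pvol (map T us) * M" using Cons.prems(3) by (simp add: d_def mult_ac)
  then have pv': "t * M ^ length us \<le> d * pvol (map T us)" using M by simp
  have "pvol (map T us) \<le> M ^ length us * prod_list (map norm us)"
    using M assms(4) Cons.prems(1) by (intro pvol_map_le) auto
  then have "d * pvol (map T us) \<le> d * M ^ length us" using nus d0 by (intro mult_left_mono) auto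
  then have "t * M ^ length us \<le> d * M ^ length us" using pv' by linarith
  then have td: "t \<le> d" using M by simp
  have "d * pvol (map T us) \<le> M * pvol (map T us)" using dM by (intro mult_right_mono) (auto simp: pvol_nonneg)
  then have IHp: "t * M ^ length us \<le> pvol (map T us) * M" using pv' by (simp add: mult.commute)
  define y where "y = norm (T e)"
  define r where "r = M / t"
  have r: "r \<ge> 1" using assms by (simp add: r_def)
  have "\<bar>c\<bar> * d \<le> y"
  proof -
    have "T s \<in> span (T ` set us)" using s by (simp add: span_blinfun_image)
    from abs_scale_infdist_le_norm[OF subspace_span this, of c "T u"]
    show ?thesis by (simp add: d_def y_def s blinfun.add_right blinfun.scaleR_right)
  qed
  moreover have "\<bar>c\<bar> * t \<le> \<bar>c\<bar> * d" using td by (intro mult_left_mono) auto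
  ultimately have c: "\<bar>c\<bar> \<le> y / t" using assms(1) by (simp add: field_simps)
  have "T s = T e - c *\<^sub>R T u" by (simp add: s blinfun.add_right blinfun.scaleR_right)
  then have "norm (T s) \<le> y + \<bar>c\<bar> * norm (T u)" unfolding y_def by (metis norm_scaleR norm_triangle_ineq4)
  also have "\<bar>c\<bar> * norm (T u) \<le> (y / t) * M" using c assms(4)[of u] Cons.prems M by (intro mult_mono) auto
  finally have Ts: "norm (T s) \<le> y * (1 + r)" by (simp add: r_def algebra_simps)
  have ge1: "1 \<le> (2 + r) ^ length us" using r by (intro one_le_power) auto
  have "norm s \<le> (2 + M / t) ^ length us / t * norm (T s)" using Cons.prems by (intro Cons.IH IHp s) auto
  also have "\<dots> \<le> (2 + r) ^ length us / t * (y * (1 + r))"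
    unfolding r_def[symmetric] using Ts ge1 assms(1) by (intro mult_left_mono) auto
  finally have ns: "norm s \<le> (2 + r) ^ length us / t * (y * (1 + r))" .
  have "norm e \<le> \<bar>c\<bar> * norm u + norm s" unfolding s(2) by (metis norm_scaleR norm_triangle_ineq)
  also have "\<dots> \<le> y / t + (2 + r) ^ length us / t * (y * (1 + r))" using c ns Cons.prems(2) by simp
  also have "\<dots> \<le> (2 + r) ^ length us * (y / t) + (2 + r) ^ length us / t * (y * (1 + r))"
    using ge1 assms(1) mult_right_mono[OF ge1, of "y / t"] by (simp add: y_def)
  also have "\<dots> = (2 + r) ^ length (u # us) / t * y" using assms(1) by (simp add: field_simps)
  finally show ?case by (simp add: y_def r_def)
qed simp

lemma pvol_map_ge:
  assumes "0 \<le> r" "\<And>w. w \<in> span (set us) \<Longrightarrow> r * norm w \<le> norm (blinfun_apply T w)"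
  shows "r ^ length us * pvol us \<le> pvol (map (blinfun_apply T) us)"
  using assms(2)
proof (induction us)
  case (Cons u us)
  have sub: "span (set us) \<subseteq> span (set (u # us))" by (intro span_mono) auto
  have IH: "r ^ length us * pvol us \<le> pvol (map T us)" using Cons sub by blast
  have "r * infdist u (span (set us)) \<le> dist (T u) a" if "a \<in> span (T ` set us)" for a
  proof -
    from that obtain s where s: "s \<in> span (set us)" "a = T s" by (auto simp: span_blinfun_image)
    have "u - s \<in> span (set (u # us))" using sub s by (intro span_diff) (auto intro: span_base)
    then have "r * norm (u - s) \<le> norm (T (u - s))" by (rule Cons.prems)
    moreover have "r * infdist u (span (set us)) \<le> r * norm (u - s)"
      using infdist_le[OF s(1), of u] assms(1) by (intro mult_left_mono) (auto simp: dist_norm)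
    ultimately show ?thesis by (simp add: s dist_norm blinfun.diff_right)
  qed
  moreover have ne: "span (T ` set us) \<noteq> {}" using span_zero by auto
  ultimately have "r * infdist u (span (set us)) \<le> infdist (T u) (span (T ` set us))"
    unfolding infdist_notempty[OF ne] by (intro cINF_greatest) auto
  then have "(r * infdist u (span (set us))) * (r ^ length us * pvol us)
     \<le> infdist (T u) (span (T ` set us)) * pvol (map T us)"
    using IH assms(1) by (intro mult_mono) (auto simp: infdist_nonneg pvol_nonneg)
  then show ?case by (simp add: mult_ac)
qed simp

lemma indep_mod_pvol_pos:
  fixes Z :: "'b::real_normed_vector set"
  assumes "subspace Z" "closed Z" "indep_mod Z us" shows "0 < pvol us"
  using assms(3)
proof (induction us)
  case (Cons v vs)
  have "0 < infdist v (span (Z \<union> set vs))"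
    using Cons.prems infdist_pos_not_in_closed[OF closed_span_Un_finite[OF assms(1,2), of "set vs"]] span_zero by fastforce
  also have "\<dots> \<le> infdist v (span (set vs))"
    using span_zero[of "set vs"] by (intro infdist_mono span_mono) auto
  finally show ?case using Cons by simp
qed simp

section \<open>Stability of volumes under perturbation\<close>

text \<open>The closeness of \<open>S'\<close> to \<open>S\<close> is relative, hence useless for
  long vectors; but those longer than \<open>2 * norm v + 1\<close> are too far from
  \<open>v'\<close> to compete. This explains the constant in the last hypothesis.\<close>

lemma infdist_perturb_ge:
  fixes v :: "'b::real_normed_vector"
  assumes "subspace S" "subspace S'" "0 < e" "e \<le> 1"
    and dv: "dist v v' \<le> e / 2"
    and close: "\<And>s'. s' \<in> S' \<Longrightarrow> \<exists>s\<in>S. norm (s' - s) \<le> e / (2 * (2 * norm v + 1)) * norm s'"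
  shows "infdist v S - e \<le> infdist v' S'"
proof -
  have ne: "S' \<noteq> {}" using subspace_0[OF assms(2)] by auto
  have "infdist v S - e \<le> dist v' s'" if s': "s' \<in> S'" for s'
  proof (cases "norm s' \<le> 2 * norm v + 1")
    case True
    obtain s where s: "s \<in> S" "norm (s' - s) \<le> e / (2 * (2 * norm v + 1)) * norm s'" using close[OF s'] by blast
    have pos: "2 * norm v + 1 > 0" by (simp add: add_nonneg_pos)
    have "e / (2 * (2 * norm v + 1)) * norm s' \<le> e / (2 * (2 * norm v + 1)) * (2 * norm v + 1)"
      using True assms(3) by (intro mult_left_mono) auto
    also have "\<dots> = e / 2" using pos by (simp add: field_simps)
    finally have "dist s s' \<le> e / 2" using s(2) unfolding dist_norm norm_minus_commute[of s s'] by linarith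
    moreover have "infdist v S \<le> dist v s" by (rule infdist_le[OF s(1)])
    moreover have "dist v s \<le> dist v v' + dist v' s' + dist s s'"
      by (smt (verit) dist_triangle dist_commute)
    ultimately show ?thesis using dv by linarith
  next
    case False
    have "infdist v S \<le> norm v" by (rule infdist_subspace_le_norm[OF assms(1)])
    moreover have "norm s' \<le> norm v + dist v v' + dist v' s'"
      by (smt (verit) dist_norm dist_commute norm_triangle_sub)
    ultimately show ?thesis using False dv assms(3,4) by linarith
  qed
  then show ?thesis unfolding infdist_notempty[OF ne] using ne by (intro cINF_greatest) auto
qed

lemma list_all2_dist_mono:
  "list_all2 (\<lambda>v v'. dist v v' < \<eta>) vs vs' \<Longrightarrow> \<eta> \<le> \<eta>' \<Longrightarrow> list_all2 (\<lambda>v v'. dist v v' < \<eta>') vs vs'"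
  by (erule list_all2_mono) simp

text \<open>Positive volume keeps the heights of the perturbed vectors bounded below, so the
  coefficient of \<open>v'\<close> in \<open>s'\<close> is at most a multiple of
  \<open>norm s'\<close>, and replacing \<open>v'\<close> by \<open>v\<close> with the same
  coefficient costs little.\<close>

lemma pvol_pos_span_close:
  fixes vs :: "'b::real_normed_vector list"
  assumes "0 < pvol vs" "e > 0"
  shows "\<exists>\<eta>>0. \<forall>vs'. list_all2 (\<lambda>v v'. dist v v' < \<eta>) vs vs' \<longrightarrow>
           (\<forall>s'\<in>span (set vs'). \<exists>s\<in>span (set vs). norm (s' - s) \<le> e * norm s')"
  using assms
proof (induction vs arbitrary: e)
  case Nil
  then show ?case by (intro exI[of _ 1]) auto
next
  case (Cons v vs)
  define d where "d = infdist v (span (set vs))"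
  have "d \<noteq> 0" "pvol vs \<noteq> 0" using Cons.prems(1) by (auto simp: d_def)
  then have d: "d > 0" and pv: "pvol vs > 0"
    using infdist_nonneg[of v] pvol_nonneg[of vs] by (auto simp: d_def less_le)
  define h where "h = min 1 (d / 2)"
  have h: "h > 0" "h \<le> 1" "h \<le> d / 2" using d by (auto simp: h_def)
  define K where "K = 1 + 2 * (norm v + 1) / d"
  have K: "K > 0" using d by (simp add: K_def add_pos_nonneg)
  define e1 where "e1 = min (h / (2 * (2 * norm v + 1))) (e / (2 * K))"
  have e1: "e1 > 0" "e1 \<le> h / (2 * (2 * norm v + 1))" "e1 \<le> e / (2 * K)"
    using h K Cons.prems(2) by (auto simp: e1_def add_nonneg_pos)
  obtain \<eta>0 where \<eta>0: "\<eta>0 > 0" and IH: "\<And>vs' s'. list_all2 (\<lambda>v v'. dist v v' < \<eta>0) vs vs' \<Longrightarrow>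
      s' \<in> span (set vs') \<Longrightarrow> \<exists>s\<in>span (set vs). norm (s' - s) \<le> e1 * norm s'"
    using Cons.IH[OF pv e1(1)] by blast
  define \<eta> where "\<eta> = Min {\<eta>0, h / 2, e * d / 4}"
  have \<eta>: "\<eta> > 0" "\<eta> \<le> \<eta>0" "\<eta> \<le> h / 2" "\<eta> \<le> e * d / 4"
    using \<eta>0 h d Cons.prems(2) by (auto simp: \<eta>_def)
  have "\<exists>s\<in>span (set (v # vs)). norm (s' - s) \<le> e * norm s'"
    if cl: "list_all2 (\<lambda>v v'. dist v v' < \<eta>) (v # vs) ws" and s': "s' \<in> span (set ws)" for ws s'
  proof -
    obtain v' vs' where ws: "ws = v' # vs'" "dist v v' < \<eta>" "list_all2 (\<lambda>v v'. dist v v' < \<eta>) vs vs'"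
      using cl by (auto simp: list_all2_Cons1)
    have cl': "list_all2 (\<lambda>v v'. dist v v' < \<eta>0) vs vs'" using ws(3) \<eta>(2) by (rule list_all2_dist_mono)
    obtain c t' where t': "t' \<in> span (set vs')" "s' = c *\<^sub>R v' + t'"
      using s' ws(1) span_insert_E by (metis list.simps(15))
    have "infdist v (span (set vs)) - h \<le> infdist v' (span (set vs'))"
    proof (rule infdist_perturb_ge[OF subspace_span subspace_span h(1,2)])
      show "dist v v' \<le> h / 2" using ws \<eta> by simp
      fix r assume "r \<in> span (set vs')"
      then obtain s where "s \<in> span (set vs)" "norm (r - s) \<le> e1 * norm r" using IH[OF cl'] by blast
      moreover have "e1 * norm r \<le> h / (2 * (2 * norm v + 1)) * norm r" using e1(2) by (rule mult_right_mono) simp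
      ultimately show "\<exists>s\<in>span (set vs). norm (r - s) \<le> h / (2 * (2 * norm v + 1)) * norm r" by force
    qed
    then have "d / 2 \<le> infdist v' (span (set vs'))" using h by (simp add: d_def)
    then have "\<bar>c\<bar> * (d / 2) \<le> \<bar>c\<bar> * infdist v' (span (set vs'))" by (rule mult_left_mono) simp
    also have "\<dots> \<le> norm s'" unfolding t'(2) by (rule abs_scale_infdist_le_norm[OF subspace_span t'(1)])
    finally have c: "\<bar>c\<bar> \<le> 2 * norm s' / d" using d by (simp add: field_simps)
    have nv': "norm v' \<le> norm v + 1"
      using ws(2) \<eta>(3) h(2) norm_triangle_sub[of v' v] by (simp add: dist_norm norm_minus_commute)
    have "t' = s' - c *\<^sub>R v'" using t' by simp
    then have "norm t' \<le> norm s' + \<bar>c\<bar> * norm v'" by (metis norm_scaleR norm_triangle_ineq4)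
    also have "\<bar>c\<bar> * norm v' \<le> (2 * norm s' / d) * (norm v + 1)" using c nv' by (intro mult_mono) auto
    finally have nt': "norm t' \<le> K * norm s'" using d by (simp add: K_def algebra_simps)
    obtain t where t: "t \<in> span (set vs)" "norm (t' - t) \<le> e1 * norm t'" using IH[OF cl' t'(1)] by blast
    have "c *\<^sub>R v + t \<in> span (set (v # vs))"
      using t(1) span_mono[of "set vs" "set (v # vs)"] by (intro span_add span_mul) (auto intro: span_base)
    moreover have "norm (s' - (c *\<^sub>R v + t)) \<le> e * norm s'"
    proof -
      have "s' - (c *\<^sub>R v + t) = c *\<^sub>R (v' - v) + (t' - t)" by (simp add: t' algebra_simps)
      then have "norm (s' - (c *\<^sub>R v + t)) \<le> \<bar>c\<bar> * norm (v' - v) + norm (t' - t)"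
        by (metis norm_scaleR norm_triangle_ineq)
      also have "\<bar>c\<bar> * norm (v' - v) \<le> (2 * norm s' / d) * (e * d / 4)"
        using c ws(2) \<eta>(4) d by (intro mult_mono) (auto simp: dist_norm norm_minus_commute)
      also have "\<dots> = e / 2 * norm s'" using d by simp
      also have "norm (t' - t) \<le> e1 * norm t'" by (rule t)
      also have "e1 * norm t' \<le> (e / (2 * K)) * (K * norm s')"
        using e1 nt' Cons.prems(2) K by (intro mult_mono) auto
      also have "\<dots> = e / 2 * norm s'" using K by simp
      finally show ?thesis by simp
    qed
    ultimately show ?thesis by blast
  qed
  then show ?case using \<eta>(1) by blast
qed

text \<open>This makes failure of a volume bound an open condition on vectors and operator, which
  \<open>volume_bound_cocycle_sets\<close> turns into measurability.\<close>

lemma pvol_lower_semicontinuous: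
  fixes vs :: "'b::real_normed_vector list"
  assumes "r < pvol vs" "0 \<le> r"
  shows "\<exists>\<eta>>0. \<forall>vs'. list_all2 (\<lambda>v v'. dist v v' < \<eta>) vs vs' \<longrightarrow> r < pvol vs'"
  using assms
proof (induction vs arbitrary: r)
  case Nil
  then show ?case by (intro exI[of _ 1]) auto
next
  case (Cons v vs)
  define d where "d = infdist v (span (set vs))"
  have "d \<noteq> 0" "pvol vs \<noteq> 0" using Cons.prems by (auto simp: d_def)
  then have d: "d > 0" and pv: "pvol vs > 0"
    using infdist_nonneg[of v] pvol_nonneg[of vs] by (auto simp: d_def less_le)
  have "r / d < pvol vs" using Cons.prems d by (simp add: d_def field_simps)
  \<comment> \<open>The slack is shared between the two factors: \<open>pvol vs\<close> may drop to
    \<open>r'\<close> and the height of \<open>v\<close> by \<open>h\<close>, where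
    \<open>r / r' < d - h\<close>.\<close>
  then obtain r' where r': "r / d < r'" "r' < pvol vs" using dense by blast
  have r'0: "r' > 0" using r'(1) Cons.prems d by (meson divide_nonneg_pos le_less_trans)
  have "r / r' < d" using r' d r'0 by (simp add: field_simps)
  define h where "h = min 1 ((d - r / r') / 2)"
  have h: "h > 0" "h \<le> 1" using \<open>r / r' < d\<close> by (auto simp: h_def)
  have "h \<le> (d - r / r') / 2" unfolding h_def by (rule min.cobounded2)
  moreover have "q < d - h" if "h \<le> (d - q) / 2" "q < d" for q :: real using that by (simp add: field_simps)
  ultimately have h3: "r / r' < d - h" using \<open>r / r' < d\<close> by blast
  obtain \<eta>1 where \<eta>1: "\<eta>1 > 0" and IH: "\<And>vs'. list_all2 (\<lambda>v v'. dist v v' < \<eta>1) vs vs' \<Longrightarrow> r' < pvol vs'"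
    using Cons.IH[OF r'(2)] r'0 by auto
  have "h / (2 * (2 * norm v + 1)) > 0" using h by (simp add: add_nonneg_pos)
  then obtain \<eta>2 where \<eta>2: "\<eta>2 > 0" and cl: "\<And>vs' s'. list_all2 (\<lambda>v v'. dist v v' < \<eta>2) vs vs' \<Longrightarrow>
      s' \<in> span (set vs') \<Longrightarrow> \<exists>s\<in>span (set vs). norm (s' - s) \<le> h / (2 * (2 * norm v + 1)) * norm s'"
    using pvol_pos_span_close[OF pv] by blast
  define \<eta> where "\<eta> = Min {\<eta>1, \<eta>2, h / 2}"
  have \<eta>: "\<eta> > 0" "\<eta> \<le> \<eta>1" "\<eta> \<le> \<eta>2" "\<eta> \<le> h / 2" using \<eta>1 \<eta>2 h by (auto simp: \<eta>_def)
  have "r < pvol ws" if "list_all2 (\<lambda>v v'. dist v v' < \<eta>) (v # vs) ws" for ws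
  proof -
    obtain v' vs' where ws: "ws = v' # vs'" "dist v v' < \<eta>" "list_all2 (\<lambda>v v'. dist v v' < \<eta>) vs vs'"
      using \<open>list_all2 _ _ ws\<close> by (auto simp: list_all2_Cons1)
    have "d - h \<le> infdist v' (span (set vs'))" unfolding d_def
      using ws \<eta> cl[OF list_all2_dist_mono[OF ws(3) \<eta>(3)]]
      by (intro infdist_perturb_ge[OF subspace_span subspace_span h(1,2)]) auto
    then have i: "r / r' < infdist v' (span (set vs'))" using h3 by linarith
    have p: "r' < pvol vs'" by (rule IH[OF list_all2_dist_mono[OF ws(3) \<eta>(2)]])
    have "r = (r / r') * r'" using r'0 by simp
    also have "\<dots> < infdist v' (span (set vs')) * pvol vs'"
    proof (rule mult_strict_mono[OF i p _ less_imp_le[OF r'0]])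
      have "0 \<le> r / r'" using r'0 Cons.prems(2) by simp
      then show "0 < infdist v' (span (set vs'))" using i by linarith
    qed
    finally show ?thesis by (simp add: ws(1))
  qed
  then show ?case using \<eta>(1) by blast
qed

subsection \<open>Slow vectors of a sequence of operators\<close>

text \<open>The factor \<open>K\<close> absorbs comparison constants when vectors are adjoined to
  \<open>W\<close>; \<open>growth_bounded_eventually\<close> trades it for a slightly larger
  rate.\<close>

definition growth_bounded :: "(nat \<Rightarrow> ('b::real_normed_vector \<Rightarrow>\<^sub>L 'b)) \<Rightarrow> 'b set \<Rightarrow> real \<Rightarrow> bool" where
  "growth_bounded T W \<mu> \<longleftrightarrow>
     (\<exists>K\<ge>0. \<exists>N. \<forall>n\<ge>N. \<forall>w\<in>W. norm (T n w) \<le> K * exp (real n * \<mu>) * norm w)"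

text \<open>The growth of the single vector \<open>v\<close> combines with uniform growth on
  \<open>Z\<close> because both components of \<open>w\<close> are at most multiples of
  \<open>norm w\<close>.\<close>

lemma growth_bounded_span_insert:
  assumes Z: "subspace Z" "closed Z" and "growth_bounded T Z \<mu>" "growth_bounded T {v} \<mu>"
  shows "growth_bounded T (span (insert v Z)) \<mu>"
proof (cases "v \<in> Z")
  case True
  then have "insert v Z = Z" by auto
  then have "span (insert v Z) = Z" using Z(1) by (simp add: span_eq_iff)
  then show ?thesis using assms(3) by simp
next
  case False
  define d where "d = infdist v Z"
  have d: "d > 0" using False Z infdist_pos_not_in_closed[of Z v] subspace_0[OF Z(1)] unfolding d_def by blast
  have spZ: "span Z = Z" using Z by (simp add: span_eq_iff)
  obtain K N where K: "K \<ge> 0" "\<And>n w. n \<ge> N \<Longrightarrow> w \<in> Z \<Longrightarrow> norm (T n w) \<le> K * exp (real n * \<mu>) * norm w"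
    using assms(3) unfolding growth_bounded_def by blast
  obtain K' N' where K': "K' \<ge> 0" "\<And>n. n \<ge> N' \<Longrightarrow> norm (T n v) \<le> K' * exp (real n * \<mu>) * norm v"
    using assms(4) unfolding growth_bounded_def by blast
  define L where "L = K' * norm v / d + K * (1 + norm v / d)"
  have "norm (T n w) \<le> L * exp (real n * \<mu>) * norm w" if n: "n \<ge> max N N'" and w: "w \<in> span (insert v Z)" for n w
  proof -
    obtain c z where z: "z \<in> Z" "w = c *\<^sub>R v + z" using span_insert_E[OF w] spZ by metis
    have "\<bar>c\<bar> * d \<le> norm w" unfolding d_def z(2) by (rule abs_scale_infdist_le_norm[OF Z(1) z(1)])
    then have c: "\<bar>c\<bar> \<le> norm w / d" using d by (simp add: field_simps)
    have "z = w - c *\<^sub>R v" using z by simp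
    then have "norm z \<le> norm w + \<bar>c\<bar> * norm v" by (metis norm_scaleR norm_triangle_ineq4)
    also have "\<bar>c\<bar> * norm v \<le> norm w / d * norm v" using c by (rule mult_right_mono) simp
    finally have nz: "norm z \<le> (1 + norm v / d) * norm w" by (simp add: algebra_simps)
    have "T n w = c *\<^sub>R T n v + T n z" by (simp add: z blinfun.add_right blinfun.scaleR_right)
    then have "norm (T n w) \<le> \<bar>c\<bar> * norm (T n v) + norm (T n z)" by (metis norm_scaleR norm_triangle_ineq)
    also have "\<bar>c\<bar> * norm (T n v) \<le> (norm w / d) * (K' * exp (real n * \<mu>) * norm v)"
      using c K' n d by (intro mult_mono) auto
    also have "norm (T n z) \<le> K * exp (real n * \<mu>) * norm z" using K n z by auto
    also have "\<dots> \<le> K * exp (real n * \<mu>) * ((1 + norm v / d) * norm w)"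
      using nz K by (intro mult_left_mono) auto
    finally show ?thesis by (simp add: L_def algebra_simps)
  qed
  moreover have "L \<ge> 0" using K K' d by (auto simp: L_def)
  ultimately show ?thesis unfolding growth_bounded_def by blast
qed

lemma growth_bounded_span_Un:
  assumes Z: "subspace Z" "closed Z" and "growth_bounded T Z \<mu>" "finite F"
    and "\<And>v. v \<in> F \<Longrightarrow> growth_bounded T {v} \<mu>"
  shows "growth_bounded T (span (Z \<union> F)) \<mu>"
  using assms(4,5)
proof (induction F rule: finite_induct)
  case empty
  have "span Z = Z" using Z(1) by (simp add: span_eq_iff)
  then show ?case using assms(3) by (simp only: Un_empty_right)
next
  case (insert v F)
  have "span (Z \<union> insert v F) = span (insert v (span (Z \<union> F)))"
    by (simp only: Un_insert_right span_insert span_span)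
  then show ?case
    using growth_bounded_span_insert[OF subspace_span closed_span_Un_finite[OF Z insert.hyps(1)]] insert by simp
qed

lemma eventually_le_exp_linear:
  fixes K d :: real
  assumes "d > 0" shows "\<forall>\<^sub>F n in sequentially. K \<le> exp (real n * d)"
proof -
  obtain N :: nat where N: "\<bar>K\<bar> / d < real N" using reals_Archimedean2 by blast
  have "K \<le> exp (real n * d)" if "n \<ge> N" for n
  proof -
    have "\<bar>K\<bar> / d \<le> real n" using N that by linarith
    then have "\<bar>K\<bar> \<le> real n * d" using assms by (simp add: field_simps)
    also have "\<dots> \<le> exp (real n * d)" using exp_ge_add_one_self[of "real n * d"] by linarith
    finally show ?thesis by linarith
  qed
  then show ?thesis using eventually_sequentially by blast
qed

lemma growth_bounded_eventually:
  assumes "growth_bounded T W \<mu>" "\<mu> < \<mu>'"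
  shows "\<forall>\<^sub>F n in sequentially. \<forall>w\<in>W. norm (T n w) \<le> exp (real n * \<mu>') * norm w"
proof -
  obtain K N where K: "K \<ge> 0" "\<And>n w. n \<ge> N \<Longrightarrow> w \<in> W \<Longrightarrow> norm (T n w) \<le> K * exp (real n * \<mu>) * norm w"
    using assms(1) unfolding growth_bounded_def by blast
  have "\<forall>\<^sub>F n in sequentially. K \<le> exp (real n * (\<mu>' - \<mu>))"
    using assms(2) by (intro eventually_le_exp_linear) simp
  then show ?thesis using eventually_ge_at_top[of N]
  proof eventually_elim
    case (elim n)
    have "K * exp (real n * \<mu>) \<le> exp (real n * (\<mu>' - \<mu>)) * exp (real n * \<mu>)"
      using elim(1) by (rule mult_right_mono) simp
    also have "\<dots> = exp (real n * \<mu>')" by (simp add: exp_add[symmetric] algebra_simps)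
    finally have "K * exp (real n * \<mu>) * norm w \<le> exp (real n * \<mu>') * norm w" for w :: 'a
      by (rule mult_right_mono) simp
    then show ?case using K(2)[OF elim(2)] by (meson order_trans)
  qed
qed

section \<open>Fast and slow directions at one time\<close>

text \<open>\<open>fast_span_aux\<close> with \<open>M = exp (n (lam + \<epsilon>'))\<close> and
  \<open>t = exp (n (lam - q \<epsilon>'))\<close>. In units of \<open>\<epsilon>'\<close> the
  exponent loses \<open>q\<close> through \<open>t\<close>, 1 through \<open>3 ^ q\<close> and
  \<open>q (q + 1)\<close> through the power of \<open>M / t\<close>, in total
  \<open>(q + 1)\<^sup>2\<close>.\<close>

lemma fast_span:
  fixes T :: "'b::real_normed_vector \<Rightarrow>\<^sub>L 'b" and lam \<epsilon> :: real and n q :: nat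
  defines "\<epsilon>' \<equiv> \<epsilon> / (real q + 1)\<^sup>2"
  assumes "\<epsilon> > 0" "3 ^ q \<le> exp (real n * \<epsilon>')" "subspace W"
    and upper: "\<And>w. w \<in> W \<Longrightarrow> norm (T w) \<le> exp (real n * (lam + \<epsilon>')) * norm w"
    and lower: "\<not> volume_bound q T W (exp (real n * (real q * lam - \<epsilon>')))"
  obtains us where "length us = q" "set us \<subseteq> W" "\<And>u. u \<in> set us \<Longrightarrow> norm u = 1"
    "exp (real n * (real q * lam - \<epsilon>')) < pvol (map (blinfun_apply T) us)"
    "\<And>e. e \<in> span (set us) \<Longrightarrow> norm e \<le> exp (- (real n * (lam - \<epsilon>))) * norm (T e)"
proof -
  have e': "\<epsilon>' > 0" using assms by simp
  have e'eq: "\<epsilon>' * (real q + 1)\<^sup>2 = \<epsilon>" by (simp add: \<epsilon>'_def)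
  obtain us where us: "length us = q" "set us \<subseteq> W" "\<And>u. u \<in> set us \<Longrightarrow> norm u = 1"
    "exp (real n * (real q * lam - \<epsilon>')) < pvol (map (blinfun_apply T) us)"
    using not_volume_bound_unit[OF lower \<open>subspace W\<close>] by auto
  define M where "M = exp (real n * (lam + \<epsilon>'))"
  define t where "t = exp (real n * (lam - real q * \<epsilon>'))"
  have "- (real q * \<epsilon>') \<le> 0" using e' by simp
  then have "- (real q * \<epsilon>') \<le> \<epsilon>'" using e' by linarith
  then have tM: "t \<le> M" unfolding t_def M_def using e' by (simp add: mult_left_mono)
  have "M ^ q = exp (real q * (real n * (lam + \<epsilon>')))" unfolding M_def by (rule exp_of_nat_mult[symmetric])
  then have "t * M ^ length us = exp (real n * (real q * lam - \<epsilon>')) * M"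
    by (simp add: us t_def M_def exp_add[symmetric] algebra_simps)
  also have "\<dots> \<le> pvol (map T us) * M" using us(4) by (intro mult_right_mono) (auto simp: M_def)
  finally have pv: "t * M ^ length us \<le> pvol (map T us) * M" .
  define r where "r = exp (real n * ((real q + 1) * \<epsilon>'))"
  have Mt: "M / t = r" unfolding M_def t_def r_def by (simp add: exp_diff[symmetric] algebra_simps)
  have r1: "r \<ge> 1" unfolding r_def using e' by simp
  have "(2 + r) ^ q \<le> (3 * r) ^ q" using r1 by (intro power_mono) auto
  also have "\<dots> = 3 ^ q * r ^ q" by (simp add: power_mult_distrib)
  also have "\<dots> \<le> exp (real n * \<epsilon>') * r ^ q" using assms(3) r1 by (intro mult_right_mono) auto
  also have "r ^ q = exp (real q * (real n * ((real q + 1) * \<epsilon>')))" unfolding r_def by (rule exp_of_nat_mult[symmetric])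
  finally have "(2 + r) ^ q / t \<le> exp (real n * \<epsilon>') * exp (real q * (real n * ((real q + 1) * \<epsilon>'))) / t"
    by (intro divide_right_mono) (auto simp: t_def)
  also have "\<dots> = exp (- (real n * (lam - \<epsilon>' * (real q + 1)\<^sup>2)))"
    unfolding t_def by (simp add: exp_add[symmetric] exp_diff[symmetric] algebra_simps power2_eq_square)
  finally have fac: "(2 + M / t) ^ length us / t \<le> exp (- (real n * (lam - \<epsilon>)))" by (simp add: Mt us e'eq)
  have "norm e \<le> exp (- (real n * (lam - \<epsilon>))) * norm (T e)" if "e \<in> span (set us)" for e
  proof -
    have "norm e \<le> (2 + M / t) ^ length us / t * norm (T e)"
    proof (rule fast_span_aux[OF _ tM \<open>subspace W\<close> _ us(2) us(3) pv that])
      show "0 < t" by (simp add: t_def)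
    qed (auto simp: M_def intro: upper)
    also have "\<dots> \<le> exp (- (real n * (lam - \<epsilon>))) * norm (T e)" using fac by (rule mult_right_mono) simp
    finally show ?thesis .
  qed
  then show ?thesis using that us by blast
qed

text \<open>The height of \<open>T w\<close> over the image of the fast span is a
  \<open>(q + 1)\<close>-volume divided by a \<open>q\<close>-volume, hence at most
  \<open>exp (n (lam - \<beta>)) * norm w\<close>. So \<open>T w\<close> is nearly the image of some
  fast \<open>e\<close>, whose norm is controlled by \<open>T e\<close>.\<close>

lemma fast_slow_decomposition:
  fixes T :: "'b::real_normed_vector \<Rightarrow>\<^sub>L 'b" and lam \<epsilon> :: real and n q :: nat
  defines "\<epsilon>' \<equiv> \<epsilon> / (real q + 1)\<^sup>2"
  assumes "\<epsilon> > 0" "3 ^ q \<le> exp (real n * \<epsilon>')" and W: "subspace W"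
    and upper: "\<And>w. w \<in> W \<Longrightarrow> norm (T w) \<le> exp (real n * (lam + \<epsilon>')) * norm w"
    and lower: "\<not> volume_bound q T W (exp (real n * (real q * lam - \<epsilon>')))"
    and vol: "volume_bound (Suc q) T W (exp (real n * (real (Suc q) * lam - \<gamma>)))"
    and "\<beta> + \<epsilon>' \<le> \<gamma>" "w \<in> W"
  obtains e where "e \<in> W" "norm (T (w - e)) \<le> 2 * exp (real n * (lam - \<beta>)) * norm w"
    "norm e \<le> exp (- (real n * (lam - \<epsilon>))) * (norm (T w) + 2 * exp (real n * (lam - \<beta>)) * norm w)"
proof (cases "w = 0")
  case True
  then show ?thesis using that[of 0] subspace_0[OF W] by simp
next
  case False
  obtain us where us: "length us = q" "set us \<subseteq> W" "\<And>u. u \<in> set us \<Longrightarrow> norm u = 1"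
    "exp (real n * (real q * lam - \<epsilon>')) < pvol (map (blinfun_apply T) us)"
    "\<And>e. e \<in> span (set us) \<Longrightarrow> norm e \<le> exp (- (real n * (lam - \<epsilon>))) * norm (T e)"
    using fast_span[OF assms(2) assms(3)[unfolded \<epsilon>'_def] W] upper lower unfolding \<epsilon>'_def by metis
  have nus: "prod_list (map norm us) = 1" using us(3) by (induction us) auto
  define a where "a = infdist (T w) (span (T ` set us))"
  define E where "E = exp (real n * (real q * lam - \<epsilon>'))"
  have a0: "a \<ge> 0" by (simp add: a_def infdist_nonneg)
  have "a * E \<le> a * pvol (map T us)" using us(4) a0 by (intro mult_left_mono) (auto simp: E_def)
  also have "\<dots> \<le> exp (real n * (real (Suc q) * lam - \<gamma>)) * norm w"
    using volume_boundD[OF vol, of "w # us"] us \<open>w \<in> W\<close> nus by (simp add: a_def)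
  also have "exp (real n * (real (Suc q) * lam - \<gamma>)) \<le> exp (real n * (lam - \<beta>)) * E"
    unfolding E_def using mult_left_mono[OF \<open>\<beta> + \<epsilon>' \<le> \<gamma>\<close>, of "real n"]
    by (simp add: exp_add[symmetric] algebra_simps)
  finally have "a * E \<le> exp (real n * (lam - \<beta>)) * norm w * E" by (simp add: mult_right_mono mult_ac)
  then have "a \<le> exp (real n * (lam - \<beta>)) * norm w" by (simp add: E_def)
  \<comment> \<open>Doubling gives the strict inequality that a nearly nearest point requires; it
    fails for \<open>w = 0\<close>, hence the case distinction.\<close>
  also have "\<dots> < 2 * exp (real n * (lam - \<beta>)) * norm w" using False by simp
  finally obtain s where s: "s \<in> span (T ` set us)" "norm (T w - s) < 2 * exp (real n * (lam - \<beta>)) * norm w"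
    using infdist_approx_diff[OF subspace_span] unfolding a_def by blast
  then obtain e where e: "e \<in> span (set us)" "s = T e" by (auto simp: span_blinfun_image)
  have "e \<in> W" using e(1) us(2) span_minimal W by blast
  moreover have we: "norm (T (w - e)) \<le> 2 * exp (real n * (lam - \<beta>)) * norm w"
    using s(2) by (simp add: e blinfun.diff_right)
  moreover have "norm e \<le> exp (- (real n * (lam - \<epsilon>))) * (norm (T w) + 2 * exp (real n * (lam - \<beta>)) * norm w)"
  proof -
    have "T e = T w - T (w - e)" by (simp add: blinfun.diff_right)
    then have "norm (T e) \<le> norm (T w) + norm (T (w - e))" by (metis norm_triangle_ineq4)
    then have "norm (T e) \<le> norm (T w) + 2 * exp (real n * (lam - \<beta>)) * norm w" using we by linarith
    then show ?thesis using us(5)[OF e(1)] by (meson exp_ge_zero mult_left_mono order_trans)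
  qed
  ultimately show ?thesis by (rule that)
qed

text \<open>Otherwise \<open>T n\<close> would expand the whole span by
  \<open>exp (n (lam - \<beta>))\<close> and the volume of \<open>fs\<close> by the
  \<open>p\<close>-th power of this, which exceeds the volume bound for large \<open>n\<close>
  because \<open>p \<beta> < \<gamma>\<close>.\<close>

lemma eventually_slow_in_span:
  fixes T :: "nat \<Rightarrow> 'b::real_normed_vector \<Rightarrow>\<^sub>L 'b"
  assumes "\<forall>\<^sub>F n in sequentially. volume_bound p (T n) W (exp (real n * (real p * lam - \<gamma>)))"
    and "length fs = p" "set fs \<subseteq> W" "0 < pvol fs" "real p * \<beta> < \<gamma>"
  shows "\<forall>\<^sub>F n in sequentially. \<exists>w\<in>span (set fs). norm w = 1 \<and> norm (T n w) \<le> exp (real n * (lam - \<beta>))"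
proof -
  define P where "P = prod_list (map norm fs)"
  have "\<forall>\<^sub>F n in sequentially. (P + 1) / pvol fs \<le> exp (real n * (\<gamma> - real p * \<beta>))"
    using assms by (intro eventually_le_exp_linear) simp
  then show ?thesis using assms(1)
  proof eventually_elim
    case (elim n)
    show ?case
    proof (rule ccontr)
      assume *: "\<not> ?thesis"
      define r where "r = exp (real n * (lam - \<beta>))"
      have "r * norm w \<le> norm (T n w)" if w: "w \<in> span (set fs)" for w
      proof (cases "w = 0")
        case False
        have "r \<le> norm (T n (w /\<^sub>R norm w))"
          using * w False by (auto simp: r_def not_le span_mul intro!: less_imp_le)
        then show ?thesis using False by (simp add: blinfun.scaleR_right field_simps)
      qed simp
      then have "r ^ p * pvol fs \<le> pvol (map (T n) fs)"
        using pvol_map_ge[of r fs "T n"] assms(2) by (simp add: r_def)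
      also have "\<dots> \<le> exp (real n * (real p * lam - \<gamma>)) * P"
        using volume_boundD[OF elim(2) assms(2,3)] by (simp add: P_def)
      also have "r ^ p = exp (real p * (real n * (lam - \<beta>)))" unfolding r_def by (rule exp_of_nat_mult[symmetric])
      also have "\<dots> = exp (real n * (real p * lam - \<gamma>)) * exp (real n * (\<gamma> - real p * \<beta>))"
        by (simp add: exp_add[symmetric] algebra_simps)
      finally have "exp (real n * (\<gamma> - real p * \<beta>)) * pvol fs \<le> P" by (simp add: mult.assoc)
      moreover have "(P + 1) / pvol fs * pvol fs \<le> exp (real n * (\<gamma> - real p * \<beta>)) * pvol fs"
        using elim(1) assms(4) by (intro mult_right_mono) auto
      ultimately show False using assms(4) by simp
    qed
  qed
qed

text \<open>A vector of \<open>span (set fs)\<close> that is slow at time \<open>N\<close> is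
  corrected at each later time by subtracting its fast component. The corrections are dominated by a
  geometric series, and for large \<open>N\<close> their sum is too small for the limit to reach
  \<open>Z\<close>.\<close>

lemma slow_vector:
  fixes T :: "nat \<Rightarrow> 'b::banach \<Rightarrow>\<^sub>L 'b"
  assumes W: "subspace W" "closed W" and Z: "subspace Z" "closed Z"
    and step: "\<And>n w. norm (T (Suc n) w) \<le> exp C * norm (T n w)"
    and upper: "\<And>\<delta>. \<delta> > 0 \<Longrightarrow> \<forall>\<^sub>F n in sequentially. \<forall>w\<in>W. norm (T n w) \<le> exp (real n * (lam + \<delta>)) * norm w"
    and lower: "\<And>\<delta>. \<delta> > 0 \<Longrightarrow> \<forall>\<^sub>F n in sequentially. \<not> volume_bound q (T n) W (exp (real n * (real q * lam - \<delta>)))"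
    and "\<gamma> > 0"
    and vol: "\<forall>\<^sub>F n in sequentially. volume_bound (Suc q) (T n) W (exp (real n * (real (Suc q) * lam - \<gamma>)))"
    and fs: "length fs = Suc q" "set fs \<subseteq> W" "indep_mod Z fs"
  shows "\<exists>u\<in>W - Z. \<exists>\<beta>>0. \<forall>\<^sub>F n in sequentially. norm (T n u) \<le> exp (real n * (lam - \<beta>))"
proof -
  \<comment> \<open>This choice gives \<open>Suc q * \<beta> = \<gamma> / 2 < \<gamma>\<close> for
    \<open>eventually_slow_in_span\<close>, and leaves room for
    \<open>\<beta> + \<epsilon>' \<le> \<gamma>\<close>.\<close>
  define \<beta> where "\<beta> = \<gamma> / (2 * real (Suc q))"
  define \<epsilon> where "\<epsilon> = \<beta> / 4"
  define \<epsilon>' where "\<epsilon>' = \<epsilon> / (real q + 1)\<^sup>2"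
  have \<beta>: "\<beta> > 0" using \<open>\<gamma> > 0\<close> by (simp add: \<beta>_def)
  have p\<beta>: "real (Suc q) * \<beta> = \<gamma> / 2" unfolding \<beta>_def by (simp del: of_nat_Suc)
  have \<epsilon>: "\<epsilon> > 0" "\<epsilon> = \<beta> / 4" using \<beta> by (auto simp: \<epsilon>_def)
  have \<epsilon>': "\<epsilon>' > 0" "\<epsilon>' \<le> \<epsilon>"
    using \<epsilon> by (auto simp: \<epsilon>'_def divide_le_eq one_le_power mult_le_cancel_left1)
  have "1 * \<beta> \<le> real (Suc q) * \<beta>" using \<beta> by (intro mult_right_mono) auto
  then have \<beta>\<gamma>: "\<beta> + \<epsilon>' \<le> \<gamma>" using p\<beta> \<epsilon>' \<epsilon> by linarith
  define r where "r = exp (- (\<beta> - \<epsilon>))"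
  have r: "r > 0" "r < 1" using \<beta> \<epsilon> by (auto simp: r_def)
  \<comment> \<open>Bound for the corrections: the first summand is the growth of the previous
    vector during one time step, relative to the slow rate, the second the error of the
    decomposition.\<close>
  define K where "K = 4 * (exp (C - (lam - \<beta>)) + 1) * r"
  have K: "K > 0" using r by (simp add: K_def add_pos_pos)
  obtain d0 where d0: "d0 > 0" "\<And>w. w \<in> span (set fs) \<Longrightarrow> d0 * norm w \<le> infdist w Z"
    using indep_mod_infdist[OF Z fs(3)] by blast
  \<comment> \<open>The total displacement will be at most \<open>d < d0\<close>, whereas the unit
    vector \<open>w0\<close> has distance at least \<open>d0\<close> from \<open>Z\<close>;
    \<open>d \<le> 1\<close> keeps the norms below 2.\<close>
  define d where "d = min 1 (d0 / 2)"
  have d: "d > 0" "d \<le> 1" "d < d0" using d0 by (auto simp: d_def)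
  have "(\<lambda>n. K * r ^ n) \<longlonglongrightarrow> K * 0" using r by (intro tendsto_intros LIMSEQ_realpow_zero) auto
  moreover have "K * 0 < d * (1 - r)" using d r by simp
  ultimately have ev1: "\<forall>\<^sub>F n in sequentially. K * r ^ n < d * (1 - r)" by (rule order_tendstoD)
  have ev2: "\<forall>\<^sub>F n in sequentially. 3 ^ q \<le> exp (real n * \<epsilon>')" by (rule eventually_le_exp_linear[OF \<epsilon>'(1)])
  have ev3: "\<forall>\<^sub>F n in sequentially. \<exists>w\<in>span (set fs). norm w = 1 \<and> norm (T n w) \<le> exp (real n * (lam - \<beta>))"
    using eventually_slow_in_span[OF vol fs(1,2) indep_mod_pvol_pos[OF Z fs(3)]] p\<beta> \<open>\<gamma> > 0\<close> by simp
  have "\<forall>\<^sub>F n in sequentially. K * r ^ n < d * (1 - r) \<and> 3 ^ q \<le> exp (real n * \<epsilon>') \<and>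
      (\<exists>w\<in>span (set fs). norm w = 1 \<and> norm (T n w) \<le> exp (real n * (lam - \<beta>))) \<and>
      (\<forall>w\<in>W. norm (T n w) \<le> exp (real n * (lam + \<epsilon>')) * norm w) \<and>
      \<not> volume_bound q (T n) W (exp (real n * (real q * lam - \<epsilon>'))) \<and>
      volume_bound (Suc q) (T n) W (exp (real n * (real (Suc q) * lam - \<gamma>)))"
    using ev1 ev2 ev3 upper[OF \<epsilon>'(1)] lower[OF \<epsilon>'(1)] vol by eventually_elim blast
  then obtain N where N: "\<And>n. n \<ge> N \<Longrightarrow> K * r ^ n < d * (1 - r)" "\<And>n. n \<ge> N \<Longrightarrow> 3 ^ q \<le> exp (real n * \<epsilon>')"
      "\<exists>w\<in>span (set fs). norm w = 1 \<and> norm (T N w) \<le> exp (real N * (lam - \<beta>))"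
      "\<And>n w. n \<ge> N \<Longrightarrow> w \<in> W \<Longrightarrow> norm (T n w) \<le> exp (real n * (lam + \<epsilon>')) * norm w"
      "\<And>n. n \<ge> N \<Longrightarrow> \<not> volume_bound q (T n) W (exp (real n * (real q * lam - \<epsilon>')))"
      "\<And>n. n \<ge> N \<Longrightarrow> volume_bound (Suc q) (T n) W (exp (real n * (real (Suc q) * lam - \<gamma>)))"
    unfolding eventually_sequentially by blast
  obtain w0 where w0: "w0 \<in> span (set fs)" "norm w0 = 1" "norm (T N w0) \<le> exp (real N * (lam - \<beta>))" using N(3) by blast
  have w0W: "w0 \<in> W" using w0(1) fs(2) span_minimal W(1) by blast
  \<comment> \<open>The bound \<open>2 - r ^ k\<close> leaves exactly the room
    \<open>r ^ k - r ^ Suc k\<close> for the next correction. As norms stay at most 2, the error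
    \<open>2 * norm w\<close> of the decomposition gives the factor 4.\<close>
  define Q where "Q k w \<longleftrightarrow> w \<in> W \<and> norm w \<le> 2 - r ^ k \<and>
     norm (T (N + k) w) \<le> 4 * exp (real (N + k) * (lam - \<beta>))" for k w
  have "\<exists>w. \<forall>k. Q k (w k) \<and> norm (w (Suc k) - w k) \<le> d * (1 - r) * r ^ k \<and> (k = 0 \<longrightarrow> w k = w0)"
  proof -
    have "\<exists>w. \<forall>k. (Q k (w k) \<and> (k = 0 \<longrightarrow> w k = w0)) \<and> norm (w (Suc k) - w k) \<le> d * (1 - r) * r ^ k"
    proof (rule dependent_nat_choice)
      have "norm (T N w0) \<le> 4 * exp (real N * (lam - \<beta>))"
        using w0(3) exp_ge_zero[of "real N * (lam - \<beta>)"] by linarith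
      then show "\<exists>w. Q 0 w \<and> (0 = (0::nat) \<longrightarrow> w = w0)" using w0W w0(2) by (auto simp: Q_def)
    next
      fix w k assume "Q k w \<and> (k = 0 \<longrightarrow> w = w0)"
      then have w: "w \<in> W" "norm w \<le> 2 - r ^ k" "norm (T (N + k) w) \<le> 4 * exp (real (N + k) * (lam - \<beta>))"
        by (auto simp: Q_def)
      define n where "n = Suc (N + k)"
      have n: "n \<ge> N" by (simp add: n_def)
      obtain e where e: "e \<in> W" "norm (T n (w - e)) \<le> 2 * exp (real n * (lam - \<beta>)) * norm w"
        "norm e \<le> exp (- (real n * (lam - \<epsilon>))) * (norm (T n w) + 2 * exp (real n * (lam - \<beta>)) * norm w)"
        using fast_slow_decomposition[OF \<epsilon>(1) N(2)[OF n, unfolded \<epsilon>'_def] W(1) N(4)[OF n, unfolded \<epsilon>'_def]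
            N(5)[OF n, unfolded \<epsilon>'_def] N(6)[OF n] \<beta>\<gamma>[unfolded \<epsilon>'_def] w(1)] by blast
      have nw: "norm w \<le> 2" using w(2) r(1) zero_le_power[of r k] by linarith
      have eq: "exp C * exp (real (N + k) * (lam - \<beta>)) = exp (C - (lam - \<beta>)) * exp (real n * (lam - \<beta>))"
        by (simp add: n_def exp_add[symmetric] algebra_simps)
      have "norm (T n w) \<le> exp C * norm (T (N + k) w)" unfolding n_def by (rule step)
      also have "\<dots> \<le> exp C * (4 * exp (real (N + k) * (lam - \<beta>)))" using w(3) by (intro mult_left_mono) auto
      also have "\<dots> = 4 * exp (C - (lam - \<beta>)) * exp (real n * (lam - \<beta>))" using eq by simp
      finally have "norm (T n w) + 2 * exp (real n * (lam - \<beta>)) * norm w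
          \<le> 4 * exp (C - (lam - \<beta>)) * exp (real n * (lam - \<beta>)) + 2 * exp (real n * (lam - \<beta>)) * 2"
        using nw by (intro add_mono mult_left_mono) auto
      also have "\<dots> = 4 * (exp (C - (lam - \<beta>)) + 1) * exp (real n * (lam - \<beta>))" by (simp add: algebra_simps)
      finally have "norm e \<le> exp (- (real n * (lam - \<epsilon>))) * (4 * (exp (C - (lam - \<beta>)) + 1) * exp (real n * (lam - \<beta>)))"
        using e(3) by (meson exp_ge_zero mult_left_mono order_trans)
      also have "\<dots> = 4 * (exp (C - (lam - \<beta>)) + 1) * exp (real n * (- (\<beta> - \<epsilon>)))"
        by (simp add: exp_add[symmetric] algebra_simps)
      also have "exp (real n * (- (\<beta> - \<epsilon>))) = r ^ n" unfolding r_def by (rule exp_of_nat_mult)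
      also have "4 * (exp (C - (lam - \<beta>)) + 1) * r ^ n = K * r ^ (N + k)" by (simp add: K_def n_def)
      also have "\<dots> = (K * r ^ N) * r ^ k" by (simp add: power_add)
      also have "\<dots> \<le> (d * (1 - r)) * r ^ k" using N(1)[of N] r by (intro mult_right_mono) auto
      finally have ne: "norm e \<le> d * (1 - r) * r ^ k" .
      also have "\<dots> \<le> 1 * (1 - r) * r ^ k" using d r by (intro mult_right_mono) auto
      finally have "norm e \<le> r ^ k - r ^ Suc k" by (simp add: algebra_simps)
      then have "norm (w - e) \<le> 2 - r ^ Suc k" using w(2) norm_triangle_ineq4[of w e] by linarith
      moreover have "norm (T n (w - e)) \<le> 4 * exp (real n * (lam - \<beta>))"
      proof -
        have "2 * exp (real n * (lam - \<beta>)) * norm w \<le> 2 * exp (real n * (lam - \<beta>)) * 2"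
          using nw by (intro mult_left_mono) auto
        then show ?thesis using e(2) by linarith
      qed
      then have "norm (T (N + Suc k) (w - e)) \<le> 4 * exp (real (N + Suc k) * (lam - \<beta>))" by (simp add: n_def)
      ultimately have "Q (Suc k) (w - e)" using w(1) e(1) W(1) by (auto simp: Q_def subspace_diff)
      then show "\<exists>y. (Q (Suc k) y \<and> (Suc k = 0 \<longrightarrow> y = w0)) \<and> norm (y - w) \<le> d * (1 - r) * r ^ k"
        using ne by (intro exI[of _ "w - e"]) simp
    qed
    then show ?thesis by blast
  qed
  then obtain w where Q: "\<And>k. Q k (w k)" and dw: "\<And>k. norm (w (Suc k) - w k) \<le> d * (1 - r) * r ^ k" and w00: "w 0 = w0"
    by blast
  have dist_w: "norm (w (k + j) - w k) \<le> d * r ^ k * (1 - r ^ j)" for k j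
  proof (induction j)
    case (Suc j)
    have "norm (w (k + Suc j) - w k) \<le> norm (w (Suc (k + j)) - w (k + j)) + norm (w (k + j) - w k)"
      by (metis add_Suc_right diff_add_cancel add_diff_eq norm_triangle_ineq)
    then show ?case using Suc dw[of "k + j"] by (simp add: power_add algebra_simps)
  qed simp
  have dist_w': "norm (w m - w k) \<le> d * r ^ k" if "k \<le> m" for k m
  proof -
    have "norm (w m - w k) \<le> d * r ^ k * (1 - r ^ (m - k))" using dist_w[of k "m - k"] that by simp
    also have "\<dots> \<le> d * r ^ k * 1" using d r by (intro mult_left_mono) auto
    finally show ?thesis by simp
  qed
  have lim0: "(\<lambda>k. d * r ^ k) \<longlonglongrightarrow> d * 0" using r by (intro tendsto_intros LIMSEQ_realpow_zero) auto
  have "Cauchy w"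
  proof (rule CauchyI')
    fix e :: real assume "e > 0"
    then have "\<forall>\<^sub>F k in sequentially. d * r ^ k < e" using lim0 by (intro order_tendstoD(2)) auto
    then obtain k where k: "\<And>m. m \<ge> k \<Longrightarrow> d * r ^ m < e" by (auto simp: eventually_sequentially)
    have "norm (w m - w n) < e" if "m \<ge> k" "n > m" for m n
      using dist_w'[of m n] k[OF that(1)] that(2) by (simp add: norm_minus_commute)
    then show "\<exists>M. \<forall>m\<ge>M. \<forall>n>m. dist (w m) (w n) < e" unfolding dist_norm by blast
  qed
  then obtain u where u: "w \<longlonglongrightarrow> u" using Cauchy_convergent convergent_def by blast
  have uW: "u \<in> W" using closed_sequentially[OF W(2) _ u] Q by (auto simp: Q_def)
  have du: "norm (u - w k) \<le> d * r ^ k" for k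
  proof (rule LIMSEQ_le_const2)
    show "(\<lambda>m. norm (w m - w k)) \<longlonglongrightarrow> norm (u - w k)" using u by (intro tendsto_intros)
    show "\<exists>N. \<forall>n\<ge>N. norm (w n - w k) \<le> d * r ^ k" using dist_w' by blast
  qed
  have "u \<notin> Z"
  proof
    assume "u \<in> Z"
    then have "infdist w0 Z \<le> norm (w0 - u)" using infdist_le[of u Z w0] by (simp add: dist_norm)
    also have "\<dots> \<le> d" using du[of 0] by (simp add: w00 norm_minus_commute)
    finally show False using d0(2)[OF w0(1)] w0(2) d(3) by simp
  qed
  moreover have "\<forall>\<^sub>F n in sequentially. norm (T n u) \<le> exp (real n * (lam - \<beta> / 4))"
  proof -
    have "\<forall>\<^sub>F n in sequentially. 4 + d / r ^ N \<le> exp (real n * (\<beta> / 4))"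
      using \<beta> by (intro eventually_le_exp_linear) simp
    then show ?thesis using eventually_ge_at_top[of N]
    proof eventually_elim
      case (elim n)
      \<comment> \<open>At time \<open>n\<close> the vector \<open>w k\<close> is slow, while
        \<open>u - w k\<close> has size \<open>r ^ k\<close>: even expanded at the top rate it
        contributes only \<open>lam + \<epsilon> - (\<beta> - \<epsilon>) = lam - \<beta> /
        2\<close>. The passage to \<open>lam - \<beta> / 4\<close> absorbs the constants.\<close>
      define k where "k = n - N"
      have nk: "n = N + k" using elim by (simp add: k_def)
      have rk: "r ^ k = r ^ n / r ^ N" using r by (simp add: nk power_add)
      have rn: "r ^ n = exp (real n * (- (\<beta> - \<epsilon>)))" unfolding r_def by (rule exp_of_nat_mult[symmetric])
      have "w k \<in> W" using Q[of k] by (simp add: Q_def)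
      have "T n u = T n (w k) + T n (u - w k)" by (simp add: blinfun.diff_right)
      then have "norm (T n u) \<le> norm (T n (w k)) + norm (T n (u - w k))" by (metis norm_triangle_ineq)
      also have "norm (T n (w k)) \<le> 4 * exp (real n * (lam - \<beta>))" using Q[of k] by (simp add: Q_def nk)
      also have "norm (T n (u - w k)) \<le> exp (real n * (lam + \<epsilon>')) * norm (u - w k)"
        using N(4)[OF elim(2)] uW \<open>w k \<in> W\<close> W(1) by (simp add: subspace_diff)
      also have "\<dots> \<le> exp (real n * (lam + \<epsilon>)) * (d * r ^ k)"
        using du[of k] \<epsilon>'(2) by (intro mult_mono) (auto simp: mult_left_mono)
      also have "\<dots> = (d / r ^ N) * exp (real n * (lam + \<epsilon> - (\<beta> - \<epsilon>)))"
        by (simp add: rk rn exp_add[symmetric] algebra_simps)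
      also have "\<dots> \<le> (d / r ^ N) * exp (real n * (lam - \<beta> / 2))"
        using d r \<epsilon> by (intro mult_left_mono) (auto simp: mult_left_mono)
      also have "exp (real n * (lam - \<beta>)) \<le> exp (real n * (lam - \<beta> / 2))" using \<beta> by (simp add: mult_left_mono)
      finally have "norm (T n u) \<le> (4 + d / r ^ N) * exp (real n * (lam - \<beta> / 2))" by (simp add: algebra_simps)
      also have "\<dots> \<le> exp (real n * (\<beta> / 4)) * exp (real n * (lam - \<beta> / 2))"
        using elim(1) by (rule mult_right_mono) simp
      also have "\<dots> = exp (real n * (lam - \<beta> / 4))" by (simp add: exp_add[symmetric] algebra_simps)
      finally show ?case .
    qed
  qed
  ultimately show ?thesis using uW \<beta> by (intro bexI[of _ u] exI[of _ "\<beta> / 4"]) auto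
qed

subsection \<open>Ergodic theory of subadditive processes\<close>

lemma ergodic_invariant_measureD:
  assumes "ergodic_invariant_measure M f"
  shows "sets M = sets borel" "space M = UNIV" "finite_measure M" "measure M UNIV = 1"
    "f \<in> measurable M M" "distr M M f = M"
proof -
  show s: "sets M = sets borel" and "f \<in> measurable M M" "distr M M f = M"
    using assms by (auto simp: ergodic_invariant_measure_def)
  show sp: "space M = UNIV" using sets_eq_imp_space_eq[OF s] by simp
  have 1: "emeasure M (space M) = 1" using assms by (simp add: ergodic_invariant_measure_def)
  then show "finite_measure M" by (intro finite_measureI) simp
  show "measure M UNIV = 1" using 1 sp by (simp add: measure_def)
qed

lemma funpow_measurable:
  assumes "f \<in> measurable M M" shows "(f ^^ n) \<in> measurable M M"
proof (induction n)
  case (Suc n)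
  show ?case unfolding funpow.simps(2) by (rule measurable_comp[OF Suc assms])
qed (simp add: id_def)

lemma measure_funpow_vimage:
  assumes "ergodic_invariant_measure M f" "E \<in> sets M"
  shows "(f ^^ n) -` E \<in> sets M" "measure M ((f ^^ n) -` E) = measure M E"
proof -
  note D = ergodic_invariant_measureD[OF assms(1)]
  have fn: "(f ^^ n) \<in> measurable M M" by (rule funpow_measurable[OF D(5)])
  show "(f ^^ n) -` E \<in> sets M" using measurable_sets[OF fn assms(2)] D(2) by simp
  have "distr M M (f ^^ n) = M"
  proof (induction n)
    case 0 then show ?case by (simp add: id_def)
  next
    case (Suc n)
    have "distr M M (f ^^ Suc n) = distr (distr M M (f ^^ n)) M f"
      using distr_distr[OF D(5) funpow_measurable[OF D(5)], of n] by simp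
    then show ?case by (simp only: Suc D(6))
  qed
  then show "measure M ((f ^^ n) -` E) = measure M E"
    using measure_distr[OF fn assms(2)] D(2) by simp
qed

text \<open>All iterated preimages of \<open>H\<close> have the measure of \<open>H\<close>; they
  decrease to a strictly invariant set of the same measure, to which ergodicity applies.\<close>

lemma ergodic_zero_one:
  assumes "ergodic_invariant_measure M f" "H \<in> sets M" "f -` H \<subseteq> H"
  shows "measure M H = 0 \<or> measure M H = 1"
proof -
  note D = ergodic_invariant_measureD[OF assms(1)]
  interpret finite_measure M by (rule D(3))
  define G where "G n = (f ^^ n) -` H" for n
  define E where "E = (\<Inter>n. G n)"
  have G: "G n \<in> sets M" "measure M (G n) = measure M H" for n
    using measure_funpow_vimage[OF assms(1,2)] by (auto simp: G_def)
  have dec: "G (Suc n) \<subseteq> G n" for n using assms(3) by (auto simp: G_def)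
  have Gsuc: "f -` G n = G (Suc n)" for n by (auto simp: G_def funpow_swap1)
  have "(\<lambda>n. measure M (G n)) \<longlonglongrightarrow> measure M E"
    unfolding E_def using G by (intro finite_Lim_measure_decseq decseq_SucI dec) auto
  then have "measure M E = measure M H" using G(2) LIMSEQ_unique[OF _ tendsto_const] by simp
  moreover have "E \<in> sets M" unfolding E_def using G by (intro sets.countable_INT) auto
  moreover have "f -` E = E"
  proof -
    have "f -` E = (\<Inter>n. G (Suc n))" unfolding E_def using Gsuc by (auto simp: vimage_INT)
    also have "\<dots> = E" unfolding E_def using dec by blast
    finally show ?thesis .
  qed
  moreover have "\<forall>E\<in>sets M. f -` E = E \<longrightarrow> measure M E = 0 \<or> measure M E = 1"
    using assms(1) D(2) by (simp add: ergodic_invariant_measure_def)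
  ultimately show ?thesis by metis
qed

lemma ergodic_AE_iff:
  assumes "ergodic_invariant_measure M f" "E \<in> sets M"
  shows "(AE x in M. x \<in> E) \<longleftrightarrow> measure M E = 1"
proof -
  note D = ergodic_invariant_measureD[OF assms(1)]
  interpret finite_measure M by (rule D(3))
  have "measure M (space M - E) = measure M (space M) - measure M E"
    using assms(2) by (rule finite_measure_compl)
  then have "measure M (space M - E) = 0 \<longleftrightarrow> measure M E = 1" using D by auto
  moreover have "(AE x in M. x \<in> E) \<longleftrightarrow> space M - E \<in> null_sets M"
    using AE_iff_null[of M "\<lambda>x. x \<in> E"] assms(2) by (simp add: set_diff_eq[symmetric] sets.compl_sets)
  ultimately show ?thesis using assms(2)
    by (simp add: null_sets_def emeasure_eq_measure)
qed

section \<open>Visit frequencies along orbits\<close>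

text \<open>The interval is cut greedily into blocks with average at least \<open>\<eta>\<close>: a
  single time where \<open>b\<close> is 1, which uses \<open>\<eta> \<le> 1\<close>, or a block of
  length at most \<open>N\<close>. Only a remainder of length at most \<open>N\<close> is
  lost.\<close>

lemma greedy_sum_ge:
  fixes b :: "nat \<Rightarrow> real"
  assumes "\<And>t. 0 \<le> b t" "0 \<le> \<eta>" "\<eta> \<le> 1"
    and "\<And>t. b t = 1 \<or> (\<exists>n\<ge>1. n \<le> N \<and> \<eta> * real n \<le> (\<Sum>s\<in>{t..<t+n}. b s))"
  shows "\<eta> * (real L - real N) \<le> (\<Sum>s\<in>{t..<t+L}. b s)"
proof (induction L arbitrary: t rule: less_induct)
  case (less L)
  show ?case
  proof (cases "L \<le> N")
    case True
    then have "\<eta> * (real L - real N) \<le> 0" using assms(2) by (simp add: mult_nonneg_nonpos)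
    also have "0 \<le> (\<Sum>s\<in>{t..<t+L}. b s)" using assms(1) by (intro sum_nonneg) auto
    finally show ?thesis .
  next
    case False
    obtain n where n: "n \<ge> 1" "n \<le> L" "\<eta> * real n \<le> (\<Sum>s\<in>{t..<t+n}. b s)"
    proof (cases "b t = 1")
      case True
      then show ?thesis using that[of 1] False assms(3) by simp
    next
      case b: False
      then obtain n where "n \<ge> 1" "n \<le> N" "\<eta> * real n \<le> (\<Sum>s\<in>{t..<t+n}. b s)" using assms(4) by blast
      then show ?thesis using that[of n] False by simp
    qed
    have "\<eta> * (real (L - n) - real N) \<le> (\<Sum>s\<in>{t+n..<t+n+(L-n)}. b s)" using n False by (intro less.IH) auto
    moreover have "(\<Sum>s\<in>{t..<t+L}. b s) = (\<Sum>s\<in>{t..<t+n}. b s) + (\<Sum>s\<in>{t+n..<t+n+(L-n)}. b s)"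
      using n by (simp add: sum.atLeastLessThan_concat)
    moreover have "\<eta> * (real L - real N) = \<eta> * real n + \<eta> * (real (L - n) - real N)"
      using n(2) by (simp add: of_nat_diff algebra_simps)
    ultimately show ?thesis using n(3) by linarith
  qed
qed

definition visits :: "('a \<Rightarrow> 'a) \<Rightarrow> 'a set \<Rightarrow> nat \<Rightarrow> 'a \<Rightarrow> real" where
  "visits f B n x = (\<Sum>t<n. indicator B ((f ^^ t) x))"

lemma visits_measurable:
  assumes "f \<in> measurable M M" "B \<in> sets M" shows "visits f B n \<in> borel_measurable M"
proof -
  have "(\<lambda>x. indicator B ((f ^^ t) x) :: real) \<in> borel_measurable M" for t
    by (rule measurable_compose[OF funpow_measurable[OF assms(1)] borel_measurable_indicator[OF assms(2)]])
  then show ?thesis unfolding visits_def by (intro borel_measurable_sum) auto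
qed

lemma visits_shift: "visits f B n ((f ^^ t) x) = (\<Sum>s\<in>{t..<t+n}. indicator B ((f ^^ s) x))"
proof -
  have "(\<Sum>s\<in>{t..<t+n}. indicator B ((f ^^ s) x)) = (\<Sum>s\<in>{0..<n}. indicator B ((f ^^ (s + t)) x) :: real)"
    using sum.shift_bounds_nat_ivl[of "\<lambda>s. indicator B ((f ^^ s) x) :: real" 0 t n] by (simp add: add.commute)
  then show ?thesis by (simp add: visits_def funpow_add lessThan_atLeast0)
qed

lemma visits_Suc_ge: "visits f B n (f x) \<le> visits f B (Suc n) x"
  unfolding visits_def sum.lessThan_Suc_shift by (simp add: funpow_swap1)

lemma integral_visits:
  assumes "ergodic_invariant_measure M f" "B \<in> sets M"
  shows "integrable M (visits f B n)" "integral\<^sup>L M (visits f B n) = real n * measure M B"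
proof -
  note D = ergodic_invariant_measureD[OF assms(1)]
  interpret finite_measure M by (rule D(3))
  have eq: "(\<lambda>x. indicator B ((f ^^ t) x) :: real) = indicator ((f ^^ t) -` B)" for t
    by (auto simp: indicator_def fun_eq_iff)
  have i: "integrable M (\<lambda>x. indicator B ((f ^^ t) x) :: real)" for t
    unfolding eq using measure_funpow_vimage[OF assms] by (intro integrable_real_indicator) (auto simp: emeasure_eq_measure)
  have e: "integral\<^sup>L M (\<lambda>x. indicator B ((f ^^ t) x) :: real) = measure M B" for t
    unfolding eq using measure_funpow_vimage[OF assms] D(2) by simp
  show "integrable M (visits f B n)" unfolding visits_def using i by auto
  show "integral\<^sup>L M (visits f B n) = real n * measure M B"
    unfolding visits_def using i e by (subst Bochner_Integration.integral_sum) auto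
qed

lemma eventually_linear_le:
  fixes a b K :: real
  assumes "a < b" shows "\<forall>\<^sub>F n in sequentially. K + a * real n \<le> b * real n"
proof -
  obtain N :: nat where N: "\<bar>K\<bar> / (b - a) < real N" using reals_Archimedean2 by blast
  have "K + a * real n \<le> b * real n" if "n \<ge> N" for n
  proof -
    have "\<bar>K\<bar> / (b - a) \<le> real n" using N that by linarith
    then have "\<bar>K\<bar> \<le> real n * (b - a)" using assms by (simp add: field_simps)
    then show ?thesis by (simp add: algebra_simps)
  qed
  then show ?thesis using eventually_sequentially by blast
qed

lemma measure_decreasing_small:
  assumes "finite_measure M" "\<And>n. B n \<in> sets M" "decseq B" "AE x in M. \<exists>n. x \<notin> B n" "e > 0"
  shows "\<exists>n. measure M (B n) < e"
proof -
  interpret finite_measure M by fact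
  have "(\<lambda>n. measure M (B n)) \<longlonglongrightarrow> measure M (\<Inter>n. B n)"
    using assms by (intro finite_Lim_measure_decseq) auto
  moreover have "measure M (\<Inter>n. B n) = 0"
  proof -
    have "AE x in M. x \<notin> (\<Inter>n. B n)" using assms(4) by eventually_elim auto
    moreover have "(\<Inter>n. B n) \<in> sets M" using assms(2) by (intro sets.countable_INT) auto
    ultimately have "emeasure M (\<Inter>n. B n) = 0" using AE_iff_null_sets by blast
    then show ?thesis by (simp add: measure_def)
  qed
  ultimately have "\<forall>\<^sub>F n in sequentially. measure M (B n) < e" using assms(5) by (intro order_tendstoD(2)) auto
  then show ?thesis by (auto simp: eventually_sequentially)
qed

text \<open>The upper half of Birkhoff's theorem for an indicator. If visits were too frequent
  infinitely often, covering orbits by good blocks would force a slightly larger set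
  \<open>b\<close> to be visited with frequency at least \<open>\<eta>0\<close> along every orbit;
  integration contradicts \<open>measure M b < \<eta>0\<close>.\<close>

lemma visit_frequency_le:
  assumes E: "ergodic_invariant_measure M f" and B: "B \<in> sets M" "measure M B < \<eta>" "\<eta> \<le> 1"
  shows "AE x in M. \<forall>\<^sub>F n in sequentially. visits f B n x \<le> \<eta> * real n"
proof -
  note D = ergodic_invariant_measureD[OF E]
  interpret finite_measure M by (rule D(3))
  obtain \<eta>0 where \<eta>0: "measure M B < \<eta>0" "\<eta>0 < \<eta>" using dense[OF B(2)] by blast
  have \<eta>0': "0 \<le> \<eta>0" "\<eta>0 \<le> 1" using \<eta>0 B(3) measure_nonneg[of M B] by linarith+
  note [measurable] = visits_measurable[OF D(5) B(1)]
  \<comment> \<open>The union over the margins \<open>1 / (j + 1)\<close> absorbs the time shift: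
    passing from \<open>f x\<close> to \<open>x\<close> only replaces \<open>j\<close> by
    \<open>Suc j\<close>.\<close>
  define F where "F = {x\<in>space M. \<exists>j::nat. \<forall>N. \<exists>n\<ge>N. (\<eta>0 + 1 / (real j + 1)) * real n < visits f B n x}"
  have F: "F \<in> sets M" unfolding F_def by measurable
  have "f -` F \<subseteq> F"
  proof
    fix x assume "x \<in> f -` F"
    then obtain j where j: "\<And>N. \<exists>n\<ge>N. (\<eta>0 + 1 / (real j + 1)) * real n < visits f B n (f x)" by (auto simp: F_def)
    define c where "c = \<eta>0 + 1 / (real (Suc j) + 1)"
    have "c < \<eta>0 + 1 / (real j + 1)" unfolding c_def by (simp add: field_simps)
    then have "\<forall>\<^sub>F n in sequentially. c + c * real n \<le> (\<eta>0 + 1 / (real j + 1)) * real n" by (rule eventually_linear_le)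
    then obtain N0 where N0: "\<And>n. n \<ge> N0 \<Longrightarrow> c + c * real n \<le> (\<eta>0 + 1 / (real j + 1)) * real n"
      by (auto simp: eventually_sequentially)
    have "\<exists>n\<ge>N. c * real n < visits f B n x" for N
    proof -
      obtain n where n: "n \<ge> max N N0" "(\<eta>0 + 1 / (real j + 1)) * real n < visits f B n (f x)" using j by blast
      then have "c * real (Suc n) < visits f B (Suc n) x"
        using N0[of n] visits_Suc_ge[of f B n x] by (simp add: algebra_simps)
      then show ?thesis using n(1) by (intro exI[of _ "Suc n"]) auto
    qed
    then show "x \<in> F" unfolding F_def c_def using D(2) by blast
  qed
  then have F01: "measure M F = 0 \<or> measure M F = 1" by (rule ergodic_zero_one[OF E F])
  have "measure M F \<noteq> 1"
  proof
    assume "measure M F = 1"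
    then have AEF: "AE x in M. x \<in> F" using ergodic_AE_iff[OF E F] by simp
    define B' where "B' N = {x\<in>space M. \<forall>n\<in>{1..N}. visits f B n x < \<eta>0 * real n}" for N
    have B': "B' N \<in> sets M" for N unfolding B'_def by measurable
    have dec: "decseq B'" by (auto simp: decseq_def B'_def)
    have "AE x in M. \<exists>N. x \<notin> B' N" using AEF
    proof eventually_elim
      case (elim x)
      then obtain j n where n: "n \<ge> 1" "(\<eta>0 + 1 / (real (j::nat) + 1)) * real n < visits f B n x"
        unfolding F_def by blast
      have "\<eta>0 * real n \<le> (\<eta>0 + 1 / (real j + 1)) * real n" by (intro mult_right_mono) auto
      then have "\<eta>0 * real n \<le> visits f B n x" using n by linarith
      then have "x \<notin> B' n" using n(1) by (auto simp: B'_def not_less intro!: bexI[of _ n])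
      then show ?case by blast
    qed
    then obtain N where N: "measure M (B' N) < \<eta>0 - measure M B"
      using measure_decreasing_small[OF D(3) B' dec] \<eta>0(1) by (meson diff_gt_0_iff_gt)
    \<comment> \<open>Points without a good block of length at most \<open>N\<close> are counted as
      visits, so that every time is covered.\<close>
    define b where "b = B \<union> B' N"
    have b: "b \<in> sets M" using B B' by (simp add: b_def)
    have mb: "measure M b < \<eta>0" using measure_Un_le[OF B(1) B'[of N]] N by (simp add: b_def)
    have ge: "\<eta>0 * (real L - real N) \<le> visits f b L x" for L x
    proof -
      have "indicator b ((f ^^ t) x) = (1::real) \<or>
         (\<exists>n\<ge>1. n \<le> N \<and> \<eta>0 * real n \<le> (\<Sum>s\<in>{t..<t+n}. indicator b ((f ^^ s) x)))" for t
      proof (cases "(f ^^ t) x \<in> b")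
        case False
        then obtain n where n: "n \<ge> 1" "n \<le> N" "\<eta>0 * real n \<le> visits f B n ((f ^^ t) x)"
          using D(2) by (auto simp: b_def B'_def not_less)
        moreover have "visits f B n ((f ^^ t) x) \<le> visits f b n ((f ^^ t) x)"
          unfolding visits_def by (intro sum_mono) (auto simp: b_def indicator_def)
        ultimately have "\<eta>0 * real n \<le> visits f b n ((f ^^ t) x)" by linarith
        then show ?thesis using n(1,2) unfolding visits_shift by blast
      qed simp
      from greedy_sum_ge[OF _ \<eta>0' this, of L 0] show ?thesis by (simp add: visits_def lessThan_atLeast0)
    qed
    have "\<eta>0 * (real L - real N) \<le> real L * measure M b" for L
    proof -
      have "integral\<^sup>L M (\<lambda>_. \<eta>0 * (real L - real N)) \<le> integral\<^sup>L M (visits f b L)"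
        using ge by (intro integral_mono integral_visits[OF E b]) auto
      then show ?thesis using integral_visits(2)[OF E b] D by simp
    qed
    then have "\<eta>0 * real L \<le> \<eta>0 * real N + measure M b * real L" for L by (simp add: algebra_simps)
    moreover obtain L where "(\<eta>0 * real N + 1) + measure M b * real L \<le> \<eta>0 * real L"
      using eventually_linear_le[OF mb, of "\<eta>0 * real N + 1"] by (auto simp: eventually_sequentially)
    ultimately show False by (smt (verit))
  qed
  then have "measure M F = 0" using F01 by simp
  then have "AE x in M. x \<notin> F" using F by (intro AE_not_in) (simp add: null_sets_def emeasure_eq_measure)
  then show ?thesis
  proof eventually_elim
    case (elim x)
    obtain j :: nat where j: "1 / (\<eta> - \<eta>0) < real j" using reals_Archimedean2 by blast
    have "1 / (\<eta> - \<eta>0) \<le> real j + 1" using j by linarith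
    then have j': "1 / (real j + 1) \<le> \<eta> - \<eta>0" using \<eta>0 by (simp add: field_simps)
    have "\<forall>j::nat. \<exists>N. \<forall>n\<ge>N. visits f B n x \<le> (\<eta>0 + 1 / (real j + 1)) * real n"
      using elim D(2) unfolding F_def by (auto simp: not_less)
    then obtain N where N: "\<And>n. n \<ge> N \<Longrightarrow> visits f B n x \<le> (\<eta>0 + 1 / (real j + 1)) * real n" by blast
    have "visits f B n x \<le> \<eta> * real n" if "n \<ge> N" for n
      using N[OF that] mult_right_mono[of "\<eta>0 + 1 / (real j + 1)" \<eta> "real n"] j' by linarith
    then show ?case using eventually_sequentially by blast
  qed
qed

text \<open>In the application \<open>P n x c\<close> says that a submultiplicative quantity attached to
  \<open>\<A>(x,n)\<close> is at most \<open>exp c\<close>. The dichotomy below is the part of the subadditive ergodic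
  theorem that survives without integrability from below.\<close>

locale subadditive_process =
  fixes M :: "'a::topological_space measure" and f :: "'a \<Rightarrow> 'a" and X0 :: "'a set"
    and P :: "nat \<Rightarrow> 'a \<Rightarrow> real \<Rightarrow> bool" and C :: real
  assumes ergodic: "ergodic_invariant_measure M f"
    and X0: "X0 \<in> sets M" "measure M X0 = 1" "f ` X0 \<subseteq> X0"
    and P_sets: "\<And>n c. {x\<in>X0. P n x c} \<in> sets M"
    and P_mono: "\<And>n x c d. x \<in> X0 \<Longrightarrow> P n x c \<Longrightarrow> c \<le> d \<Longrightarrow> P n x d"
    and P_add: "\<And>n m x c d. x \<in> X0 \<Longrightarrow> P n x c \<Longrightarrow> P m ((f ^^ n) x) d \<Longrightarrow> P (n + m) x (c + d)"
    and P_trivial: "\<And>n x. x \<in> X0 \<Longrightarrow> P n x (C * real n)"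
begin

lemma funpow_X0: "x \<in> X0 \<Longrightarrow> (f ^^ n) x \<in> X0"
  using X0(3) by (induction n) auto

lemma AE_X0: "AE x in M. x \<in> X0"
  using ergodic_AE_iff[OF ergodic X0(1)] X0(2) by simp

text \<open>The covering of \<open>greedy_sum_ge\<close> again: good blocks cost the rate
  \<open>a\<close>, while each time in \<open>B\<close> and a final stretch of at most
  \<open>N\<close> steps cost the trivial rate \<open>C\<close>, hence the surcharge
  \<open>C - a\<close>.\<close>

lemma greedy_bound:
  assumes "x \<in> X0" "a \<le> C" and good: "\<And>t. (f ^^ t) x \<notin> B \<Longrightarrow> \<exists>n\<ge>1. n \<le> N \<and> P n ((f ^^ t) x) (a * real n)"
  shows "P L ((f ^^ t) x) (a * real L + (C - a) * ((\<Sum>s\<in>{t..<t+L}. indicator B ((f ^^ s) x)) + real N))"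
proof (induction L arbitrary: t rule: less_induct)
  case (less L)
  have tX: "(f ^^ t) x \<in> X0" by (rule funpow_X0[OF assms(1)])
  define S where "S t L = (\<Sum>s\<in>{t..<t+L}. indicator B ((f ^^ s) x) :: real)" for t L
  have S0: "S t L \<ge> 0" for t L unfolding S_def by (intro sum_nonneg) auto
  show ?case unfolding S_def[symmetric]
  proof (cases "L \<le> N")
    case True
    have "C * real L = a * real L + (C - a) * real L" by (simp add: algebra_simps)
    also have "\<dots> \<le> a * real L + (C - a) * (S t L + real N)"
      using True assms(2) S0[of t L] by (intro add_left_mono mult_left_mono) auto
    finally show "P L ((f ^^ t) x) (a * real L + (C - a) * (S t L + real N))" using P_mono[OF tX P_trivial[OF tX]] by blast
  next
    case False
    obtain n c where n: "n \<ge> 1" "n \<le> L" "P n ((f ^^ t) x) c" "c \<le> a * real n + (C - a) * S t n"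
    proof (cases "(f ^^ t) x \<in> B")
      case True
      then have "S t 1 = 1" by (simp add: S_def)
      then show ?thesis using that[of 1 "C * real 1"] P_trivial[OF tX, of 1] False by simp
    next
      case nB: False
      then obtain n where n: "n \<ge> 1" "n \<le> N" "P n ((f ^^ t) x) (a * real n)" using good by blast
      then show ?thesis using that[of n "a * real n"] S0[of t n] False assms(2) by simp
    qed
    have "P (L - n) ((f ^^ (t + n)) x) (a * real (L - n) + (C - a) * (S (t + n) (L - n) + real N))"
      unfolding S_def using n False by (intro less.IH) auto
    then have "P (n + (L - n)) ((f ^^ t) x) (c + (a * real (L - n) + (C - a) * (S (t + n) (L - n) + real N)))"
      using n(3) P_add[OF tX] by (simp add: funpow_add add.commute)
    moreover have "S t L = S t n + S (t + n) (L - n)"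
      unfolding S_def using n by (simp add: sum.atLeastLessThan_concat)
    then have "a * real n + (C - a) * S t n + (a * real (L - n) + (C - a) * (S (t + n) (L - n) + real N))
        = a * real L + (C - a) * (S t L + real N)" using n(2) by (simp add: of_nat_diff algebra_simps)
    ultimately show "P L ((f ^^ t) x) (a * real L + (C - a) * (S t L + real N))"
      using n(2,4) P_mono[OF tX, of L "c + (a * real (L - n) + (C - a) * (S (t + n) (L - n) + real N))"] by simp
  qed
qed

text \<open>A bound attained once, at a time depending on the point, propagates along the orbit: the
  points with no such time up to \<open>N\<close> form a set of small measure, and by
  \<open>visit_frequency_le\<close> the visits to it add little to the rate.\<close>

lemma eventually_of_once:
  assumes "AE x in M. \<exists>n\<ge>1. P n x (a * real n)" "\<epsilon> > 0"
  shows "AE x in M. \<forall>\<^sub>F n in sequentially. P n x ((a + \<epsilon>) * real n)"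
proof (cases "a \<le> C")
  case False
  have "C * real n \<le> (a + \<epsilon>) * real n" for n using False assms(2) by (intro mult_right_mono) auto
  then show ?thesis using AE_X0 P_mono[OF _ P_trivial] by (auto elim!: eventually_mono)
next
  case True
  note D = ergodic_invariant_measureD[OF ergodic]
  define B where "B N = {x\<in>X0. \<forall>n\<in>{1..N}. \<not> P n x (a * real n)}" for N
  have B: "B N \<in> sets M" for N
  proof -
    have "B N = X0 - (\<Union>n\<in>{1..N}. {x\<in>X0. P n x (a * real n)})" by (auto simp: B_def)
    also have "\<dots> \<in> sets M" using X0 P_sets by (intro sets.Diff sets.finite_UN) auto
    finally show ?thesis .
  qed
  have dec: "decseq B" by (auto simp: decseq_def B_def)
  have "AE x in M. \<exists>N. x \<notin> B N" using assms(1)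
  proof eventually_elim
    case (elim x)
    then obtain n where "n \<ge> 1" "P n x (a * real n)" by blast
    then have "x \<notin> B n" by (auto simp: B_def intro!: bexI[of _ n])
    then show ?case by blast
  qed
  define \<eta> where "\<eta> = min 1 (\<epsilon> / (2 * (C - a + 1)))"
  have \<eta>: "\<eta> > 0" "\<eta> \<le> 1" using True assms(2) by (auto simp: \<eta>_def)
  have "(C - a) * \<eta> \<le> (C - a) * (\<epsilon> / (2 * (C - a + 1)))" using True by (intro mult_left_mono) (auto simp: \<eta>_def)
  also have "\<dots> \<le> (C - a + 1) * (\<epsilon> / (2 * (C - a + 1)))" using True assms(2) by (intro mult_right_mono) auto
  also have "\<dots> = \<epsilon> / 2" using True by (simp add: field_simps)
  finally have \<eta>\<epsilon>: "(C - a) * \<eta> \<le> \<epsilon> / 2" .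
  obtain N where N: "measure M (B N) < \<eta>"
    using measure_decreasing_small[OF D(3) B dec \<open>AE x in M. \<exists>N. x \<notin> B N\<close> \<eta>(1)] by blast
  show ?thesis using visit_frequency_le[OF ergodic B N \<eta>(2)] AE_X0
  proof eventually_elim
    case (elim x)
    have "\<forall>\<^sub>F n in sequentially. (C - a) * real N + (\<epsilon> / 2) * real n \<le> \<epsilon> * real n"
      using assms(2) by (intro eventually_linear_le) simp
    then show ?case using elim(1)
    proof eventually_elim
      case (elim n)
      have "\<exists>m\<ge>1. m \<le> N \<and> P m ((f ^^ t) x) (a * real m)" if "(f ^^ t) x \<notin> B N" for t
        using that funpow_X0[OF \<open>x \<in> X0\<close>, of t] by (auto simp: B_def)
      from greedy_bound[OF \<open>x \<in> X0\<close> True this, where L = n and t = 0]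
      have "P n x (a * real n + (C - a) * (visits f (B N) n x + real N))"
        by (simp add: visits_def lessThan_atLeast0)
      moreover have "(C - a) * visits f (B N) n x \<le> (C - a) * (\<eta> * real n)"
        using elim(2) True by (intro mult_left_mono) auto
      moreover have "(C - a) * \<eta> * real n \<le> (\<epsilon> / 2) * real n" using \<eta>\<epsilon> by (rule mult_right_mono) simp
      ultimately show ?case
        using elim(1) P_mono[OF \<open>x \<in> X0\<close>, of n "a * real n + (C - a) * (visits f (B N) n x + real N)" "(a + \<epsilon>) * real n"]
        by (simp add: algebra_simps)
    qed
  qed
qed

text \<open>Either bounds with rate below \<open>a\<close> hold infinitely often almost everywhere,
  and \<open>eventually_of_once\<close> applies, or they do so only on a null set.\<close>

lemma dichotomy:
  "(\<forall>\<epsilon>>0. AE x in M. \<forall>\<^sub>F n in sequentially. P n x ((a + \<epsilon>) * real n)) \<or>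
   (\<forall>\<epsilon>>0. AE x in M. \<forall>\<^sub>F n in sequentially. \<not> P n x ((a - \<epsilon>) * real n))"
proof -
  note D = ergodic_invariant_measureD[OF ergodic]
  interpret finite_measure M by (rule D(3))
  define H where "H = {x\<in>X0. \<exists>j::nat. \<forall>N. \<exists>n\<ge>N. P n x ((a - 1 / (real j + 1)) * real n)}"
  have "H = (\<Union>j. \<Inter>N. \<Union>n\<in>{N..}. {x\<in>X0. P n x ((a - 1 / (real (j::nat) + 1)) * real n)})"
    unfolding H_def by (simp add: set_eq_iff Bex_def)
  also have "\<dots> \<in> sets M"
    using P_sets by (intro sets.countable_UN sets.countable_INT sets.countable_UN' subsetI image_subsetI) auto
  finally have H: "H \<in> sets M" .
  \<comment> \<open>Points outside \<open>X0\<close> may be mapped into \<open>H\<close>; adding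
    them makes the preimage of \<open>H'\<close> a subset of \<open>H'\<close>.\<close>
  define H' where "H' = H \<union> (UNIV - X0)"
  have H': "H' \<in> sets M" using H X0(1) sets.compl_sets[OF X0(1)] D(2) by (simp add: H'_def)
  have "f -` H' \<subseteq> H'"
  proof
    fix x assume x: "x \<in> f -` H'"
    show "x \<in> H'"
    proof (cases "x \<in> X0")
      case True
      then have "f x \<in> H" using x X0(3) by (auto simp: H'_def)
      then obtain j where j: "\<And>N. \<exists>n\<ge>N. P n (f x) ((a - 1 / (real (j::nat) + 1)) * real n)" by (auto simp: H_def)
      define c c' where "c = a - 1 / (real j + 1)" and "c' = a - 1 / (real (Suc j) + 1)"
      have "c < c'" unfolding c_def c'_def by (simp add: field_simps)
      then have "\<forall>\<^sub>F n in sequentially. (C - c') + c * real n \<le> c' * real n" by (rule eventually_linear_le)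
      then obtain N0 where N0: "\<And>n. n \<ge> N0 \<Longrightarrow> (C - c') + c * real n \<le> c' * real n"
        by (auto simp: eventually_sequentially)
      have "\<exists>n\<ge>N. P n x (c' * real n)" for N
      proof -
        obtain n where n: "n \<ge> max N N0" "P n (f x) (c * real n)" using j unfolding c_def by blast
        have "P (1 + n) x (C * real 1 + c * real n)" using P_add[OF True P_trivial[OF True, of 1]] n(2) by simp
        moreover have "C * real 1 + c * real n \<le> c' * real (1 + n)" using N0[of n] n(1) by (simp add: algebra_simps)
        ultimately have "P (1 + n) x (c' * real (1 + n))" by (rule P_mono[OF True])
        then show ?thesis using n(1) by (intro exI[of _ "1 + n"]) auto
      qed
      then have "x \<in> H" unfolding H_def c'_def using True by blast
      then show ?thesis by (simp add: H'_def)
    qed (simp add: H'_def)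
  qed
  then have "measure M H' = 0 \<or> measure M H' = 1" by (rule ergodic_zero_one[OF ergodic H'])
  then show ?thesis
  proof
    assume "measure M H' = 1"
    then have "AE x in M. x \<in> H'" using ergodic_AE_iff[OF ergodic H'] by simp
    then have "AE x in M. \<exists>n\<ge>1. P n x (a * real n)" using AE_X0
    proof eventually_elim
      case (elim x)
      then obtain j n where n: "n \<ge> 1" "P n x ((a - 1 / (real (j::nat) + 1)) * real n)" unfolding H'_def H_def by blast
      have "(a - 1 / (real j + 1)) * real n \<le> a * real n" by (intro mult_right_mono) auto
      then show ?case using n P_mono[OF elim(2)] by blast
    qed
    then show ?thesis using eventually_of_once by blast
  next
    assume "measure M H' = 0"
    then have "AE x in M. x \<notin> H'" using H' by (intro AE_not_in) (simp add: null_sets_def emeasure_eq_measure)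
    then have "AE x in M. \<forall>\<^sub>F n in sequentially. \<not> P n x ((a - \<epsilon>) * real n)" if "\<epsilon> > 0" for \<epsilon>
    proof eventually_elim
      case (elim x)
      then have x: "x \<in> X0" "x \<notin> H" by (auto simp: H'_def)
      obtain j :: nat where "1 / \<epsilon> < real j" using reals_Archimedean2 by blast
      then have "1 / \<epsilon> \<le> real j + 1" by linarith
      then have j': "1 / (real j + 1) \<le> \<epsilon>" using \<open>\<epsilon> > 0\<close> by (simp add: field_simps)
      obtain N where N: "\<And>n. n \<ge> N \<Longrightarrow> \<not> P n x ((a - 1 / (real j + 1)) * real n)"
        using x unfolding H_def by blast
      have "(a - \<epsilon>) * real n \<le> (a - 1 / (real j + 1)) * real n" for n using j' by (intro mult_right_mono) auto
      then show ?case unfolding eventually_sequentially using N P_mono[OF x(1)] by blast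
    qed
    then show ?thesis by blast
  qed
qed

end

subsection \<open>Cocycles and measurability\<close>

lemma cocycle_add: "cocycle f A x (n + m) = cocycle f A ((f ^^ n) x) m o\<^sub>L cocycle f A x n"
proof (induction m)
  case (Suc m)
  have "(f ^^ (n + m)) x = (f ^^ m) ((f ^^ n) x)" by (metis add.commute comp_apply funpow_add)
  then show ?case using Suc by (intro blinfun_eqI) simp
qed (intro blinfun_eqI, simp)

lemma norm_cocycle_Suc_le:
  assumes "\<And>x. norm (A x) \<le> exp C"
  shows "norm (cocycle f A x (Suc n) w) \<le> exp C * norm (cocycle f A x n w)"
proof -
  have "norm (cocycle f A x (Suc n) w) \<le> norm (A ((f ^^ n) x)) * norm (cocycle f A x n w)"
    by (simp add: norm_blinfun)
  also have "\<dots> \<le> exp C * norm (cocycle f A x n w)" using assms by (intro mult_right_mono) auto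
  finally show ?thesis .
qed

lemma norm_cocycle_apply_le:
  assumes "\<And>x. norm (A x) \<le> exp C"
  shows "norm (cocycle f A x n w) \<le> exp (real n * C) * norm w"
proof (induction n)
  case (Suc n)
  have "norm (cocycle f A x (Suc n) w) \<le> exp C * norm (cocycle f A x n w)" by (rule norm_cocycle_Suc_le[OF assms])
  also have "\<dots> \<le> exp C * (exp (real n * C) * norm w)" using Suc by (rule mult_left_mono) simp
  finally show ?case by (simp add: exp_add distrib_right)
qed simp

lemma continuous_on_funpow:
  fixes f :: "'a::topological_space \<Rightarrow> 'a"
  assumes "continuous_on UNIV f" shows "continuous_on UNIV (f ^^ n)"
proof (induction n)
  case (Suc n)
  have "continuous_on UNIV (\<lambda>x. f ((f ^^ n) x))" by (rule continuous_on_compose2[OF assms Suc]) simp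
  then show ?case by (simp add: o_def)
qed (simp add: id_def)

lemma continuous_on_cocycle:
  assumes "continuous_on UNIV f" "continuous_on UNIV A"
  shows "continuous_on UNIV (\<lambda>x. cocycle f A x n)"
proof (induction n)
  case (Suc n)
  have "continuous_on UNIV (\<lambda>x. A ((f ^^ n) x))"
    using continuous_on_compose2[OF assms(2) continuous_on_funpow[OF assms(1)]] by simp
  then show ?case using bounded_bilinear.continuous_on[OF bounded_bilinear_blinfun_compose] Suc by simp
qed simp

lemma cocycle_image_subset:
  assumes "f ` X0 \<subseteq> X0" "\<And>x. x \<in> X0 \<Longrightarrow> blinfun_apply (A x) ` V x \<subseteq> V (f x)" "x \<in> X0"
  shows "blinfun_apply (cocycle f A x n) ` V x \<subseteq> V ((f ^^ n) x)"
proof (induction n)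
  case (Suc n)
  have "(f ^^ n) x \<in> X0" using assms(1,3) by (induction n) auto
  then show ?case using Suc assms(2)[of "(f ^^ n) x"] by auto
qed simp

section \<open>Effros measurability of volume bounds\<close>

definition countable_dense :: "'a::metric_space set \<Rightarrow> bool" where
  "countable_dense D \<longleftrightarrow> countable D \<and> (\<forall>x. \<forall>e>0. \<exists>d\<in>D. dist d x < e)"

lemma compact_countable_dense:
  assumes "compact (UNIV :: 'a::metric_space set)" shows "\<exists>D :: 'a set. countable_dense D"
proof -
  have "\<forall>n::nat. \<exists>k. finite k \<and> (UNIV :: 'a set) \<subseteq> (\<Union>x\<in>k. ball x (1 / (real n + 1)))"
    using assms compact_eq_totally_bounded by (metis add_nonneg_pos divide_pos_pos of_nat_0_le_iff zero_less_one)
  then obtain k where k: "\<And>n::nat. finite (k n)" "\<And>n. (UNIV :: 'a set) \<subseteq> (\<Union>x\<in>k n. ball x (1 / (real n + 1)))" by metis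
  have "\<exists>d\<in>(\<Union>n. k n). dist d x < e" if "e > 0" for x e
  proof -
    obtain n :: nat where "1 / e < real n" using reals_Archimedean2 by blast
    then have n: "1 / (real n + 1) < e" using that by (simp add: field_simps)
    have "x \<in> (\<Union>y\<in>k n. ball y (1 / (real n + 1)))" using k(2)[of n] by blast
    then obtain d where "d \<in> k n" "dist d x < 1 / (real n + 1)" by auto
    then show ?thesis using n by (intro bexI[of _ d]) auto
  qed
  moreover have "countable (\<Union>n. k n)" using k(1) by (intro countable_UN) (auto intro: countable_finite)
  ultimately show ?thesis unfolding countable_dense_def by blast
qed

lemma separable_countable_dense:
  assumes "separable_space (euclidean :: 'b::metric_space topology)" shows "\<exists>D :: 'b set. countable_dense D"
proof -
  obtain D :: "'b set" where D: "countable D" "euclidean closure_of D = UNIV"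
    using assms unfolding separable_space_def by auto
  then have "closure D = UNIV" by simp
  then have "\<exists>d\<in>D. dist d x < e" if "e > 0" for x e using that closure_approachable by (metis UNIV_I)
  then show ?thesis using D(1) unfolding countable_dense_def by blast
qed

text \<open>As the condition is open, it holds at \<open>x\<close> with some \<open>us\<close>
  exactly if it holds on a product of balls of equal radius with centres in the dense sets, where
  \<open>x\<close> lies in the first ball and \<open>V x\<close> meets the others. There are
  countably many such products, and each gives a measurable set.\<close>

lemma effros_exists_list_sets:
  fixes M :: "'a::metric_space measure" and V :: "'a \<Rightarrow> 'b::metric_space set"
  assumes "sets M = sets borel" "X0 \<in> sets M" and DX: "countable_dense (DX :: 'a set)" and DB: "countable_dense (DB :: 'b set)"
    and V: "\<And>U. open U \<Longrightarrow> {x\<in>X0. V x \<inter> U \<noteq> {}} \<in> sets M"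
    and Q: "\<And>x us. length us = p \<Longrightarrow> Q x us \<Longrightarrow>
       \<exists>\<eta>>0. \<forall>x' us'. dist x x' < \<eta> \<longrightarrow> list_all2 (\<lambda>u u'. dist u u' < \<eta>) us us' \<longrightarrow> Q x' us'"
  shows "{x\<in>X0. \<exists>us. length us = p \<and> set us \<subseteq> V x \<and> Q x us} \<in> sets M"
proof -
  define \<rho> :: "nat \<Rightarrow> real" where "\<rho> k = 1 / (real k + 1)" for k
  have \<rho>: "\<rho> k > 0" for k by (simp add: \<rho>_def)
  define I where "I = {(d, ds, k). d \<in> DX \<and> ds \<in> lists DB \<and> length ds = p \<and>
     (\<forall>x' us'. dist d x' < \<rho> k \<longrightarrow> list_all2 (\<lambda>u u'. dist u u' < \<rho> k) ds us' \<longrightarrow> Q x' us')}"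
  define S where "S = (\<lambda>(d, ds, k). (X0 \<inter> ball d (\<rho> k)) \<inter> (\<Inter>j\<in>{..<p}. X0 \<inter> {x\<in>X0. V x \<inter> ball (ds ! j) (\<rho> k) \<noteq> {}}))"
  have "I \<subseteq> DX \<times> (lists DB \<times> UNIV)" by (auto simp: I_def)
  moreover have "countable (DX \<times> (lists DB \<times> (UNIV :: nat set)))"
    using DX DB by (intro countable_SIGMA) (auto simp: countable_dense_def)
  ultimately have cI: "countable I" by (rule countable_subset)
  have S: "S i \<in> sets M" if i: "i \<in> I" for i
  proof -
    obtain d ds k where dk: "i = (d, ds, k)" by (cases i) auto
    have b: "X0 \<inter> ball d (\<rho> k) \<in> sets M" using assms(1,2) by auto
    have "X0 \<inter> {x\<in>X0. V x \<inter> ball (ds ! j) (\<rho> k) \<noteq> {}} \<in> sets M" for j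
      using V[of "ball (ds ! j) (\<rho> k)"] assms(2) by auto
    then have "{..<p} \<noteq> {} \<Longrightarrow> (\<Inter>j\<in>{..<p}. X0 \<inter> {x\<in>X0. V x \<inter> ball (ds ! j) (\<rho> k) \<noteq> {}}) \<in> sets M"
      by (intro sets.finite_INT) auto
    then show ?thesis using b by (cases "{..<p} = {}") (auto simp: S_def dk)
  qed
  have "{x\<in>X0. \<exists>us. length us = p \<and> set us \<subseteq> V x \<and> Q x us} = (\<Union>i\<in>I. S i)"
  proof (intro equalityI subsetI)
    fix x assume "x \<in> {x\<in>X0. \<exists>us. length us = p \<and> set us \<subseteq> V x \<and> Q x us}"
    then obtain us where x: "x \<in> X0" and us: "length us = p" "set us \<subseteq> V x" "Q x us" by auto
    obtain \<eta> where \<eta>: "\<eta> > 0" "\<And>x' us'. dist x x' < \<eta> \<Longrightarrow> list_all2 (\<lambda>u u'. dist u u' < \<eta>) us us' \<Longrightarrow> Q x' us'"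
      using Q[OF us(1,3)] by blast
    obtain k :: nat where "2 / \<eta> < real k" using reals_Archimedean2 by blast
    \<comment> \<open>One radius is spent on moving to the dense centres and one on moving within
      the balls around them.\<close>
    then have k: "2 * \<rho> k < \<eta>" using \<eta>(1) by (simp add: \<rho>_def field_simps)
    obtain d where d: "d \<in> DX" "dist d x < \<rho> k" using DX \<rho> unfolding countable_dense_def by blast
    have "\<forall>u. \<exists>c\<in>DB. dist c u < \<rho> k" using DB \<rho> unfolding countable_dense_def by blast
    then obtain c where c: "\<And>u. c u \<in> DB" "\<And>u. dist (c u) u < \<rho> k" by metis
    define ds where "ds = map c us"
    have "Q x' us'" if x': "dist d x' < \<rho> k" and us': "list_all2 (\<lambda>u u'. dist u u' < \<rho> k) ds us'" for x' us'
    proof (rule \<eta>(2))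
      show "dist x x' < \<eta>" using dist_triangle[of x x' d] d(2) x' k by (simp add: dist_commute)
      show "list_all2 (\<lambda>u u'. dist u u' < \<eta>) us us'"
        unfolding list_all2_conv_all_nth
      proof (intro conjI allI impI)
        show "length us = length us'" using us' by (simp add: ds_def list_all2_conv_all_nth)
        fix i assume i: "i < length us"
        have "dist (c (us ! i)) (us' ! i) < \<rho> k" using us' i by (simp add: ds_def list_all2_conv_all_nth)
        then show "dist (us ! i) (us' ! i) < \<eta>"
          using c(2)[of "us ! i"] dist_triangle[of "us ! i" "us' ! i" "c (us ! i)"] k by (simp add: dist_commute)
      qed
    qed
    then have "(d, ds, k) \<in> I" using d c us by (auto simp: I_def ds_def)
    moreover have "x \<in> S (d, ds, k)"
    proof -
      have "us ! j \<in> V x \<inter> ball (ds ! j) (\<rho> k)" if "j < p" for j using that us c by (auto simp: ds_def)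
      then show ?thesis using x d(2) by (fastforce simp: S_def)
    qed
    ultimately show "x \<in> (\<Union>i\<in>I. S i)" by blast
  next
    fix x assume "x \<in> (\<Union>i\<in>I. S i)"
    then obtain d ds k where i: "(d, ds, k) \<in> I" "x \<in> S (d, ds, k)" by auto
    have "x \<in> (\<Inter>j\<in>{..<p}. X0 \<inter> {x\<in>X0. V x \<inter> ball (ds ! j) (\<rho> k) \<noteq> {}})"
      using i(2) by (simp only: S_def prod.case Int_iff)
    then have "x \<in> {x\<in>X0. V x \<inter> ball (ds ! j) (\<rho> k) \<noteq> {}}" if "j < p" for j using that by blast
    then have "\<forall>j. \<exists>u. j < p \<longrightarrow> u \<in> V x \<and> dist (ds ! j) u < \<rho> k" by fastforce
    then obtain u where u: "\<And>j. j < p \<Longrightarrow> u j \<in> V x \<and> dist (ds ! j) (u j) < \<rho> k" by metis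
    define us where "us = map u [0..<p]"
    have "list_all2 (\<lambda>u u'. dist u u' < \<rho> k) ds us" using u i(1) by (auto simp: us_def list_all2_conv_all_nth I_def)
    then have "Q x us" using i by (auto simp: I_def S_def)
    moreover have "length us = p" "set us \<subseteq> V x" using u by (auto simp: us_def)
    ultimately show "x \<in> {x\<in>X0. \<exists>us. length us = p \<and> set us \<subseteq> V x \<and> Q x us}" using i(2) by (auto simp: S_def)
  qed
  also have "\<dots> \<in> sets M" using cI S by (intro sets.countable_UN') auto
  finally show ?thesis .
qed

lemma prod_list_norm_upper_semicontinuous:
  fixes us :: "'b::real_normed_vector list"
  assumes "e > 0"
  shows "\<exists>\<eta>>0. \<forall>us'. list_all2 (\<lambda>u u'. dist u u' < \<eta>) us us' \<longrightarrow>
           prod_list (map norm us') < prod_list (map norm us) + e"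
  using assms
proof (induction us arbitrary: e)
  case Nil
  then show ?case by (intro exI[of _ 1]) auto
next
  case (Cons u us)
  define P where "P = prod_list (map norm us)"
  have P: "P \<ge> 0" by (simp add: P_def prod_list_norm_nonneg)
  define h where "h = min 1 (e / (2 * (norm u + P + 1)))"
  have pos: "norm u + P + 1 > 0" using P by (simp add: add_nonneg_pos)
  have h: "h > 0" "h \<le> 1" using pos Cons.prems by (auto simp: h_def)
  have "h \<le> e / (2 * (norm u + P + 1))" by (simp add: h_def)
  then have he: "h * (norm u + P + 1) \<le> e / 2" using pos by (simp add: field_simps)
  obtain \<eta> where \<eta>: "\<eta> > 0" "\<And>us'. list_all2 (\<lambda>u u'. dist u u' < \<eta>) us us' \<Longrightarrow> prod_list (map norm us') < P + h"
    using Cons.IH[OF h(1)] unfolding P_def by blast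
  have "prod_list (map norm ws) < prod_list (map norm (u # us)) + e"
    if ws: "list_all2 (\<lambda>u u'. dist u u' < min \<eta> h) (u # us) ws" for ws
  proof -
    obtain u' us' where ws': "ws = u' # us'" "dist u u' < min \<eta> h" "list_all2 (\<lambda>u u'. dist u u' < min \<eta> h) us us'"
      using ws by (auto simp: list_all2_Cons1)
    have "prod_list (map norm us') < P + h" by (rule \<eta>(2)[OF list_all2_dist_mono[OF ws'(3)]]) simp
    moreover have "norm u' \<le> norm u + h"
      using ws'(2) norm_triangle_sub[of u' u] by (simp add: dist_norm norm_minus_commute)
    ultimately have "norm u' * prod_list (map norm us') \<le> (norm u + h) * (P + h)"
      using h P by (intro mult_mono) (auto simp: prod_list_norm_nonneg)
    also have "\<dots> = norm u * P + h * (norm u + P + h)" by (simp add: algebra_simps)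
    also have "\<dots> \<le> norm u * P + h * (norm u + P + 1)" using h by (intro add_left_mono mult_left_mono) auto
    also have "\<dots> < norm u * P + e" using he Cons.prems by linarith
    finally show ?thesis by (simp add: ws'(1) P_def)
  qed
  then show ?case using \<eta>(1) h(1) by (intro exI[of _ "min \<eta> h"]) auto
qed

text \<open>Failure of the bound asks for one tuple in \<open>V x\<close> with a strict inequality
  between an upper and a lower semicontinuous function of \<open>x\<close> and the tuple, which is
  an open condition.\<close>

lemma volume_bound_cocycle_sets:
  fixes M :: "'a::metric_space measure" and V :: "'a \<Rightarrow> 'b::real_normed_vector set"
  assumes "sets M = sets borel" "X0 \<in> sets M" "countable_dense (DX :: 'a set)" "countable_dense (DB :: 'b set)"
    and V: "\<And>U. open U \<Longrightarrow> {x\<in>X0. V x \<inter> U \<noteq> {}} \<in> sets M"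
    and T: "continuous_on UNIV T" and "0 \<le> r"
  shows "{x\<in>X0. volume_bound p (T x) (V x) r} \<in> sets M"
proof -
  define Q where "Q x us \<longleftrightarrow> r * prod_list (map norm us) < pvol (map (blinfun_apply (T x)) us)" for x us
  have "\<exists>\<eta>>0. \<forall>x' us'. dist x x' < \<eta> \<longrightarrow> list_all2 (\<lambda>u u'. dist u u' < \<eta>) us us' \<longrightarrow> Q x' us'" if "Q x us" for x us
  proof -
    define P where "P = prod_list (map norm us)"
    have P: "P \<ge> 0" by (simp add: P_def prod_list_norm_nonneg)
    obtain c where c: "r * P < c" "c < pvol (map (T x) us)" using \<open>Q x us\<close> dense unfolding Q_def P_def by blast
    have "c \<ge> 0" using c(1) P assms(7) by (meson less_eq_real_def mult_nonneg_nonneg order_trans)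
    obtain \<eta>1 where \<eta>1: "\<eta>1 > 0" "\<And>vs'. list_all2 (\<lambda>v v'. dist v v' < \<eta>1) (map (T x) us) vs' \<Longrightarrow> c < pvol vs'"
      using pvol_lower_semicontinuous[OF c(2) \<open>c \<ge> 0\<close>] by blast
    define e where "e = (c - r * P) / (r + 1)"
    have e: "e > 0" using c assms(7) by (simp add: e_def)
    have "r * e \<le> (r + 1) * e" using e by simp
    also have "\<dots> = c - r * P" using assms(7) by (simp add: e_def)
    finally have re: "r * (P + e) \<le> c" by (simp add: distrib_left)
    obtain \<eta>2 where \<eta>2: "\<eta>2 > 0" "\<And>us'. list_all2 (\<lambda>u u'. dist u u' < \<eta>2) us us' \<Longrightarrow> prod_list (map norm us') < P + e"
      using prod_list_norm_upper_semicontinuous[OF e] unfolding P_def by blast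
    define R where "R = sum_list (map norm us) + 1"
    have R: "norm u + 1 \<le> R" if "u \<in> set us" for u
    proof -
      have nn: "0 \<le> sum_list (map norm ws)" for ws :: "'b list" by (induction ws) auto
      have "norm u \<le> sum_list (map norm us)"
        using that nn by (induction us) (auto intro: add_increasing add_increasing2)
      then show ?thesis by (simp add: R_def)
    qed
    have R0: "R > 0" unfolding R_def by (intro add_nonneg_pos sum_list_nonneg) auto
    obtain \<eta>3 where \<eta>3: "\<eta>3 > 0" "\<And>x'. dist x' x < \<eta>3 \<Longrightarrow> dist (T x') (T x) < \<eta>1 / (2 * R)"
    proof -
      have "\<eta>1 / (2 * R) > 0" using \<eta>1(1) R0 by simp
      then show ?thesis using T that unfolding continuous_on_iff by blast
    qed
    define \<eta> where "\<eta> = Min {1, \<eta>2, \<eta>3, \<eta>1 / (2 * (norm (T x) + 1))}"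
    have nT: "norm (T x) + 1 > 0" by (simp add: add_nonneg_pos)
    have "\<eta>1 / (2 * (norm (T x) + 1)) > 0" using \<eta>1(1) nT by simp
    then have \<eta>: "\<eta> > 0" "\<eta> \<le> 1" "\<eta> \<le> \<eta>2" "\<eta> \<le> \<eta>3" "\<eta> \<le> \<eta>1 / (2 * (norm (T x) + 1))"
      using \<eta>2 \<eta>3 by (auto simp: \<eta>_def)
    have "Q x' us'" if x': "dist x x' < \<eta>" and us': "list_all2 (\<lambda>u u'. dist u u' < \<eta>) us us'" for x' us'
    proof -
      have "dist (T x u) (T x' u') < \<eta>1" if "u \<in> set us" "dist u u' < \<eta>" for u u'
      proof -
        have "dist x' x < \<eta>3" using x' \<eta>(4) by (simp add: dist_commute)
        then have Tx: "norm (T x - T x') < \<eta>1 / (2 * R)" using \<eta>3(2)[of x'] by (simp add: dist_norm norm_minus_commute)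
        have "norm u' \<le> R" using R[OF that(1)] that(2) \<eta>(2) norm_triangle_sub[of u' u] by (simp add: dist_norm norm_minus_commute)
        have "T x u - T x' u' = T x (u - u') + (T x - T x') u'" by (simp add: blinfun.diff_left blinfun.diff_right)
        then have "norm (T x u - T x' u') \<le> norm (T x (u - u')) + norm ((T x - T x') u')" by (metis norm_triangle_ineq)
        also have "norm ((T x - T x') u') \<le> norm (T x - T x') * norm u'" by (rule norm_blinfun)
        also have "\<dots> \<le> \<eta>1 / (2 * R) * R" using Tx \<open>norm u' \<le> R\<close> R0 \<eta>1(1) by (intro mult_mono) auto
        also have "\<dots> = \<eta>1 / 2" using R0 by simp
        also have "norm (T x (u - u')) \<le> norm (T x) * norm (u - u')" by (rule norm_blinfun)
        also have "\<dots> \<le> norm (T x) * (\<eta>1 / (2 * (norm (T x) + 1)))"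
          using that(2) \<eta>(5) by (intro mult_left_mono) (auto simp: dist_norm)
        also have "\<dots> < (norm (T x) + 1) * (\<eta>1 / (2 * (norm (T x) + 1)))"
          using \<eta>1(1) nT by (intro mult_strict_right_mono) auto
        also have "\<dots> = \<eta>1 / 2"
        proof -
          have "c * (\<eta>1 / (2 * c)) = \<eta>1 / 2" if "c > 0" for c :: real using that by simp
          then show ?thesis using nT by blast
        qed
        finally show ?thesis by (simp add: dist_norm)
      qed
      then have "list_all2 (\<lambda>v v'. dist v v' < \<eta>1) (map (T x) us) (map (T x') us')"
        using us' by (simp add: list_all2_conv_all_nth)
      then have "c < pvol (map (T x') us')" by (rule \<eta>1(2))
      moreover have "prod_list (map norm us') < P + e" by (rule \<eta>2(2)[OF list_all2_dist_mono[OF us' \<eta>(3)]])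
      then have "r * prod_list (map norm us') \<le> r * (P + e)" using assms(7) by (intro mult_left_mono) auto
      ultimately show ?thesis unfolding Q_def using re by linarith
    qed
    then show ?thesis using \<eta>(1) by blast
  qed
  then have "{x\<in>X0. \<exists>us. length us = p \<and> set us \<subseteq> V x \<and> Q x us} \<in> sets M"
    using assms(1-5) by (intro effros_exists_list_sets) auto
  moreover have "{x\<in>X0. volume_bound p (T x) (V x) r} = X0 - {x\<in>X0. \<exists>us. length us = p \<and> set us \<subseteq> V x \<and> Q x us}"
    by (auto simp: volume_bound_def Q_def not_less)
  ultimately show ?thesis using assms(2) by auto
qed

section \<open>Inner regularity of finite Borel measures\<close>

text \<open>Induction over the sigma-algebra generated by the closed sets. For a countable union the
  errors of the parts sum to at most \<open>e / 2\<close>, and finitely many of the closed sets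
  suffice by continuity from above.\<close>

lemma borel_closed_open_approx:
  fixes M :: "'a::metric_space measure"
  assumes M: "sets M = sets borel" "finite_measure M" and "B \<in> sets M" "e > 0"
  shows "\<exists>K U. closed K \<and> open U \<and> K \<subseteq> B \<and> B \<subseteq> U \<and> measure M (U - K) < e"
proof -
  interpret finite_measure M by fact
  have cl: "closed K \<Longrightarrow> K \<in> sets M" and op: "open K \<Longrightarrow> K \<in> sets M" for K using M(1) by auto
  have "B \<in> sigma_sets UNIV (Collect closed)"
    using assms(1,3) by (simp add: borel_eq_closed sets_measure_of)
  then show ?thesis using \<open>e > 0\<close>
  proof (induction B arbitrary: e rule: sigma_sets.induct)
    case (Basic B)
    then have B: "closed B" by simp
    show ?case
    proof (cases "B = {}")
      case True
      then show ?thesis using Basic.prems by (intro exI[of _ "{}"]) auto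
    next
      case False
      define U where "U n = {x. infdist x B < 1 / (real n + 1)}" for n :: nat
      have U: "open (U n)" for n unfolding U_def by (intro open_Collect_less continuous_intros)
      have sub: "B \<subseteq> U n" for n unfolding U_def by auto
      have dec: "decseq (\<lambda>n. U n - B)"
      proof (intro decseq_SucI Diff_mono subsetI)
        fix n x assume "x \<in> U (Suc n)"
        moreover have "1 / (real (Suc n) + 1) \<le> 1 / (real n + 1)" by (simp add: frac_le)
        ultimately show "x \<in> U n" unfolding U_def by simp
      qed simp
      have ex: "\<exists>n. x \<notin> U n - B" for x
      proof (cases "x \<in> B")
        case nB: False
        then have "infdist x B > 0" using infdist_pos_not_in_closed[OF B False] by simp
        moreover obtain n :: nat where "1 / infdist x B < real n" using reals_Archimedean2 by blast
        ultimately have "1 / (real n + 1) \<le> infdist x B" by (simp add: field_simps)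
        then show ?thesis unfolding U_def by (intro exI[of _ n]) auto
      qed auto
      have "U n - B \<in> sets M" for n using op[OF U] cl[OF B] by (rule sets.Diff)
      from measure_decreasing_small[OF M(2) this dec _ Basic.prems]
      obtain n where "measure M (U n - B) < e" using ex by auto
      then show ?thesis using U[of n] sub[of n] B by (intro exI[of _ B] exI[of _ "U n"]) auto
    qed
  next
    case Empty
    then show ?case by (intro exI[of _ "{}"]) auto
  next
    case (Compl B)
    obtain K U where KU: "closed K" "open U" "K \<subseteq> B" "B \<subseteq> U" "measure M (U - K) < e"
      using Compl.IH[OF Compl.prems] by blast
    have "- K - (- U) = U - K" by auto
    then have "measure M (- K - (- U)) < e" using KU(5) by (simp only:)
    moreover have "closed (- U)" "open (- K)" using KU by (simp_all only: closed_Compl open_Compl)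
    moreover have "- U \<subseteq> UNIV - B" "UNIV - B \<subseteq> - K" using KU by blast+
    ultimately show ?case by blast
  next
    case (Union B)
    define g where "g i = (e / 4) * (1 / 2) ^ i" for i :: nat
    have g: "g i > 0" for i using Union.prems by (simp add: g_def)
    have "\<forall>i. \<exists>K U. closed K \<and> open U \<and> K \<subseteq> B i \<and> B i \<subseteq> U \<and> measure M (U - K) < g i"
      using Union.IH g by blast
    then obtain K U where KU: "\<And>i. closed (K i)" "\<And>i. open (U i)" "\<And>i. K i \<subseteq> B i" "\<And>i. B i \<subseteq> U i" "\<And>i. measure M (U i - K i) < g i"
      by metis
    define D where "D n = (\<Union>i. K i) - (\<Union>i<n. K i)" for n :: nat
    have D: "D n \<in> sets M" for n
      unfolding D_def using KU(1) cl by (intro sets.Diff sets.countable_UN sets.finite_UN) auto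
    have "decseq D" by (auto simp: decseq_def D_def)
    moreover have "\<exists>n. x \<notin> D n" for x
    proof (cases "x \<in> (\<Union>i. K i)")
      case True
      then obtain i where "x \<in> K i" by blast
      then have "x \<notin> D (Suc i)" by (auto simp: D_def)
      then show ?thesis by blast
    qed (auto simp: D_def)
    ultimately obtain n where n: "measure M (D n) < e / 2"
      using measure_decreasing_small[where B = D and e = "e / 2", OF M(2) D] Union.prems by auto
    have sg: "g sums (e / 4 * (1 / (1 - 1 / 2)))" unfolding g_def by (intro sums_mult geometric_sums) simp
    have summ: "summable (\<lambda>i. measure M (U i - K i))"
      by (rule summable_comparison_test'[OF sums_summable[OF sg], of 0]) (use KU(5) in \<open>auto intro: less_imp_le\<close>)
    have "measure M (\<Union>i. U i - K i) \<le> (\<Sum>i. measure M (U i - K i))"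
      using KU cl op summ by (intro finite_measure_subadditive_countably) auto
    also have "\<dots> \<le> suminf g" using KU(5) summ sums_summable[OF sg] by (intro suminf_le) (auto intro: less_imp_le)
    also have "\<dots> = e / 2" using sg by (simp add: sums_iff)
    finally have m1: "measure M (\<Union>i. U i - K i) \<le> e / 2" .
    have "measure M ((\<Union>i. U i) - (\<Union>i<n. K i)) \<le> measure M ((\<Union>i. U i - K i) \<union> D n)"
      using KU cl op D by (intro finite_measure_mono sets.Un sets.countable_UN) (auto simp: D_def)
    also have "\<dots> \<le> measure M (\<Union>i. U i - K i) + measure M (D n)"
      using KU cl op D by (intro measure_Un_le sets.countable_UN) auto
    also have "\<dots> < e" using m1 n by linarith
    finally have "measure M ((\<Union>i. U i) - (\<Union>i<n. K i)) < e" .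
    moreover have "closed (\<Union>i<n. K i)" "open (\<Union>i. U i)" using KU by auto
    moreover have "(\<Union>i<n. K i) \<subseteq> (\<Union>i. B i)" "(\<Union>i. B i) \<subseteq> (\<Union>i. U i)" using KU(3,4) by blast+
    ultimately show ?case by blast
  qed
qed

lemma compact_inner_approx:
  fixes M :: "'a::metric_space measure"
  assumes "compact (UNIV :: 'a set)" "sets M = sets borel" "finite_measure M" "B \<in> sets M" "c < measure M B"
  obtains K where "compact K" "K \<subseteq> B" "c < measure M K"
proof -
  interpret finite_measure M by fact
  obtain K U where KU: "closed K" "open U" "K \<subseteq> B" "B \<subseteq> U" "measure M (U - K) < measure M B - c"
    using borel_closed_open_approx[OF assms(2-4), of "measure M B - c"] assms(5) by auto
  have sets: "K \<in> sets M" "U \<in> sets M" using KU(1,2) assms(2) by auto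
  have "measure M B \<le> measure M (K \<union> (U - K))"
    using KU sets by (intro finite_measure_mono) auto
  also have "\<dots> \<le> measure M K + measure M (U - K)" using sets by (intro measure_Un_le) auto
  finally have "c < measure M K" using KU(5) by linarith
  moreover have "compact K" using compact_Int_closed[OF assms(1) KU(1)] by simp
  ultimately show ?thesis using that KU(3) by blast
qed

subsection \<open>Uniform splitting at one exponent\<close>

lemma elog_limitD:
  assumes "(\<lambda>n. elog (a n) / ereal (real n)) \<longlonglongrightarrow> ereal l" "\<delta> > 0"
  shows "\<forall>\<^sub>F n in sequentially. a n \<le> exp (real n * (l + \<delta>))"
    "\<forall>\<^sub>F n in sequentially. exp (real n * (l - \<delta>)) \<le> a n"
proof -
  have "\<forall>\<^sub>F n in sequentially. elog (a n) / ereal (real n) < ereal (l + \<delta>)"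
    using order_tendstoD(2)[OF assms(1)] assms(2) by simp
  then show "\<forall>\<^sub>F n in sequentially. a n \<le> exp (real n * (l + \<delta>))" using eventually_gt_at_top[of 0]
  proof eventually_elim
    case (elim n)
    show ?case
    proof (cases "a n \<le> 0")
      case True
      then show ?thesis using exp_ge_zero[of "real n * (l + \<delta>)"] by linarith
    next
      case False
      then have "ln (a n) / real n < l + \<delta>" using elim by (simp add: elog_def)
      then have "ln (a n) < real n * (l + \<delta>)" using elim(2) by (simp add: field_simps)
      then show ?thesis using False by (metis exp_le_cancel_iff exp_ln less_imp_le not_le)
    qed
  qed
  have "\<forall>\<^sub>F n in sequentially. ereal (l - \<delta>) < elog (a n) / ereal (real n)"
    using order_tendstoD(1)[OF assms(1)] assms(2) by simp
  then show "\<forall>\<^sub>F n in sequentially. exp (real n * (l - \<delta>)) \<le> a n" using eventually_gt_at_top[of 0]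
  proof eventually_elim
    case (elim n)
    have pos: "a n > 0"
    proof (rule ccontr)
      assume "\<not> a n > 0"
      then have "elog (a n) / ereal (real n) = - \<infinity>" using elim(2) by (simp add: elog_def)
      then show False using elim(1) by simp
    qed
    then have "l - \<delta> < ln (a n) / real n" using elim by (simp add: elog_def)
    then have "real n * (l - \<delta>) < ln (a n)" using elim(2) by (simp add: field_simps)
    then show ?case using pos by (metis exp_le_cancel_iff exp_ln less_imp_le)
  qed
qed

lemma elog_limsupD:
  assumes "limsup (\<lambda>n. elog (a n) / ereal (real n)) \<le> l" "l < ereal \<kappa>"
  shows "\<forall>\<^sub>F n in sequentially. a n \<le> exp (real n * \<kappa>)"
proof -
  have "limsup (\<lambda>n. elog (a n) / ereal (real n)) < ereal \<kappa>" using assms by (rule le_less_trans)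
  then have "\<forall>\<^sub>F n in sequentially. elog (a n) / ereal (real n) < ereal \<kappa>" by (rule Limsup_lessD)
  then show ?thesis using eventually_gt_at_top[of 0]
  proof eventually_elim
    case (elim n)
    show ?case
    proof (cases "a n \<le> 0")
      case True
      then show ?thesis using exp_ge_zero[of "real n * \<kappa>"] by linarith
    next
      case False
      then have "ln (a n) / real n < \<kappa>" using elim by (simp add: elog_def)
      then have "ln (a n) < real n * \<kappa>" using elim(2) by (simp add: field_simps)
      then show ?thesis using False by (metis exp_le_cancel_iff exp_ln less_imp_le not_le)
    qed
  qed
qed

lemma norm_restrict_apply_le:
  assumes "subspace W" "u \<in> W"
  shows "norm (blinfun_apply T u) \<le> norm_restrict T W * norm u"
proof (cases "u = 0")
  case False
  define v where "v = u /\<^sub>R norm u"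
  have v: "v \<in> {u\<in>W. norm u \<le> 1}" using assms False by (simp add: v_def subspace_scale)
  have "bdd_above ((\<lambda>u. norm (T u)) ` {u\<in>W. norm u \<le> 1})"
  proof (rule bdd_aboveI2)
    fix w assume "w \<in> {u\<in>W. norm u \<le> 1}"
    then have "norm T * norm w \<le> norm T * 1" by (intro mult_left_mono) auto
    then show "norm (T w) \<le> norm T" using norm_blinfun[of T w] by simp
  qed
  then have "norm (T v) \<le> norm_restrict T W" unfolding norm_restrict_def by (rule cSUP_upper[OF v])
  then show ?thesis using False by (simp add: v_def blinfun.scaleR_right field_simps)
qed simp

section \<open>Codimension in terms of lists independent modulo a subspace\<close>

lemma indep_mod_append:
  assumes "subspace W" "Z \<subseteq> W" "set us \<subseteq> W" "indep_mod Z us" "indep_mod W bs"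
  shows "indep_mod Z (bs @ us)"
  using assms(5)
proof (induction bs)
  case (Cons v bs)
  have "Z \<union> set (bs @ us) \<subseteq> W \<union> set bs" using assms by auto
  then have "span (Z \<union> set (bs @ us)) \<subseteq> span (W \<union> set bs)" by (rule span_mono)
  then show ?case using Cons by auto
qed (use assms in simp)

lemma has_codimension_list:
  assumes "has_codimension W m" "subspace W"
  obtains bs where "length bs = m" "indep_mod W bs" "span (W \<union> set bs) = UNIV"
proof -
  obtain B where B: "finite B" "card B = m" "independent B" "span B \<inter> W = {0}" "span (W \<union> B) = UNIV"
    using assms(1) unfolding has_codimension_def by blast
  obtain bs where bs: "set bs = B" "distinct bs" using B(1) finite_distinct_list by blast
  have "indep_mod W cs" if "distinct cs" "set cs \<subseteq> B" for cs
    using that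
  proof (induction cs)
    case (Cons v cs)
    have "v \<notin> span (W \<union> set cs)"
    proof
      assume "v \<in> span (W \<union> set cs)"
      then obtain w s where ws: "w \<in> W" "s \<in> span (set cs)" "v = w + s" using span_Un_decompose[OF assms(2)] by blast
      have "s \<in> span B" using ws(2) Cons.prems span_mono[of "set cs" B] by auto
      then have "v - s \<in> span B" using Cons.prems by (intro span_diff) (auto intro: span_base)
      then have "w = 0" using ws B(4) by auto
      then have "v \<in> span (B - {v})"
        using ws Cons.prems span_mono[of "set cs" "B - {v}"] by auto
      then show False using B(3) Cons.prems by (auto simp: dependent_def)
    qed
    then show ?case using Cons by simp
  qed simp
  then show ?thesis using that[of bs] bs B distinct_card[of bs] by auto
qed

lemma indep_mod_max_spans:
  assumes "\<And>us. set us \<subseteq> W \<Longrightarrow> indep_mod Z us \<Longrightarrow> length us \<le> m"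
    and "length us = m" "set us \<subseteq> W" "indep_mod Z us"
  shows "W \<subseteq> span (Z \<union> set us)"
proof
  fix v assume v: "v \<in> W"
  show "v \<in> span (Z \<union> set us)"
  proof (rule ccontr)
    assume "v \<notin> span (Z \<union> set us)"
    then have "length (v # us) \<le> m" using assms v by (intro assms(1)) auto
    then show False using assms(2) by simp
  qed
qed

text \<open>A longest list \<open>us\<close> in \<open>W\<close> independent modulo
  \<open>Z\<close>, followed by a complement \<open>bs\<close> of \<open>W\<close>, is independent
  modulo \<open>Z\<close> and spans everything together with \<open>Z\<close>. Comparison with a
  complement of \<open>Z\<close> in both directions gives
  \<open>length us + m0 = m1\<close>.\<close>

lemma relative_codimension:
  assumes "has_codimension W m0" "has_codimension Z m1" "subspace W" "subspace Z" "Z \<subseteq> W"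
  shows "\<exists>us. length us = m1 - m0 \<and> set us \<subseteq> W \<and> indep_mod Z us"
    "set us \<subseteq> W \<Longrightarrow> indep_mod Z us \<Longrightarrow> length us \<le> m1 - m0"
proof -
  obtain bs where bs: "length bs = m0" "indep_mod W bs" "span (W \<union> set bs) = UNIV"
    using has_codimension_list[OF assms(1,3)] by blast
  obtain cs where cs: "length cs = m1" "indep_mod Z cs" "span (Z \<union> set cs) = UNIV"
    using has_codimension_list[OF assms(2,4)] by blast
  have bound: "m0 + length us \<le> m1" if "set us \<subseteq> W" "indep_mod Z us" for us
  proof -
    have "length (bs @ us) \<le> card (set cs)"
      using cs(3) indep_mod_append[OF assms(3,5) that bs(2)] by (intro indep_mod_length_le[OF assms(4)]) auto
    also have "\<dots> \<le> m1" using card_length[of cs] cs(1) by simp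
    finally show ?thesis using bs(1) by simp
  qed
  then show "set us \<subseteq> W \<Longrightarrow> indep_mod Z us \<Longrightarrow> length us \<le> m1 - m0" by fastforce
  define L where "L = {l. \<exists>us. length us = l \<and> set us \<subseteq> W \<and> indep_mod Z us}"
  have "L \<subseteq> {..m1}" using bound by (fastforce simp: L_def)
  then have "finite L" by (rule finite_subset) simp
  moreover have "0 \<in> L" by (auto simp: L_def)
  ultimately have "Max L \<in> L" by (intro Max_in) auto
  then obtain us where us: "length us = Max L" "set us \<subseteq> W" "indep_mod Z us" by (auto simp: L_def)
  have "length vs \<le> Max L" if "set vs \<subseteq> W" "indep_mod Z vs" for vs
    using \<open>finite L\<close> that by (intro Max_ge) (auto simp: L_def)
  then have W: "W \<subseteq> span (Z \<union> set us)" using us by (intro indep_mod_max_spans) auto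
  have "UNIV \<subseteq> span (Z \<union> (set us \<union> set bs))"
  proof -
    have "W \<union> set bs \<subseteq> span (Z \<union> (set us \<union> set bs))"
      using W span_mono[of "Z \<union> set us" "Z \<union> (set us \<union> set bs)"] by (auto intro: span_base)
    then have "span (W \<union> set bs) \<subseteq> span (Z \<union> (set us \<union> set bs))" by (intro span_minimal) auto
    then show ?thesis using bs(3) by simp
  qed
  then have "length cs \<le> card (set us \<union> set bs)"
    using cs(2) by (intro indep_mod_length_le[OF assms(4)]) auto
  also have "\<dots> \<le> length us + length bs" using card_Un_le[of "set us" "set bs"] card_length[of us] card_length[of bs] by linarith
  finally have "length us = m1 - m0" using bound[OF us(2,3)] cs(1) bs(1) by linarith
  then show "\<exists>us. length us = m1 - m0 \<and> set us \<subseteq> W \<and> indep_mod Z us" using us by blast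
qed

lemma indep_mod_of_disjoint_span:
  assumes "subspace Z" "\<And>e. e \<in> span (set us) \<Longrightarrow> e \<in> Z \<Longrightarrow> e = 0"
    and "pvol (map (blinfun_apply T) us) \<noteq> 0"
  shows "indep_mod Z us"
  using assms(2,3)
proof (induction us)
  case (Cons v us)
  have sub: "span (set us) \<subseteq> span (set (v # us))" by (intro span_mono) auto
  have "v \<notin> span (Z \<union> set us)"
  proof
    assume "v \<in> span (Z \<union> set us)"
    then obtain z s where zs: "z \<in> Z" "s \<in> span (set us)" "v = z + s" using span_Un_decompose[OF assms(1)] by blast
    have "z \<in> span (set (v # us))" using zs sub span_diff[of v "set (v # us)" s] by (auto intro: span_base)
    then have "z = 0" using Cons.prems(1) zs(1) by blast
    then have "T v \<in> span (T ` set us)" using zs by (simp add: span_blinfun_image)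
    then show False using Cons.prems(2) by simp
  qed
  moreover have "indep_mod Z us" using Cons sub by auto
  ultimately show ?case by simp
qed simp

text \<open>One step of the filtration: \<open>W\<close> and \<open>Z\<close> stand for
  \<open>V j\<close> and \<open>V (j + 1)\<close>, and \<open>m\<close> is the codimension of
  \<open>Z\<close> in \<open>W\<close>. The real rate \<open>chi\<close> is to be taken above the
  next exponent, so that an exponent - \<infinity> is treated like any other.\<close>

locale exponent_gap =
  fixes M :: "'a::metric_space measure" and f :: "'a \<Rightarrow> 'a" and A :: "'a \<Rightarrow> ('b::banach \<Rightarrow>\<^sub>L 'b)"
    and X0 :: "'a set" and W Z :: "'a \<Rightarrow> 'b set" and lam chi C :: real and m :: nat
  assumes ergodic: "ergodic_invariant_measure M f"
    and X0: "X0 \<in> sets M" "measure M X0 = 1" "f ` X0 \<subseteq> X0"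
    and A_bound: "\<And>x. norm (A x) \<le> exp C"
    and W: "\<And>x. x \<in> X0 \<Longrightarrow> subspace (W x)" "\<And>x. x \<in> X0 \<Longrightarrow> closed (W x)"
    and Z: "\<And>x. x \<in> X0 \<Longrightarrow> subspace (Z x)" "\<And>x. x \<in> X0 \<Longrightarrow> closed (Z x)"
    and Z_sub_W: "\<And>x. x \<in> X0 \<Longrightarrow> Z x \<subseteq> W x"
    and W_invariant: "\<And>x. x \<in> X0 \<Longrightarrow> blinfun_apply (A x) ` W x \<subseteq> W (f x)"
    and W_sets: "\<And>p n r. 0 \<le> r \<Longrightarrow> {x\<in>X0. volume_bound p (cocycle f A x n) (W x) r} \<in> sets M"
    and Z_sets: "\<And>p n r. 0 \<le> r \<Longrightarrow> {x\<in>X0. volume_bound p (cocycle f A x n) (Z x) r} \<in> sets M"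
    and exact: "\<And>x u. x \<in> X0 \<Longrightarrow> u \<in> W x - Z x \<Longrightarrow>
       (\<lambda>n. elog (norm (cocycle f A x n u)) / ereal (real n)) \<longlonglongrightarrow> ereal lam"
    and slow: "\<And>x. x \<in> X0 \<Longrightarrow> \<forall>\<^sub>F n in sequentially. \<forall>v\<in>Z x. norm (cocycle f A x n v) \<le> exp (real n * chi) * norm v"
    and gap: "chi < lam"
    and m_attained: "\<And>x. x \<in> X0 \<Longrightarrow> \<exists>us. length us = m \<and> set us \<subseteq> W x \<and> indep_mod (Z x) us"
    and m_max: "\<And>x us. x \<in> X0 \<Longrightarrow> set us \<subseteq> W x \<Longrightarrow> indep_mod (Z x) us \<Longrightarrow> length us \<le> m"
begin

lemma AE_X0: "AE x in M. x \<in> X0"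
  using ergodic_AE_iff[OF ergodic X0(1)] X0(2) by simp

text \<open>\<open>exact\<close> speaks of single vectors only; uniformity holds because
  \<open>W x\<close> is contained in the span of the uniformly slow \<open>Z x\<close> and finitely
  many vectors.\<close>

lemma upper:
  assumes x: "x \<in> X0" and "\<delta> > 0"
  shows "\<forall>\<^sub>F n in sequentially. \<forall>w\<in>W x. norm (cocycle f A x n w) \<le> exp (real n * (lam + \<delta>)) * norm w"
proof (rule growth_bounded_eventually)
  obtain us where us: "length us = m" "set us \<subseteq> W x" "indep_mod (Z x) us" using m_attained[OF x] by blast
  have WZ: "W x \<subseteq> span (Z x \<union> set us)" using m_max[OF x] us by (intro indep_mod_max_spans) auto
  define \<mu> where "\<mu> = lam + \<delta> / 2"
  have Zg: "growth_bounded (cocycle f A x) (Z x) \<mu>"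
  proof -
    obtain N where N: "\<And>n v. n \<ge> N \<Longrightarrow> v \<in> Z x \<Longrightarrow> norm (cocycle f A x n v) \<le> exp (real n * chi) * norm v"
      using slow[OF x] by (auto simp: eventually_sequentially)
    have "norm (cocycle f A x n v) \<le> 1 * exp (real n * \<mu>) * norm v" if "n \<ge> N" "v \<in> Z x" for n v
    proof -
      have "exp (real n * chi) * norm v \<le> exp (real n * \<mu>) * norm v"
        using gap \<open>\<delta> > 0\<close> by (intro mult_right_mono) (auto simp: \<mu>_def intro: mult_left_mono)
      then show ?thesis using N[OF that] by simp
    qed
    then show ?thesis unfolding growth_bounded_def by (intro exI[of _ 1]) auto
  qed
  moreover have "growth_bounded (cocycle f A x) {u} \<mu>" if u: "u \<in> W x" for u
  proof (cases "u \<in> Z x")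
    case True
    then show ?thesis using Zg unfolding growth_bounded_def by fast
  next
    case False
    then have u0: "u \<noteq> 0" using subspace_0[OF Z(1)[OF x]] by auto
    have "\<forall>\<^sub>F n in sequentially. norm (cocycle f A x n u) \<le> exp (real n * (lam + \<delta> / 2))"
      using False u \<open>\<delta> > 0\<close> by (intro elog_limitD(1)[OF exact[OF x]]) auto
    then obtain N where "\<And>n. n \<ge> N \<Longrightarrow> norm (cocycle f A x n u) \<le> exp (real n * \<mu>)"
      by (auto simp: eventually_sequentially \<mu>_def)
    then show ?thesis unfolding growth_bounded_def using u0
      by (intro exI[of _ "1 / norm u"] conjI exI[of _ N]) auto
  qed
  ultimately have "growth_bounded (cocycle f A x) (span (Z x \<union> set us)) \<mu>"
    using us(2) by (intro growth_bounded_span_Un Z x) auto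
  then show "growth_bounded (cocycle f A x) (W x) \<mu>" using WZ unfolding growth_bounded_def by (meson subsetD)
  show "\<mu> < lam + \<delta>" using \<open>\<delta> > 0\<close> by (simp add: \<mu>_def)
qed

lemma subadditive_volume:
  "subadditive_process M f X0 (\<lambda>n x c. volume_bound p (cocycle f A x n) (W x) (exp c)) (C * real p)"
proof
  fix n c x d assume x: "x \<in> X0"
  show "volume_bound p (cocycle f A x n) (W x) (exp d)"
    if "volume_bound p (cocycle f A x n) (W x) (exp c)" "c \<le> d"
    using volume_bound_mono[OF that(1)] that(2) by simp
  show "volume_bound p (cocycle f A x n) (W x) (exp (C * real p * real n))"
  proof -
    have "exp (real n * C) ^ p = exp (real p * (real n * C))" by (rule exp_of_nat_mult[symmetric])
    moreover have "norm (cocycle f A x n w) \<le> exp (real n * C) * norm w" for w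
      by (rule norm_cocycle_apply_le[where A = A, OF A_bound])
    then have "volume_bound p (cocycle f A x n) (W x) (exp (real n * C) ^ p)" by (intro volume_bound_power) auto
    ultimately show ?thesis by (simp add: mult_ac)
  qed
next
  fix n k c x d assume x: "x \<in> X0" and n: "volume_bound p (cocycle f A x n) (W x) (exp c)"
    and k: "volume_bound p (cocycle f A ((f ^^ n) x) k) (W ((f ^^ n) x)) (exp d)"
  have fn: "(f ^^ n) x \<in> X0" using x X0(3) by (induction n) auto
  have "cocycle f A x n ` W x \<subseteq> W ((f ^^ n) x)" using X0(3) W_invariant x by (rule cocycle_image_subset)
  then have "volume_bound p (cocycle f A ((f ^^ n) x) k o\<^sub>L cocycle f A x n) (W x) (exp d * exp c)"
    using fn W(1) by (intro volume_bound_compose[OF n k]) auto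
  then show "volume_bound p (cocycle f A x (n + k)) (W x) (exp (c + d))"
    by (simp add: cocycle_add exp_add mult.commute)
qed (use ergodic X0 W_sets in auto)

lemma not_AE_False: "\<not> (AE x in M. False)"
proof
  assume "AE x in M. False"
  then have "AE x in M. x \<in> ({} :: 'a set)" by simp
  then show False using ergodic_AE_iff[OF ergodic, of "{}"] by simp
qed

text \<open>The induction hypothesis supplies the large \<open>q\<close>-volumes required by
  \<open>slow_vector\<close>. If the \<open>Suc q\<close>-volumes were small, that lemma would give
  a vector outside \<open>Z x\<close> growing at a rate below \<open>lam\<close>, contrary to
  \<open>exact\<close>.\<close>

lemma lower:
  assumes "p \<le> m" "\<epsilon> > 0"
  shows "AE x in M. \<forall>\<^sub>F n in sequentially.
    \<not> volume_bound p (cocycle f A x n) (W x) (exp (real n * (real p * lam - \<epsilon>)))"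
  using assms
proof (induction p arbitrary: \<epsilon>)
  case 0
  have "\<not> volume_bound 0 (cocycle f A x n) (W x) (exp (real n * (real 0 * lam - \<epsilon>)))" if "n > 0" for x n
    using that \<open>\<epsilon> > 0\<close> mult_pos_pos[of "real n" \<epsilon>] by (simp add: volume_bound_def not_le del: mult_pos_pos zero_less_mult_iff)
  then show ?case by (intro AE_I2 eventually_mono[OF eventually_gt_at_top[of 0]])
next
  case (Suc q)
  interpret subadditive_process M f X0 "\<lambda>n x c. volume_bound (Suc q) (cocycle f A x n) (W x) (exp c)" "C * real (Suc q)"
    by (rule subadditive_volume)
  \<comment> \<open>Half of \<open>\<epsilon>\<close> remains on each side: the first alternative of
    the dichotomy gives a volume deficit \<open>\<epsilon> / 4\<close>, the second one the
    claim.\<close>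
  define a where "a = real (Suc q) * lam - \<epsilon> / 2"
  have "\<not> (\<forall>\<epsilon>>0. AE x in M. \<forall>\<^sub>F n in sequentially. volume_bound (Suc q) (cocycle f A x n) (W x) (exp ((a + \<epsilon>) * real n)))"
  proof
    assume "\<forall>\<epsilon>>0. AE x in M. \<forall>\<^sub>F n in sequentially. volume_bound (Suc q) (cocycle f A x n) (W x) (exp ((a + \<epsilon>) * real n))"
    then have vol: "AE x in M. \<forall>\<^sub>F n in sequentially.
        volume_bound (Suc q) (cocycle f A x n) (W x) (exp ((a + \<epsilon> / 4) * real n))"
      using Suc.prems(2) by simp
    have "AE x in M. \<forall>\<^sub>F n in sequentially.
        \<not> volume_bound q (cocycle f A x n) (W x) (exp (real n * (real q * lam - 1 / (real j + 1))))" for j :: nat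
      using Suc.prems(1) by (intro Suc.IH) auto
    \<comment> \<open>Countably many margins suffice, so one null set serves for all
      \<open>\<delta>\<close>.\<close>
    then have IH: "AE x in M. \<forall>j::nat. \<forall>\<^sub>F n in sequentially.
        \<not> volume_bound q (cocycle f A x n) (W x) (exp (real n * (real q * lam - 1 / (real j + 1))))"
      by (simp add: AE_all_countable)
    have "AE x in M. False" using vol IH AE_X0
    proof eventually_elim
      case (elim x)
      note x = \<open>x \<in> X0\<close>
      have low: "\<forall>\<^sub>F n in sequentially. \<not> volume_bound q (cocycle f A x n) (W x) (exp (real n * (real q * lam - \<delta>)))"
        if "\<delta> > 0" for \<delta>
      proof -
        obtain j :: nat where "1 / \<delta> < real j" using reals_Archimedean2 by blast
        then have "1 / \<delta> \<le> real j + 1" by linarith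
        then have j: "1 / (real j + 1) \<le> \<delta>" using that by (simp add: field_simps)
        then have "exp (real n * (real q * lam - \<delta>)) \<le> exp (real n * (real q * lam - 1 / (real j + 1)))" for n
          by (simp add: mult_left_mono)
        then show ?thesis using elim(2) volume_bound_mono by (fast elim: eventually_mono)
      qed
      obtain us where us: "length us = m" "set us \<subseteq> W x" "indep_mod (Z x) us" using m_attained[OF x] by blast
      \<comment> \<open>A tail of the list, since tails inherit \<open>indep_mod\<close> from its
        recursion.\<close>
      define fs where "fs = drop (m - Suc q) us"
      have fs: "length fs = Suc q" "set fs \<subseteq> W x" "indep_mod (Z x) fs"
      proof -
        show "length fs = Suc q" using us Suc.prems(1) by (simp add: fs_def)
        show "set fs \<subseteq> W x" using us set_drop_subset unfolding fs_def by fast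
        have "indep_mod (Z x) (drop k us)" for k using us(3)
          by (induction us arbitrary: k) (auto simp: drop_Cons split: nat.split)
        then show "indep_mod (Z x) fs" by (simp add: fs_def)
      qed
      have eq: "(a + \<epsilon> / 4) * real n = real n * (real (Suc q) * lam - \<epsilon> / 4)" for n by (simp add: a_def algebra_simps)
      have v: "\<forall>\<^sub>F n in sequentially. volume_bound (Suc q) (cocycle f A x n) (W x) (exp (real n * (real (Suc q) * lam - \<epsilon> / 4)))"
        using elim(1) by (simp only: eq)
      have "\<epsilon> / 4 > 0" using Suc.prems by simp
      then obtain u \<beta> where u: "u \<in> W x - Z x" "\<beta> > 0"
        "\<forall>\<^sub>F n in sequentially. norm (cocycle f A x n u) \<le> exp (real n * (lam - \<beta>))"
        using slow_vector[OF W(1)[OF x] W(2)[OF x] Z(1)[OF x] Z(2)[OF x] norm_cocycle_Suc_le[OF A_bound] upper[OF x] low _ v fs] by blast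
      have "\<forall>\<^sub>F n in sequentially. exp (real n * (lam - \<beta> / 2)) \<le> norm (cocycle f A x n u)"
        using u(2) by (intro elog_limitD(2)[OF exact[OF x u(1)]]) simp
      then have "\<forall>\<^sub>F n in sequentially. False" using u(3) eventually_gt_at_top[of 0]
      proof eventually_elim
        case (elim n)
        then have "exp (real n * (lam - \<beta> / 2)) \<le> exp (real n * (lam - \<beta>))" by linarith
        then show False using elim(3) u(2) by (simp add: mult_le_cancel_left)
      qed
      then show False by simp
    qed
    then show False using not_AE_False by blast
  qed
  then have "AE x in M. \<forall>\<^sub>F n in sequentially. \<not> volume_bound (Suc q) (cocycle f A x n) (W x) (exp ((a - \<epsilon> / 2) * real n))"
    using dichotomy[of a] Suc.prems(2) by fastforce
  moreover have eq: "(a - \<epsilon> / 2) * real n = real n * (real (Suc q) * lam - \<epsilon>)" for n by (simp add: a_def algebra_simps)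
  ultimately show ?case by (simp only: eq)
qed

text \<open>Vectors of the fast span are expanded at least at rate \<open>lam - \<epsilon>\<close>,
  those of \<open>Z x\<close> at most at rate \<open>chi\<close>, so the two spaces meet only in 0.
  By maximality of \<open>m\<close> the fast span is then a complement of \<open>Z x\<close> in
  \<open>W x\<close>, for this one time \<open>n\<close>.\<close>

lemma fast_slow_splitting:
  assumes x: "x \<in> X0" and \<epsilon>: "\<epsilon> > 0" "chi < lam - \<epsilon>" and "n > 0"
    and "3 ^ m \<le> exp (real n * (\<epsilon> / (real m + 1)\<^sup>2))"
    and up: "\<And>w. w \<in> W x \<Longrightarrow> norm (cocycle f A x n w) \<le> exp (real n * (lam + \<epsilon> / (real m + 1)\<^sup>2)) * norm w"
    and low: "\<not> volume_bound m (cocycle f A x n) (W x) (exp (real n * (real m * lam - \<epsilon> / (real m + 1)\<^sup>2)))"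
    and sl: "\<And>v. v \<in> Z x \<Longrightarrow> norm (cocycle f A x n v) \<le> exp (real n * chi) * norm v"
    and u: "u \<in> W x"
  shows "\<exists>e\<in>W x. u - e \<in> Z x \<and> norm e \<le> exp (- (real n * (lam - \<epsilon>))) * norm (cocycle f A x n e)"
proof -
  obtain us where us: "length us = m" "set us \<subseteq> W x"
    "exp (real n * (real m * lam - \<epsilon> / (real m + 1)\<^sup>2)) < pvol (map (blinfun_apply (cocycle f A x n)) us)"
    "\<And>e. e \<in> span (set us) \<Longrightarrow> norm e \<le> exp (- (real n * (lam - \<epsilon>))) * norm (cocycle f A x n e)"
    using fast_span[OF \<epsilon>(1) assms(5) W(1)[OF x] up low] by metis
  have "indep_mod (Z x) us"
  proof (rule indep_mod_of_disjoint_span[OF Z(1)[OF x]])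
    show "pvol (map (blinfun_apply (cocycle f A x n)) us) \<noteq> 0"
      using us(3) exp_gt_zero[of "real n * (real m * lam - \<epsilon> / (real m + 1)\<^sup>2)"] by linarith
    fix e assume e: "e \<in> span (set us)" "e \<in> Z x"
    have "norm e \<le> exp (- (real n * (lam - \<epsilon>))) * norm (cocycle f A x n e)" by (rule us(4)[OF e(1)])
    also have "\<dots> \<le> exp (- (real n * (lam - \<epsilon>))) * (exp (real n * chi) * norm e)"
      using sl[OF e(2)] by (intro mult_left_mono) auto
    also have "\<dots> = exp (real n * (chi - (lam - \<epsilon>))) * norm e" by (simp add: exp_add[symmetric] algebra_simps)
    finally have le: "norm e \<le> exp (real n * (chi - (lam - \<epsilon>))) * norm e" .
    have "real n * (chi - (lam - \<epsilon>)) < 0" using \<epsilon>(2) \<open>n > 0\<close> by (intro mult_pos_neg) auto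
    then have "exp (real n * (chi - (lam - \<epsilon>))) < 1" by simp
    then show "e = 0" using le by (metis less_le_not_le mult_le_cancel_right1 norm_le_zero_iff not_le)
  qed
  then have "u \<in> span (Z x \<union> set us)" using indep_mod_max_spans[OF m_max[OF x]] us(1,2) u by blast
  then obtain z s where zs: "z \<in> Z x" "s \<in> span (set us)" "u = z + s" using span_Un_decompose[OF Z(1)[OF x]] by blast
  moreover have "s \<in> W x" using zs(2) us(2) span_minimal W(1)[OF x] by blast
  ultimately show ?thesis using us(4) by (intro bexI[of _ s]) auto
qed

text \<open>An Egorov argument. Measurability concerns only the three volume bounds in
  \<open>R n\<close>; the fast component \<open>e\<close> is found afterwards, separately for each
  point and time.\<close>

lemma uniform_splitting:
  assumes \<epsilon>: "\<epsilon> > 0" "chi < lam - \<epsilon>" and "c < 1"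
  obtains G N where "G \<in> sets M" "G \<subseteq> X0" "c < measure M G"
    "\<And>x n u. x \<in> G \<Longrightarrow> n \<ge> N \<Longrightarrow> u \<in> W x \<Longrightarrow>
       \<exists>e\<in>W x. u - e \<in> Z x \<and> norm e \<le> exp (- (real n * (lam - \<epsilon>))) * norm (cocycle f A x n e)"
    "\<And>x n v. x \<in> G \<Longrightarrow> n \<ge> N \<Longrightarrow> v \<in> Z x \<Longrightarrow> norm (cocycle f A x n v) \<le> exp (real n * chi) * norm v"
proof -
  note D = ergodic_invariant_measureD[OF ergodic]
  interpret finite_measure M by (rule D(3))
  define \<epsilon>' where "\<epsilon>' = \<epsilon> / (real m + 1)\<^sup>2"
  have \<epsilon>': "\<epsilon>' > 0" using \<epsilon> by (simp add: \<epsilon>'_def)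
  define R where "R n = {x\<in>X0. volume_bound 1 (cocycle f A x n) (W x) (exp (real n * (lam + \<epsilon>')))} \<inter>
     (X0 - {x\<in>X0. volume_bound m (cocycle f A x n) (W x) (exp (real n * (real m * lam - \<epsilon>')))}) \<inter>
     {x\<in>X0. volume_bound 1 (cocycle f A x n) (Z x) (exp (real n * chi))}" for n
  have R: "R n \<in> sets M" for n unfolding R_def using X0(1) W_sets Z_sets by (intro sets.Int sets.Diff) auto
  define B where "B N = X0 - (\<Inter>n\<in>{N..}. R n)" for N
  have B: "B N \<in> sets M" for N unfolding B_def using X0(1) R by (intro sets.Diff sets.countable_INT') auto
  have "decseq B" by (rule decseq_SucI) (auto simp: B_def)
  moreover have "AE x in M. \<exists>N. x \<notin> B N" using lower[OF order_refl \<epsilon>'] AE_X0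
  proof eventually_elim
    case (elim x)
    have "\<forall>\<^sub>F n in sequentially. x \<in> R n" using upper[OF elim(2) \<epsilon>'] slow[OF elim(2)] elim(1)
      by eventually_elim (use elim(2) in \<open>auto simp: R_def volume_bound_1[unfolded One_nat_def]\<close>)
    then obtain N where "\<And>n. n \<ge> N \<Longrightarrow> x \<in> R n" by (auto simp: eventually_sequentially)
    then have "x \<notin> B N" by (auto simp: B_def)
    then show ?case by blast
  qed
  ultimately obtain N where N: "measure M (B N) < 1 - c"
    using measure_decreasing_small[where B = B and e = "1 - c", OF D(3) B] \<open>c < 1\<close> by auto
  define G where "G = X0 - B N"
  have G: "G \<in> sets M" "G \<subseteq> X0" using X0(1) B by (auto simp: G_def)
  have "measure M G = measure M X0 - measure M (B N)"
    unfolding G_def using X0(1) B by (intro finite_measure_Diff) (auto simp: B_def)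
  then have mG: "c < measure M G" using N X0(2) by simp
  have GR: "x \<in> R n" if "x \<in> G" "n \<ge> N" for x n using that by (auto simp: G_def B_def)
  obtain N' where N': "\<And>n. n \<ge> N' \<Longrightarrow> 3 ^ m \<le> exp (real n * \<epsilon>')"
    using eventually_le_exp_linear[OF \<epsilon>'] by (auto simp: eventually_sequentially)
  define N2 where "N2 = Max {N, N', 1}"
  have N2: "N2 \<ge> N" "N2 \<ge> N'" "N2 \<ge> 1" by (auto simp: N2_def)
  show ?thesis
  proof (rule that[OF G mG, of N2])
    fix x n v assume x: "x \<in> G" and n: "n \<ge> N2" and v: "v \<in> Z x"
    have "x \<in> R n" using GR[OF x] n N2 by simp
    then show "norm (cocycle f A x n v) \<le> exp (real n * chi) * norm v"
      using v by (auto simp: R_def volume_bound_1[unfolded One_nat_def])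
  next
    fix x n u assume x: "x \<in> G" and n: "n \<ge> N2" and u: "u \<in> W x"
    have xR: "x \<in> R n" using GR[OF x] n N2 by simp
    show "\<exists>e\<in>W x. u - e \<in> Z x \<and> norm e \<le> exp (- (real n * (lam - \<epsilon>))) * norm (cocycle f A x n e)"
    proof (rule fast_slow_splitting[OF _ \<epsilon> _ _ _ _ _ u])
      show "3 ^ m \<le> exp (real n * (\<epsilon> / (real m + 1)\<^sup>2))" using N'[of n] n N2 by (simp add: \<epsilon>'_def)
    qed (use xR n N2 G x in \<open>auto simp: R_def volume_bound_1[unfolded One_nat_def] \<epsilon>'_def\<close>)
  qed
qed

end

subsection \<open>Hoelder estimates\<close>

text \<open>Telescoping over the last factor: the orbits separate at most by \<open>L ^ n\<close>,
  and the base of the power dominates both the growth of the products and that of the differences of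
  the factors.\<close>

lemma norm_cocycle_diff_le:
  fixes f :: "'a::metric_space \<Rightarrow> 'a" and A :: "'a \<Rightarrow> ('b::real_normed_vector \<Rightarrow>\<^sub>L 'b)"
  assumes A: "\<And>x. norm (A x) \<le> exp C" and H: "\<And>x y. norm (A x - A y) \<le> c * dist x y powr \<nu>" and "c \<ge> 0"
    and f: "\<And>x y. dist (f x) (f y) \<le> L * dist x y" and "L \<ge> 1" "\<nu> > 0"
  shows "norm (cocycle f A x n - cocycle f A y n) \<le> ((c + exp C) * L powr \<nu>) ^ n * dist x y powr \<nu>"
proof (induction n)
  case (Suc n)
  define a where "a = (c + exp C) * L powr \<nu>"
  define D where "D = dist x y powr \<nu>"
  have D: "D \<ge> 0" by (simp add: D_def)
  have L1: "L powr \<nu> \<ge> 1" using \<open>L \<ge> 1\<close> \<open>\<nu> > 0\<close> by (simp add: ge_one_powr_ge_zero)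
  have dn: "dist ((f ^^ n) x) ((f ^^ n) y) \<le> L ^ n * dist x y"
  proof (induction n)
    case (Suc n)
    have "dist (f ((f ^^ n) x)) (f ((f ^^ n) y)) \<le> L * dist ((f ^^ n) x) ((f ^^ n) y)" by (rule f)
    also have "\<dots> \<le> L * (L ^ n * dist x y)" using Suc \<open>L \<ge> 1\<close> by (intro mult_left_mono) auto
    finally show ?case by simp
  qed simp
  have "dist ((f ^^ n) x) ((f ^^ n) y) powr \<nu> \<le> (L ^ n * dist x y) powr \<nu>" using dn \<open>\<nu> > 0\<close> by (intro powr_mono2) auto
  also have "\<dots> = (L ^ n) powr \<nu> * D" using \<open>L \<ge> 1\<close> by (simp add: powr_mult D_def)
  also have "(L ^ n) powr \<nu> = (L powr \<nu>) ^ n" using \<open>L \<ge> 1\<close> by (induction n) (auto simp: powr_mult)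
  finally have Dn: "dist ((f ^^ n) x) ((f ^^ n) y) powr \<nu> \<le> (L powr \<nu>) ^ n * D" .
  let ?x = "cocycle f A x n" and ?y = "cocycle f A y n"
  have "norm ?x \<le> exp (real n * C)"
    by (rule norm_blinfun_bound) (auto intro: norm_cocycle_apply_le[where A = A, OF A])
  also have "\<dots> = exp C ^ n" by (rule exp_of_nat_mult)
  finally have nx: "norm ?x \<le> exp C ^ n" .
  have "cocycle f A x (Suc n) - cocycle f A y (Suc n) =
      ((A ((f ^^ n) x) - A ((f ^^ n) y)) o\<^sub>L ?x) + (A ((f ^^ n) y) o\<^sub>L (?x - ?y))"
    by (intro blinfun_eqI) (simp add: blinfun.diff_left blinfun.diff_right blinfun.add_left)
  then have "norm (cocycle f A x (Suc n) - cocycle f A y (Suc n)) \<le>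
      norm ((A ((f ^^ n) x) - A ((f ^^ n) y)) o\<^sub>L ?x) + norm (A ((f ^^ n) y) o\<^sub>L (?x - ?y))"
    by (metis norm_triangle_ineq)
  also have "norm ((A ((f ^^ n) x) - A ((f ^^ n) y)) o\<^sub>L ?x) \<le> norm (A ((f ^^ n) x) - A ((f ^^ n) y)) * norm ?x"
    by (rule norm_blinfun_compose)
  also have "\<dots> \<le> (c * ((L powr \<nu>) ^ n * D)) * exp C ^ n"
    using H[of "(f ^^ n) x" "(f ^^ n) y"] Dn nx \<open>c \<ge> 0\<close> D L1
    by (intro mult_mono) (auto intro: order_trans[OF _ mult_left_mono])
  also have "\<dots> = c * (exp C * L powr \<nu>) ^ n * D" by (simp add: power_mult_distrib)
  also have "\<dots> \<le> c * a ^ n * D" unfolding a_def using \<open>c \<ge> 0\<close> D L1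
    by (intro mult_right_mono mult_left_mono power_mono) auto
  also have "norm (A ((f ^^ n) y) o\<^sub>L (?x - ?y)) \<le> norm (A ((f ^^ n) y)) * norm (?x - ?y)" by (rule norm_blinfun_compose)
  also have "\<dots> \<le> exp C * (a ^ n * D)" using A Suc by (intro mult_mono) (auto simp: a_def D_def)
  finally have "norm (cocycle f A x (Suc n) - cocycle f A y (Suc n)) \<le> (c + exp C) * (a ^ n * D)" by (simp add: algebra_simps)
  also have "\<dots> \<le> a * (a ^ n * D)"
    using \<open>c \<ge> 0\<close> D L1 mult_left_mono[of 1 "L powr \<nu>" "c + exp C"] by (intro mult_right_mono) (auto simp: a_def)
  finally show ?case by (simp add: a_def D_def)
qed simp

text \<open>A unit vector \<open>u\<close> that grows slowly under the perturbed operators \<open>S\<close> and is close to \<open>W\<close>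
  is close to the slow subspace \<open>Z\<close> of \<open>W\<close>: a large component of \<open>u\<close> transversal to \<open>Z\<close> would
  be expanded by \<open>T\<close>.\<close>

lemma infdist_slow_subspace_le:
  fixes T S :: "'b::real_normed_vector \<Rightarrow>\<^sub>L 'b"
  assumes "subspace W" "norm u = 1" "0 < d" "d \<le> 1" "0 < \<theta>" "\<theta> \<le> \<nu>" "0 \<le> K" "1 \<le> a"
    and near: "infdist u W \<le> K * d powr \<theta>"
    and diff: "norm (T - S) \<le> a ^ n * d powr \<nu>" and T: "\<And>w. norm (T w) \<le> a ^ n * norm w"
    and S: "norm (S u) \<le> exp (real n * \<kappa>)"
    and half: "exp (- (real n * (\<mu> - \<kappa>))) \<le> 1 / 2"
    and split: "\<And>w. w \<in> W \<Longrightarrow> \<exists>e\<in>W. w - e \<in> Z \<and> norm e \<le> exp (- (real n * \<mu>)) * norm (T e)"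
    and slow: "\<And>v. v \<in> Z \<Longrightarrow> norm (T v) \<le> exp (real n * \<kappa>) * norm v"
  shows "infdist u Z \<le> (K + 1) * d powr \<theta> +
     2 * (K + 3) * (exp (- (real n * (\<mu> - \<kappa>))) + (a * exp \<bar>\<mu>\<bar>) ^ n * d powr \<theta>)"
proof -
  define q where "q = d powr \<theta>"
  have q: "0 < q" "q \<le> 1" using assms by (auto simp: q_def powr_le1)
  have q\<nu>: "d powr \<nu> \<le> q" unfolding q_def using assms by (intro powr_mono') auto
  have "infdist u W < (K + 1) * q" using near[folded q_def] q(1) by (simp add: distrib_right)
  then obtain w where w: "w \<in> W" "norm (u - w) < (K + 1) * q" using infdist_approx_diff[OF assms(1)] by blast
  obtain e where e: "e \<in> W" "w - e \<in> Z" "norm e \<le> exp (- (real n * \<mu>)) * norm (T e)" using split[OF w(1)] by blast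
  define v where "v = w - e"
  define E where "E = exp (- (real n * (\<mu> - \<kappa>)))"
  have a0: "a ^ n \<ge> 0" using assms by simp
  have "(K + 1) * q \<le> (K + 1) * 1" using q assms by (intro mult_left_mono) auto
  then have "(K + 1) * q \<le> K + 1" by simp
  with less_imp_le[OF w(2)] have uw: "norm (u - w) \<le> K + 1" by (rule order_trans)
  have "v = u - (u - w) - e" by (simp add: v_def)
  then have "norm v \<le> norm u + norm (u - w) + norm e" by (smt (verit) norm_triangle_ineq4)
  then have nv: "norm v \<le> K + 2 + norm e" using uw assms(2) by linarith
  have Tu: "norm (T u) \<le> exp (real n * \<kappa>) + a ^ n * q"
  proof -
    have "T u = S u + (T - S) u" by (simp add: blinfun.diff_left)
    then have "norm (T u) \<le> norm (S u) + norm ((T - S) u)" by (metis norm_triangle_ineq)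
    also have "norm ((T - S) u) \<le> norm (T - S)" using norm_blinfun[of "T - S" u] assms(2) by simp
    also have "\<dots> \<le> a ^ n * q" using diff mult_left_mono[OF q\<nu> a0] by linarith
    finally show ?thesis using S by linarith
  qed
  have Tuw: "norm (T (u - w)) \<le> a ^ n * ((K + 1) * q)"
    using T[of "u - w"] mult_left_mono[OF less_imp_le[OF w(2)] a0] by linarith
  have Tv: "norm (T v) \<le> exp (real n * \<kappa>) * (K + 2 + norm e)"
    using slow[of v] e(2) nv by (metis exp_ge_zero mult_left_mono order_trans v_def)
  have "T e = T u - T (u - w) - T v" by (simp add: v_def blinfun.diff_right)
  then have "norm (T e) \<le> norm (T u) + norm (T (u - w)) + norm (T v)" by (smt (verit) norm_triangle_ineq4)
  also have "\<dots> \<le> exp (real n * \<kappa>) * (K + 3 + norm e) + a ^ n * ((K + 2) * q)"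
    using Tu Tuw Tv by (simp add: algebra_simps)
  finally have "exp (- (real n * \<mu>)) * norm (T e) \<le> exp (- (real n * \<mu>)) *
      (exp (real n * \<kappa>) * (K + 3 + norm e) + a ^ n * ((K + 2) * q))" by (rule mult_left_mono) simp
  also have "\<dots> = E * (K + 3 + norm e) + exp (- (real n * \<mu>)) * a ^ n * ((K + 2) * q)"
    by (simp add: E_def exp_add[symmetric] algebra_simps)
  also have "exp (- (real n * \<mu>)) * a ^ n * ((K + 2) * q) \<le> (a * exp \<bar>\<mu>\<bar>) ^ n * ((K + 2) * q)"
  proof (rule mult_right_mono)
    have "exp (- (real n * \<mu>)) = exp (- \<mu>) ^ n" by (metis exp_of_nat_mult mult_minus_right)
    also have "\<dots> \<le> exp \<bar>\<mu>\<bar> ^ n" by (intro power_mono) auto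
    finally show "exp (- (real n * \<mu>)) * a ^ n \<le> (a * exp \<bar>\<mu>\<bar>) ^ n"
      using a0 by (simp add: power_mult_distrib mult.commute mult_left_mono)
  qed (use q assms in auto)
  \<comment> \<open>The unknown \<open>norm e\<close> reappears through the slow part
    \<open>v = w - e\<close>; since \<open>E \<le> 1 / 2\<close>, it can be absorbed on the
    left.\<close>
  also have "E * (K + 3 + norm e) \<le> E * (K + 3) + norm e / 2"
    using half mult_right_mono[of E "1 / 2" "norm e"] by (simp add: E_def algebra_simps)
  finally have "norm e \<le> E * (K + 3) + norm e / 2 + (a * exp \<bar>\<mu>\<bar>) ^ n * ((K + 2) * q)" using e(3) by linarith
  also have "(a * exp \<bar>\<mu>\<bar>) ^ n * ((K + 2) * q) \<le> (a * exp \<bar>\<mu>\<bar>) ^ n * ((K + 3) * q)"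
    using q assms by (intro mult_left_mono mult_right_mono) auto
  finally have ne: "norm e \<le> 2 * (K + 3) * (E + (a * exp \<bar>\<mu>\<bar>) ^ n * q)" by (simp add: algebra_simps)
  have "infdist u Z \<le> norm (u - v)" using infdist_le[OF e(2), of u] by (simp add: dist_norm v_def)
  also have "u - v = (u - w) + e" by (simp add: v_def)
  also have "norm \<dots> \<le> norm (u - w) + norm e" by (rule norm_triangle_ineq)
  finally show ?thesis using w(2) ne by (simp add: q_def E_def)
qed

text \<open>The number of iterates is chosen proportional to \<open>- ln d\<close>, which balances the two error terms.\<close>

lemma exists_balanced_time:
  fixes b \<beta> \<theta> :: real
  assumes "b > 1" "\<beta> > 0" "\<theta> > 0"
  shows "\<exists>\<theta>'>0. \<theta>' \<le> \<theta> \<and> (\<exists>\<delta>>0. \<delta> \<le> 1 \<and> (\<forall>d. 0 < d \<and> d < \<delta> \<longrightarrow>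
     (\<exists>n\<ge>N. exp (- (real n * \<beta>)) \<le> exp \<beta> * d powr \<theta>' \<and> b ^ n * d powr \<theta> \<le> d powr \<theta>')))"
proof -
  \<comment> \<open>With \<open>n\<close> at most \<open>\<tau> * (- ln d)\<close> the factor
    \<open>b ^ n\<close> is at most \<open>d powr (- \<theta> / 2)\<close>, so half of the exponent
    \<open>\<theta>\<close> survives.\<close>
  define \<tau> where "\<tau> = \<theta> / (2 * ln b)"
  have lb: "ln b > 0" using assms by simp
  have \<tau>: "\<tau> > 0" using lb assms by (simp add: \<tau>_def)
  define \<theta>' where "\<theta>' = min (\<theta> / 2) (\<beta> * \<tau>)"
  have \<theta>': "\<theta>' > 0" "\<theta>' \<le> \<theta>" "\<theta>' \<le> \<theta> / 2" "\<theta>' \<le> \<beta> * \<tau>" using \<tau> assms by (auto simp: \<theta>'_def)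
  \<comment> \<open>\<open>N\<close> enters only here, to ensure \<open>n \<ge> N\<close>; the
    exponent \<open>\<theta>'\<close> does not depend on it.\<close>
  define \<delta> where "\<delta> = exp (- ((real N + 1) / \<tau>))"
  have "\<delta> > 0" "\<delta> \<le> 1" using \<tau> by (auto simp: \<delta>_def)
  moreover have "\<exists>n\<ge>N. exp (- (real n * \<beta>)) \<le> exp \<beta> * d powr \<theta>' \<and> b ^ n * d powr \<theta> \<le> d powr \<theta>'"
    if d: "0 < d" "d < \<delta>" for d
  proof -
    define l where "l = - ln d"
    have "ln d < ln \<delta>" using d by simp
    then have "ln d < - ((real N + 1) / \<tau>)" by (simp add: \<delta>_def)
    then have "(real N + 1) / \<tau> < l" by (simp add: l_def)
    then have l: "real N + 1 < \<tau> * l" using \<tau> by (simp add: field_simps)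
    have l0: "l > 0" using l \<tau> by (metis add_nonneg_pos less_trans of_nat_0_le_iff zero_less_mult_pos zero_less_one)
    define n where "n = nat \<lfloor>\<tau> * l\<rfloor>"
    have "\<tau> * l \<ge> 0" using l by linarith
    then have n: "real n \<le> \<tau> * l" "\<tau> * l < real n + 1" unfolding n_def by linarith+
    have dp: "d powr t = exp (- (t * l))" for t using d by (simp add: powr_def l_def)
    have "N \<le> n" using n(2) l by linarith
    moreover have "exp (- (real n * \<beta>)) \<le> exp \<beta> * d powr \<theta>'"
    proof -
      have "\<theta>' * l \<le> \<beta> * \<tau> * l" using \<theta>' l0 by (intro mult_right_mono) auto
      also have "\<dots> \<le> \<beta> * (real n + 1)" using n(2) assms by (simp add: mult.assoc)
      finally have "- (real n * \<beta>) \<le> \<beta> + - (\<theta>' * l)" by (simp add: algebra_simps)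
      then show ?thesis unfolding dp by (simp add: exp_add[symmetric])
    qed
    moreover have "b ^ n * d powr \<theta> \<le> d powr \<theta>'"
    proof -
      have "b ^ n = exp (real n * ln b)" using assms(1) by (simp add: exp_of_nat_mult)
      moreover have "real n * ln b + - (\<theta> * l) \<le> - (\<theta>' * l)"
      proof -
        have "real n * ln b \<le> \<tau> * l * ln b" using n(1) lb by (intro mult_right_mono) auto
        also have "\<dots> = \<theta> / 2 * l" using lb by (simp add: \<tau>_def)
        finally have "real n * ln b \<le> \<theta> / 2 * l" .
        moreover have "\<theta>' * l \<le> \<theta> / 2 * l" using \<theta>' l0 by (intro mult_right_mono) auto
        ultimately show ?thesis by simp
      qed
      ultimately show ?thesis unfolding dp by (simp add: exp_add[symmetric])
    qed
    ultimately show ?thesis by blast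
  qed
  ultimately show ?thesis using \<theta>'(1,2) by blast
qed

text \<open>Two families, because in the descent the vectors stay in \<open>V i y\<close> while the
  target shrinks from \<open>V 1 x\<close> to \<open>V i x\<close>. Coinciding points are excluded
  since the number of iterates is chosen through \<open>ln (dist x y)\<close>.\<close>

definition holder_near :: "'a::metric_space set \<Rightarrow> ('a \<Rightarrow> 'b::real_normed_vector set) \<Rightarrow> ('a \<Rightarrow> 'b set) \<Rightarrow> bool" where
  "holder_near \<Lambda> U W \<longleftrightarrow> (\<exists>K\<ge>0. \<exists>\<theta>>0. \<exists>\<delta>>0. \<forall>x\<in>\<Lambda>. \<forall>y\<in>\<Lambda>. 0 < dist x y \<and> dist x y < \<delta> \<longrightarrow>
      (\<forall>u\<in>U y. norm u = 1 \<longrightarrow> infdist u (W x) \<le> K * dist x y powr \<theta>))"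

text \<open>A unit vector of \<open>U y\<close> is slow for the cocycle at \<open>y\<close> because
  \<open>U y\<close> is contained in \<open>Z y\<close>; \<open>infdist_slow_subspace_le\<close> at
  the balanced time brings it near \<open>Z x\<close>, with a possibly smaller exponent.\<close>

lemma holder_near_slow_subspace:
  fixes f :: "'a::metric_space \<Rightarrow> 'a" and A :: "'a \<Rightarrow> ('b::real_normed_vector \<Rightarrow>\<^sub>L 'b)"
  assumes "1 < a" "\<nu> > 0" "\<kappa> < \<mu>"
    and diff: "\<And>x y n. norm (cocycle f A x n - cocycle f A y n) \<le> a ^ n * dist x y powr \<nu>"
    and bound: "\<And>x n w. norm (cocycle f A x n w) \<le> a ^ n * norm w"
    and W: "\<And>x. x \<in> \<Lambda> \<Longrightarrow> subspace (W x)" and U: "\<And>x. x \<in> \<Lambda> \<Longrightarrow> U x \<subseteq> Z x"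
    and split: "\<And>x n w. x \<in> \<Lambda> \<Longrightarrow> n \<ge> N \<Longrightarrow> w \<in> W x \<Longrightarrow>
       \<exists>e\<in>W x. w - e \<in> Z x \<and> norm e \<le> exp (- (real n * \<mu>)) * norm (cocycle f A x n e)"
    and slow: "\<And>x n v. x \<in> \<Lambda> \<Longrightarrow> n \<ge> N \<Longrightarrow> v \<in> Z x \<Longrightarrow> norm (cocycle f A x n v) \<le> exp (real n * \<kappa>) * norm v"
    and near: "holder_near \<Lambda> U W"
  shows "holder_near \<Lambda> U Z"
proof -
  obtain K \<theta>0 \<delta>0 where K: "K \<ge> 0" "\<theta>0 > 0" "\<delta>0 > 0" and near: "\<And>x y u. x \<in> \<Lambda> \<Longrightarrow> y \<in> \<Lambda> \<Longrightarrow>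
      0 < dist x y \<Longrightarrow> dist x y < \<delta>0 \<Longrightarrow> u \<in> U y \<Longrightarrow> norm u = 1 \<Longrightarrow> infdist u (W x) \<le> K * dist x y powr \<theta>0"
    using near unfolding holder_near_def by blast
  define \<theta> where "\<theta> = min \<theta>0 \<nu>"
  have \<theta>: "\<theta> > 0" "\<theta> \<le> \<theta>0" "\<theta> \<le> \<nu>" using K assms by (auto simp: \<theta>_def)
  define \<beta> where "\<beta> = \<mu> - \<kappa>"
  have \<beta>: "\<beta> > 0" using assms by (simp add: \<beta>_def)
  define b where "b = a * exp \<bar>\<mu>\<bar>"
  have "1 * 1 < a * exp \<bar>\<mu>\<bar>" using assms by (intro mult_less_le_imp_less) auto
  then have b: "b > 1" by (simp add: b_def)
  obtain N1 where N1: "\<And>n. n \<ge> N1 \<Longrightarrow> 2 \<le> exp (real n * \<beta>)"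
    using eventually_le_exp_linear[OF \<beta>] by (auto simp: eventually_sequentially)
  obtain \<theta>' \<delta>1 where \<theta>': "\<theta>' > 0" "\<theta>' \<le> \<theta>" and \<delta>1: "\<delta>1 > 0" "\<delta>1 \<le> 1" and time: "\<And>d. 0 < d \<Longrightarrow> d < \<delta>1 \<Longrightarrow>
     \<exists>n\<ge>max N N1. exp (- (real n * \<beta>)) \<le> exp \<beta> * d powr \<theta>' \<and> b ^ n * d powr \<theta> \<le> d powr \<theta>'"
    using exists_balanced_time[OF b \<beta> \<theta>(1), of "max N N1"] by blast
  define K' where "K' = (K + 1) + 2 * (K + 3) * (exp \<beta> + 1)"
  have "infdist u (Z x) \<le> K' * dist x y powr \<theta>'"
    if x: "x \<in> \<Lambda>" and y: "y \<in> \<Lambda>" and d: "0 < dist x y" "dist x y < min \<delta>0 \<delta>1" and u: "u \<in> U y" "norm u = 1" for x y u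
  proof -
    define d where "d = dist x y"
    have d01: "0 < d" "d < \<delta>1" "d \<le> 1" using d \<delta>1 by (auto simp: d_def)
    obtain n where n: "n \<ge> N" "n \<ge> N1" "exp (- (real n * \<beta>)) \<le> exp \<beta> * d powr \<theta>'" "b ^ n * d powr \<theta> \<le> d powr \<theta>'"
      using time[OF d01(1,2)] by auto
    have "infdist u (Z x) \<le> (K + 1) * d powr \<theta> +
       2 * (K + 3) * (exp (- (real n * (\<mu> - \<kappa>))) + (a * exp \<bar>\<mu>\<bar>) ^ n * d powr \<theta>)"
    proof (rule infdist_slow_subspace_le[OF W[OF x] u(2) d01(1,3) \<theta>(1,3) K(1)])
      show "1 \<le> a" using assms by simp
      have "d powr \<theta>0 \<le> d powr \<theta>" using d01 \<theta> by (intro powr_mono') auto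
      then have "K * d powr \<theta>0 \<le> K * d powr \<theta>" using K by (intro mult_left_mono)
      then show "infdist u (W x) \<le> K * d powr \<theta>" using near[OF x y _ _ u] d by (simp add: d_def)
      show "norm (cocycle f A x n - cocycle f A y n) \<le> a ^ n * d powr \<nu>" unfolding d_def by (rule diff)
      show "norm (cocycle f A y n u) \<le> exp (real n * \<kappa>)" using slow[OF y n(1), of u] u U[OF y] by auto
      have "exp (- (real n * \<beta>)) = 1 / exp (real n * \<beta>)" by (simp add: exp_minus field_simps)
      also have "\<dots> \<le> 1 / 2" using N1[OF n(2)] by (intro divide_left_mono) auto
      finally show "exp (- (real n * (\<mu> - \<kappa>))) \<le> 1 / 2" by (simp add: \<beta>_def)
    qed (use x n split slow bound in auto)
    also have "\<dots> \<le> (K + 1) * d powr \<theta>' + 2 * (K + 3) * (exp \<beta> * d powr \<theta>' + d powr \<theta>')"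
    proof (intro add_mono mult_left_mono)
      show "d powr \<theta> \<le> d powr \<theta>'" using d01 \<theta>' by (intro powr_mono') auto
    qed (use n K in \<open>auto simp: \<beta>_def b_def\<close>)
    also have "\<dots> = K' * d powr \<theta>'" by (simp add: K'_def algebra_simps)
    finally show ?thesis by (simp add: d_def)
  qed
  moreover have "K' \<ge> 0" using K by (simp add: K'_def add_nonneg_nonneg)
  moreover have "min \<delta>0 \<delta>1 > 0" using K \<delta>1 by simp
  ultimately show ?thesis unfolding holder_near_def using \<theta>'(1) by blast
qed

section \<open>From nearness of subspaces to the distance of unit spheres\<close>

text \<open>Normalising \<open>w\<close> moves it by \<open>\<bar>norm w - 1\<bar>\<close>, which is
  at most \<open>dist v w\<close> because \<open>v\<close> is a unit vector; hence the factor 2. The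
  unit vector \<open>w0\<close> handles \<open>w = 0\<close>.\<close>

lemma infdist_sphere_le:
  fixes v :: "'b::real_normed_vector"
  assumes "subspace W" "norm v = 1" "w0 \<in> W" "norm w0 = 1"
  shows "infdist v (W \<inter> sphere 0 1) \<le> 2 * infdist v W"
proof -
  have "infdist v (W \<inter> sphere 0 1) / 2 \<le> dist v w" if w: "w \<in> W" for w
  proof (cases "w = 0")
    case True
    have "infdist v (W \<inter> sphere 0 1) \<le> dist v w0" using assms by (intro infdist_le) auto
    also have "\<dots> \<le> norm v + norm w0" unfolding dist_norm by (rule norm_triangle_ineq4)
    finally show ?thesis using True assms by simp
  next
    case False
    have "w /\<^sub>R norm w \<in> W \<inter> sphere 0 1" using w False assms(1) by (auto simp: subspace_scale)
    then have "infdist v (W \<inter> sphere 0 1) \<le> dist v (w /\<^sub>R norm w)" by (rule infdist_le)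
    also have "\<dots> \<le> dist v w + dist w (w /\<^sub>R norm w)" by (rule dist_triangle)
    also have "dist w (w /\<^sub>R norm w) = \<bar>norm w - 1\<bar>"
    proof -
      have "w - w /\<^sub>R norm w = ((norm w - 1) / norm w) *\<^sub>R w" using False by (simp add: scaleR_diff_left diff_divide_distrib inverse_eq_divide)
      then show ?thesis using False by (simp add: dist_norm)
    qed
    also have "\<dots> \<le> dist v w" using norm_triangle_ineq3[of w v] assms(2) by (simp add: dist_norm norm_minus_commute)
    finally show ?thesis by simp
  qed
  moreover have ne: "W \<noteq> {}" using assms by auto
  ultimately have "infdist v (W \<inter> sphere 0 1) / 2 \<le> infdist v W"
    unfolding infdist_notempty[OF ne] using ne by (intro cINF_greatest) auto
  then show ?thesis by simp
qed

text \<open>Finite codimension in an infinite-dimensional space excludes the zero subspace; this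
  keeps the suprema in \<open>d_hat\<close> over nonempty sets.\<close>

lemma has_codimension_unit_vector:
  fixes W :: "'b::real_normed_vector set"
  assumes "\<not> (\<exists>B :: 'b set. finite B \<and> span B = UNIV)" "has_codimension W m" "subspace W"
  obtains w where "w \<in> W" "norm w = 1"
proof -
  obtain B where B: "finite B" "span (W \<union> B) = UNIV" using assms(2) unfolding has_codimension_def by blast
  have "\<exists>w\<in>W. w \<noteq> 0"
  proof (rule ccontr)
    assume "\<not> ?thesis"
    then have "W \<union> B \<subseteq> insert 0 B" by auto
    then have "span (W \<union> B) \<subseteq> span B" by (metis span_insert_0 span_mono)
    then show False using assms(1) B by auto
  qed
  then obtain w where "w \<in> W" "w \<noteq> 0" by blast
  then show ?thesis using that[of "w /\<^sub>R norm w"] assms(3) by (simp add: subspace_scale)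
qed

text \<open>\<open>holder_near\<close> ranges over ordered pairs, so it bounds both suprema. The
  constant \<open>2 * K + 1\<close> is positive even if \<open>K = 0\<close>.\<close>

lemma holder_near_d_hat:
  assumes near: "holder_near \<Lambda> V V" and V: "\<And>x. x \<in> \<Lambda> \<Longrightarrow> subspace (V x)"
    and unit: "\<And>x. x \<in> \<Lambda> \<Longrightarrow> \<exists>w\<in>V x. norm w = 1"
  shows "\<exists>C>0. \<exists>\<theta>>0. \<exists>\<delta>>0. \<forall>x\<in>\<Lambda>. \<forall>y\<in>\<Lambda>. dist x y < \<delta> \<longrightarrow> d_hat (V x) (V y) \<le> C * dist x y powr \<theta>"
proof -
  obtain K \<theta> \<delta> where K: "K \<ge> 0" "\<theta> > 0" "\<delta> > 0" and near: "\<And>x y u. x \<in> \<Lambda> \<Longrightarrow> y \<in> \<Lambda> \<Longrightarrow>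
      0 < dist x y \<Longrightarrow> dist x y < \<delta> \<Longrightarrow> u \<in> V y \<Longrightarrow> norm u = 1 \<Longrightarrow> infdist u (V x) \<le> K * dist x y powr \<theta>"
    using near unfolding holder_near_def by blast
  have sup: "(SUP v\<in>V y \<inter> sphere 0 1. infdist v (V x \<inter> sphere 0 1)) \<le> (2 * K + 1) * dist x y powr \<theta>"
    if x: "x \<in> \<Lambda>" and y: "y \<in> \<Lambda>" and d: "dist x y < \<delta>" for x y
  proof (rule cSUP_least)
    show "V y \<inter> sphere 0 1 \<noteq> {}" using unit[OF y] by auto
    fix v assume v: "v \<in> V y \<inter> sphere 0 1"
    show "infdist v (V x \<inter> sphere 0 1) \<le> (2 * K + 1) * dist x y powr \<theta>"
    proof (cases "x = y")
      case True
      then show ?thesis using v by simp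
    next
      case False
      obtain w where "w \<in> V x" "norm w = 1" using unit[OF x] by blast
      then have "infdist v (V x \<inter> sphere 0 1) \<le> 2 * infdist v (V x)" using v by (intro infdist_sphere_le[OF V[OF x]]) auto
      also have "\<dots> \<le> 2 * (K * dist x y powr \<theta>)" using near[OF x y _ d, of v] False v by simp
      also have "\<dots> \<le> (2 * K + 1) * dist x y powr \<theta>" by (simp add: algebra_simps)
      finally show ?thesis .
    qed
  qed
  have "d_hat (V x) (V y) \<le> (2 * K + 1) * dist x y powr \<theta>" if "x \<in> \<Lambda>" "y \<in> \<Lambda>" "dist x y < \<delta>" for x y
    unfolding d_hat_def using sup[OF that] sup[of y x] that by (simp add: dist_commute)
  moreover have "2 * K + 1 > 0" using K by simp
  ultimately show ?thesis using K by blast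
qed

lemma holder_map_continuous:
  assumes "holder_map \<nu> A" "\<nu> > 0" shows "continuous_on UNIV A"
proof -
  obtain c where c: "\<And>x y. norm (A x - A y) \<le> c * dist x y powr \<nu>" using assms(1) unfolding holder_map_def by blast
  show ?thesis unfolding continuous_on_iff
  proof (intro ballI allI impI)
    fix x :: 'a and e :: real assume "e > 0"
    define q where "q = e / (\<bar>c\<bar> + 1)"
    have q: "q > 0" using \<open>e > 0\<close> by (simp add: q_def add_nonneg_pos)
    have "dist (A y) (A x) < e" if y: "dist y x < q powr (1 / \<nu>)" for y
    proof -
      have "dist y x powr \<nu> < (q powr (1 / \<nu>)) powr \<nu>" using y assms(2) by (intro powr_less_mono2) auto
      also have "\<dots> = q" using q assms(2) by (simp add: powr_powr)
      finally have "(\<bar>c\<bar> + 1) * dist y x powr \<nu> < (\<bar>c\<bar> + 1) * q" by (intro mult_strict_left_mono) auto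
      also have "\<dots> = e" unfolding q_def by (simp add: add_nonneg_pos less_imp_neq[symmetric])
      finally have "(\<bar>c\<bar> + 1) * dist y x powr \<nu> < e" .
      moreover have "c * dist y x powr \<nu> \<le> (\<bar>c\<bar> + 1) * dist y x powr \<nu>" by (intro mult_right_mono) auto
      ultimately show ?thesis using c[of y x] by (simp add: dist_norm)
    qed
    moreover have "q powr (1 / \<nu>) > 0" using q by simp
    ultimately show "\<exists>d>0. \<forall>x'\<in>UNIV. dist x' x < d \<longrightarrow> dist (A x') (A x) < e" by blast
  qed
qed

section \<open>Application to the Oseledets filtration\<close>

lemma oseledets_filtrationD:
  fixes A :: "'a \<Rightarrow> ('b::real_normed_vector \<Rightarrow>\<^sub>L 'b)"
  assumes O: "oseledets_filtration M f A alpha X0 k lam V"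
  shows "X0 \<in> sets M" "measure M X0 = 1" "f ` X0 \<subseteq> X0"
    and "1 \<le> i \<Longrightarrow> enat i \<le> k \<Longrightarrow> alpha < ereal (lam i)"
    and "1 \<le> i \<Longrightarrow> enat (i + 1) \<le> k \<Longrightarrow> lam (i + 1) < lam i"
    and "x \<in> X0 \<Longrightarrow> V 1 x = UNIV"
    and "1 \<le> i \<Longrightarrow> enat i \<le> k + 1 \<Longrightarrow> x \<in> X0 \<Longrightarrow> subspace (V i x)"
    and "1 \<le> i \<Longrightarrow> enat i \<le> k + 1 \<Longrightarrow> x \<in> X0 \<Longrightarrow> closed (V i x)"
    and "1 \<le> i \<Longrightarrow> enat i \<le> k + 1 \<Longrightarrow> \<exists>m. \<forall>x\<in>X0. has_codimension (V i x) m"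
    and "1 \<le> i \<Longrightarrow> enat i \<le> k + 1 \<Longrightarrow> x \<in> X0 \<Longrightarrow> blinfun_apply (A x) ` V i x \<subseteq> V i (f x)"
    and "1 \<le> i \<Longrightarrow> enat i \<le> k \<Longrightarrow> x \<in> X0 \<Longrightarrow> V (i + 1) x \<subseteq> V i x"
    and "1 \<le> i \<Longrightarrow> enat i \<le> k \<Longrightarrow> x \<in> X0 \<Longrightarrow> u \<in> V i x - V (i + 1) x \<Longrightarrow>
        (\<lambda>n. elog (norm (blinfun_apply (cocycle f A x n) u)) / ereal (real n)) \<longlonglongrightarrow> ereal (lam i)"
    and "1 \<le> i \<Longrightarrow> enat i \<le> k \<Longrightarrow> x \<in> X0 \<Longrightarrow>
        limsup (\<lambda>n. elog (norm_restrict (cocycle f A x n) (V (i + 1) x)) / ereal (real n)) \<le> exponent k lam alpha (i + 1)"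
    and "1 \<le> i \<Longrightarrow> enat i \<le> k + 1 \<Longrightarrow> open U \<Longrightarrow> {x\<in>X0. V i x \<inter> U \<noteq> {}} \<in> sets M"
  using O[unfolded oseledets_filtration_def] by (elim conjE; simp; fail)+

text \<open>For \<open>j = k\<close> the next exponent is \<open>alpha\<close>, possibly -
  \<infinity>; a real \<open>\<kappa>\<close> still fits between it and \<open>lam j\<close>. The
  relative codimension \<open>m1 - m0\<close> is the same at all points because both codimensions
  are.\<close>

lemma oseledets_exponent_gap:
  fixes f :: "'a::metric_space \<Rightarrow> 'a" and A :: "'a \<Rightarrow> ('b::banach \<Rightarrow>\<^sub>L 'b)"
  assumes X: "compact (UNIV :: 'a set)" and f: "continuous_on UNIV f"
    and E: "ergodic_invariant_measure M f"
    and B: "separable_space (euclidean :: 'b topology)"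
    and A: "continuous_on UNIV A" "\<And>x. norm (A x) \<le> exp C"
    and O: "oseledets_filtration M f A alpha X0 k lam V" and j: "1 \<le> j" "enat j \<le> k"
  obtains \<kappa> m where "exponent_gap M f A X0 (V j) (V (j + 1)) (lam j) \<kappa> C m"
proof -
  note O' = oseledets_filtrationD[OF O]
  note X0 = O'(1-3)
  have jk: "enat j \<le> k + 1" "enat (j + 1) \<le> k + 1" "1 \<le> j + 1"
    using j(2) by (cases k; auto simp: one_enat_def)+
  note nested = O'(11)[OF j] and exact = O'(12)[OF j] and lims = O'(13)[OF j] and eff = O'(14)
  have "exponent k lam alpha (j + 1) < ereal (lam j)"
    using O'(4,5)[of j] j by (auto simp: exponent_def)
  then obtain \<kappa> where \<kappa>: "exponent k lam alpha (j + 1) < ereal \<kappa>" "\<kappa> < lam j"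
    using ereal_dense2 less_ereal.simps(1) by blast
  obtain m0 where m0: "\<And>x. x \<in> X0 \<Longrightarrow> has_codimension (V j x) m0" using O'(9)[OF j(1) jk(1)] by blast
  obtain m1 where m1: "\<And>x. x \<in> X0 \<Longrightarrow> has_codimension (V (j + 1) x) m1" using O'(9)[OF jk(3,2)] by blast
  obtain DX :: "'a set" where DX: "countable_dense DX" using compact_countable_dense[OF X] by blast
  obtain DB :: "'b set" where DB: "countable_dense DB" using separable_countable_dense[OF B] by blast
  have sets: "sets M = sets borel" using ergodic_invariant_measureD(1)[OF E] .
  have vb: "{x\<in>X0. volume_bound p (cocycle f A x n) (V i x) r} \<in> sets M"
    if "1 \<le> i" "enat i \<le> k + 1" "0 \<le> r" for i p n r
    using volume_bound_cocycle_sets[OF sets X0(1) DX DB eff[OF that(1,2)] continuous_on_cocycle[OF f A(1)] that(3)] .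
  have "exponent_gap M f A X0 (V j) (V (j + 1)) (lam j) \<kappa> C (m1 - m0)"
  proof
    fix x assume x: "x \<in> X0"
    have sx: "subspace (V j x)" "subspace (V (j + 1) x)" using O'(7)[OF j(1) jk(1) x] O'(7)[OF jk(3,2) x] .
    show "\<forall>\<^sub>F n in sequentially. \<forall>v\<in>V (j + 1) x. norm (cocycle f A x n v) \<le> exp (real n * \<kappa>) * norm v"
      using elog_limsupD[OF lims[OF x] \<kappa>(1)]
    proof eventually_elim
      case (elim n)
      show ?case
      proof
        fix v assume "v \<in> V (j + 1) x"
        then have "norm (cocycle f A x n v) \<le> norm_restrict (cocycle f A x n) (V (j + 1) x) * norm v"
          by (rule norm_restrict_apply_le[OF sx(2)])
        also have "\<dots> \<le> exp (real n * \<kappa>) * norm v" using elim by (rule mult_right_mono) simp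
        finally show "norm (cocycle f A x n v) \<le> exp (real n * \<kappa>) * norm v" .
      qed
    qed
    show "\<exists>us. length us = m1 - m0 \<and> set us \<subseteq> V j x \<and> indep_mod (V (j + 1) x) us"
      by (rule relative_codimension(1)[OF m0[OF x] m1[OF x] sx nested[OF x]])
    show "length us \<le> m1 - m0" if "set us \<subseteq> V j x" "indep_mod (V (j + 1) x) us" for us
      by (rule relative_codimension(2)[OF m0[OF x] m1[OF x] sx nested[OF x] that])
  qed (use E X0 A(2) O'(7,8,10) j jk nested exact vb \<kappa>(2) in \<open>simp_all del: One_nat_def\<close>)
  then show ?thesis by (rule that)
qed

theorem theorem4p2:
  fixes f :: "'a::metric_space \<Rightarrow> 'a"
    and M :: "'a measure"
    and A :: "'a \<Rightarrow> ('b::banach \<Rightarrow>\<^sub>L 'b)"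
    and \<nu> L :: real
    and alpha :: ereal
    and X0 :: "'a set"
    and k :: enat
    and lam :: "nat \<Rightarrow> real"
    and V :: "nat \<Rightarrow> 'a \<Rightarrow> 'b set"
  assumes "compact (UNIV :: 'a set)"
    and "L-lipschitz_on UNIV f"
    and "ergodic_invariant_measure M f"
    and "separable_space (euclidean :: 'b topology)"
    and "\<not> (\<exists>B :: 'b set. finite B \<and> span B = UNIV)"
    and "\<nu> > 0"
    and "holder_map \<nu> A"
    and "quasi_compact M f A"
    and "has_index_exponent M f A alpha"
    and "oseledets_filtration M f A alpha X0 k lam V"
  shows "\<forall>\<gamma>>0. \<forall>i\<ge>1. enat i \<le> k + 1 \<longrightarrow>
    (\<exists>\<Lambda>. compact \<Lambda> \<and> \<Lambda> \<subseteq> X0 \<and> measure M \<Lambda> > 1 - \<gamma> \<and>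
      (\<exists>C>0. \<exists>\<theta>>0. \<exists>\<delta>>0. \<forall>x\<in>\<Lambda>. \<forall>y\<in>\<Lambda>. dist x y < \<delta> \<longrightarrow>
         d_hat (V i x) (V i y) \<le> C * dist x y powr \<theta>))"
proof (intro allI impI)
  fix \<gamma> :: real and i :: nat
  assume \<gamma>: "\<gamma> > 0" and i: "1 \<le> i" "enat i \<le> k + 1"
  note E = assms(3)
  note D = ergodic_invariant_measureD[OF E]
  interpret finite_measure M by (rule D(3))
  note O' = oseledets_filtrationD[OF assms(10)]
  note X0 = O'(1,2) and V1 = O'(6) and sub = O'(7)
  have jk: "enat j \<le> k" if "j < i" for j
    using that i(2) by (cases k) (auto simp: one_enat_def)
  have nested: "V (j + 1) x \<subseteq> V j x" if "1 \<le> j" "j < i" "x \<in> X0" for j x by (rule O'(11)[OF that(1) jk[OF that(2)] that(3)])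
  have Vi_sub: "V i x \<subseteq> V j x" if "1 \<le> j" "j \<le> i" "x \<in> X0" for j x
    using that(2,1) by (induction j rule: inc_induct) (use nested that(3) in \<open>fastforce+\<close>)

  have f_cont: "continuous_on UNIV f" by (rule lipschitz_on_continuous_on[OF assms(2)])
  have A_cont: "continuous_on UNIV A" by (rule holder_map_continuous[OF assms(7,6)])
  obtain R where R: "\<And>x. norm (A x) \<le> R"
    using compact_imp_bounded[OF compact_continuous_image[OF A_cont assms(1)]] by (auto simp: bounded_iff)
  \<comment> \<open>The bound 2 ensures \<open>a > 1\<close> below, so that the logarithm in the
    choice of the time is positive.\<close>
  define C where "C = ln (max R 2)"
  have "exp C = max R 2" by (simp add: C_def)
  then have A_bound: "norm (A x) \<le> exp C" for x using R[of x] by simp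
  have eC: "exp C \<ge> 2" using \<open>exp C = max R 2\<close> by simp
  obtain c0 where c0: "\<And>x y. norm (A x - A y) \<le> c0 * dist x y powr \<nu>" using assms(7) unfolding holder_map_def by blast
  define c where "c = max c0 0"
  have c: "norm (A x - A y) \<le> c * dist x y powr \<nu>" for x y
    using c0[of x y] mult_right_mono[of c0 c "dist x y powr \<nu>"] by (simp add: c_def)
  define L' where "L' = max L 1"
  have L': "dist (f x) (f y) \<le> L' * dist x y" for x y
    using lipschitz_onD[OF assms(2), of x y] mult_right_mono[of L L' "dist x y"] by (simp add: L'_def)
  define a where "a = (c + exp C) * L' powr \<nu>"
  have L'1: "L' powr \<nu> \<ge> 1" using assms(6) by (simp add: L'_def ge_one_powr_ge_zero)
  have "exp C * 1 \<le> (c + exp C) * L' powr \<nu>" using L'1 by (intro mult_mono) (auto simp: c_def)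
  then have aC: "exp C \<le> a" by (simp add: a_def)
  have diff: "norm (cocycle f A x n - cocycle f A y n) \<le> a ^ n * dist x y powr \<nu>" for x y n
    unfolding a_def by (rule norm_cocycle_diff_le) (use A_bound c L' assms(6) in \<open>auto simp: c_def L'_def\<close>)
  have bound: "norm (cocycle f A x n w) \<le> a ^ n * norm w" for x n w
  proof -
    have "norm (cocycle f A x n w) \<le> exp (real n * C) * norm w"
      by (rule norm_cocycle_apply_le[where A = A, OF A_bound])
    also have "exp (real n * C) = exp C ^ n" by (rule exp_of_nat_mult)
    also have "exp C ^ n * norm w \<le> a ^ n * norm w" using aC by (intro mult_right_mono power_mono) auto
    finally show ?thesis .
  qed

  \<comment> \<open>Each of the \<open>i - 1\<close> splittings may fail on a set of measure less
    than \<open>\<gamma> / (2 * i)\<close>, so all of them hold together outside a set of measure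
    less than \<open>\<gamma>\<close>.\<close>
  define good where "good j G N \<mu> \<kappa> \<longleftrightarrow> \<kappa> < \<mu> \<and> G \<in> sets M \<and> 1 - \<gamma> / (2 * real i) < measure M G \<and>
    (\<forall>x\<in>G. \<forall>n\<ge>N. (\<forall>w\<in>V j x. \<exists>e\<in>V j x. w - e \<in> V (j + 1) x \<and>
        norm e \<le> exp (- (real n * \<mu>)) * norm (cocycle f A x n e)) \<and>
      (\<forall>v\<in>V (j + 1) x. norm (cocycle f A x n v) \<le> exp (real n * \<kappa>) * norm v))" for j G N \<mu> \<kappa>
  have "\<exists>G N \<mu> \<kappa>. good j G N \<mu> \<kappa>" if j: "j \<in> {1..<i}" for j
  proof -
    obtain \<kappa> m where "exponent_gap M f A X0 (V j) (V (j + 1)) (lam j) \<kappa> C m"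
      using oseledets_exponent_gap[OF assms(1) f_cont E assms(4) A_cont A_bound assms(10)] j jk[of j] by auto
    then interpret exponent_gap M f A X0 "V j" "V (j + 1)" "lam j" \<kappa> C m .
    define \<epsilon> where "\<epsilon> = (lam j - \<kappa>) / 2"
    have \<epsilon>: "\<epsilon> > 0" "\<kappa> < lam j - \<epsilon>" using gap by (auto simp: \<epsilon>_def field_simps)
    have "1 - \<gamma> / (2 * real i) < 1" using \<gamma> i by simp
    from uniform_splitting[OF \<epsilon> this] show ?thesis unfolding good_def using \<epsilon>(2) by metis
  qed
  then obtain G N \<mu> \<kappa> where good: "\<And>j. j \<in> {1..<i} \<Longrightarrow> good j (G j) (N j) (\<mu> j) (\<kappa> j)" by metis
  have G: "G j \<in> sets M" "1 - \<gamma> / (2 * real i) < measure M (G j)" if "j \<in> {1..<i}" for j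
    using good[OF that] by (auto simp: good_def)
  define bad where "bad = (\<Union>j\<in>{1..<i}. UNIV - G j)"
  have compl: "UNIV - G j \<in> sets M" if "j \<in> {1..<i}" for j using sets.compl_sets[OF G(1)[OF that]] D(2) by simp
  have bad: "bad \<in> sets M" unfolding bad_def using compl by (intro sets.finite_UN) auto
  have "measure M bad \<le> (\<Sum>j\<in>{1..<i}. measure M (UNIV - G j))"
    unfolding bad_def using compl by (intro finite_measure_subadditive_finite) auto
  also have "\<dots> \<le> (\<Sum>j\<in>{1..<i}. \<gamma> / (2 * real i))"
  proof (rule sum_mono)
    fix j assume j: "j \<in> {1..<i}"
    have "measure M (UNIV - G j) = 1 - measure M (G j)"
      using finite_measure_compl[OF G(1)[OF j]] D by simp
    then show "measure M (UNIV - G j) \<le> \<gamma> / (2 * real i)" using G(2)[OF j] by linarith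
  qed
  also have "\<dots> = real (i - 1) * (\<gamma> / (2 * real i))" by simp
  also have "\<dots> \<le> real i * (\<gamma> / (2 * real i))" using \<gamma> by (intro mult_right_mono) auto
  also have "\<dots> < \<gamma>" using \<gamma> i by simp
  finally have "measure M bad < \<gamma>" .
  moreover have "measure M X0 \<le> measure M (X0 - bad) + measure M bad"
  proof -
    have "measure M X0 \<le> measure M ((X0 - bad) \<union> bad)" using X0 bad by (intro finite_measure_mono) auto
    also have "\<dots> \<le> measure M (X0 - bad) + measure M bad" using X0 bad by (intro measure_Un_le) auto
    finally show ?thesis .
  qed
  ultimately have "1 - \<gamma> < measure M (X0 - bad)" using X0(2) by linarith
  then obtain \<Lambda> where \<Lambda>: "compact \<Lambda>" "\<Lambda> \<subseteq> X0 - bad" "1 - \<gamma> < measure M \<Lambda>"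
    using compact_inner_approx[OF assms(1) D(1,3)] X0(1) bad by (metis sets.Diff)
  have \<Lambda>X0: "x \<in> X0" if "x \<in> \<Lambda>" for x using that \<Lambda>(2) by blast
  have \<Lambda>G: "x \<in> G j" if "x \<in> \<Lambda>" "j \<in> {1..<i}" for x j using that \<Lambda>(2) by (auto simp: bad_def)

  have "holder_near \<Lambda> (V i) (V j)" if "1 \<le> j" "j \<le> i" for j
    using that
  proof (induction j rule: dec_induct)
    case base
    \<comment> \<open>The descent starts trivially, \<open>V 1 x\<close> being the whole
      space.\<close>
    have "infdist u (V 1 x) = 0" if "x \<in> \<Lambda>" for x u using V1[OF \<Lambda>X0[OF that]] by simp
    then show ?case unfolding holder_near_def by (intro exI[of _ 0] exI[of _ 1] conjI) auto
  next
    case (step j)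
    then have j: "j \<in> {1..<i}" by auto
    have g: "\<kappa> j < \<mu> j" "\<And>x n w. x \<in> G j \<Longrightarrow> n \<ge> N j \<Longrightarrow> w \<in> V j x \<Longrightarrow> \<exists>e\<in>V j x. w - e \<in> V (j + 1) x \<and>
        norm e \<le> exp (- (real n * \<mu> j)) * norm (cocycle f A x n e)"
      "\<And>x n v. x \<in> G j \<Longrightarrow> n \<ge> N j \<Longrightarrow> v \<in> V (j + 1) x \<Longrightarrow> norm (cocycle f A x n v) \<le> exp (real n * \<kappa> j) * norm v"
      using good[OF j] unfolding good_def by blast+
    have "1 < a" using aC eC by linarith
    then have "holder_near \<Lambda> (V i) (V (j + 1))"
    proof (rule holder_near_slow_subspace[OF _ assms(6) g(1) diff bound])
      have "enat j \<le> k + 1" using jk[of j] j by (cases k) (auto simp: one_enat_def)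
      then show "subspace (V j x)" if "x \<in> \<Lambda>" for x using sub j \<Lambda>X0[OF that] by auto
      show "V i x \<subseteq> V (j + 1) x" if "x \<in> \<Lambda>" for x using Vi_sub[of "j + 1"] j \<Lambda>X0[OF that] by auto
      show "holder_near \<Lambda> (V i) (V j)" using step by simp
    qed (use g(2,3) \<Lambda>G j in blast)+
    then show ?case by simp
  qed
  then have near: "holder_near \<Lambda> (V i) (V i)" using i(1) by blast
  have "\<exists>w\<in>V i x. norm w = 1" if "x \<in> \<Lambda>" for x
  proof -
    obtain m where "has_codimension (V i x) m" using O'(9)[OF i] \<Lambda>X0[OF \<open>x \<in> \<Lambda>\<close>] by blast
    then show ?thesis using has_codimension_unit_vector[OF assms(5)] sub[OF i \<Lambda>X0[OF that]] by blast
  qed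
  with holder_near_d_hat[OF near] sub[OF i \<Lambda>X0]
  have "\<exists>C>0. \<exists>\<theta>>0. \<exists>\<delta>>0. \<forall>x\<in>\<Lambda>. \<forall>y\<in>\<Lambda>. dist x y < \<delta> \<longrightarrow>
      d_hat (V i x) (V i y) \<le> C * dist x y powr \<theta>" by blast
  then show "\<exists>\<Lambda>. compact \<Lambda> \<and> \<Lambda> \<subseteq> X0 \<and> measure M \<Lambda> > 1 - \<gamma> \<and>
      (\<exists>C>0. \<exists>\<theta>>0. \<exists>\<delta>>0. \<forall>x\<in>\<Lambda>. \<forall>y\<in>\<Lambda>. dist x y < \<delta> \<longrightarrow>
         d_hat (V i x) (V i y) \<le> C * dist x y powr \<theta>)"
    using \<Lambda> by blast
qed

end
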